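(* Let $G:\mathbb R\times\mathbb R^n\to\mathbb R$, $(t,u)\mapsto G(t,u)$, be continuous, $T$-periodic in $t$, and such that $u\mapsto G(t,u)$ is of class $C^2(\mathbb R^n,\mathbb R)$ for every $t\in\mathbb R$. Assume there exist continuous $T$-periodic matrix functions $A(\cdot)$, $B(\cdot)$, with $A(t)$ real symmetric $n\times n$ and $B(t)$ diagonal with entries $b_{ii}(t)$, and exponents $p_i\in[1,\infty]$, $1\le i\le n$, such that $$A(t)\le G_{uu}(t,u)\le B(t)\quad\forall (t,u)\in\mathbb R\times\mathbb R^n,\qquad \int_0^T\langle A(t)k,k\rangle\,dt>0\quad\forall k\in\mathbb R^n\setminus\{0\},$$ and for each $i$: $\|b_{ii}^+\|_{p_i}<\beta_{p_i}^{per}$ if $p_i\in(1,\infty]$, and $\|b_{ii}^+\|_{p_i}\le\beta_{p_i}^{per}$ if $p_i=1$. Then the boundary value problem $$u''(t)+G_u(t,u(t))=0,\ t\in\mathbb R,\qquad u(0)-u(T)=u'(0)-u'(T)=0,$$ has exactly one solution.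
   Context: $G_u$ and $G_{uu}$ denote the gradient and Hessian of $G$ with respect to $u$. For real symmetric $n\times n$ matrices, $C\le D$ means $D-C$ is positive semi-definite. $b^+=\max\{b,0\}$ and $\|\cdot\|_p$ is the $L^p(0,T)$ norm. A solution is a $T$-periodic function $u\in H^1_{loc}(\mathbb R,\mathbb R^n)$ satisfying the equation in the weak (equivalently, a.e.) sense. $\beta_p^{per}$ is defined as follows: let $L_T(\mathbb R,\mathbb R)$ be the set of $T$-periodic $a:\mathbb R\to\mathbb R$ with $a|_{[0,T]}\in L^1(0,T)$ and $\Lambda^{per}=\{a\in L_T(\mathbb R,\mathbb R)\setminus\{0\}: \int_0^T a\ge 0$ and $u''+a(t)u=0$, $u(0)-u(T)=u'(0)-u'(T)=0$, has a nontrivial solution$\}$; then $\beta_p^{per}=\inf\{\|a^+\|_p : a\in\Lambda^{per}\cap L^p(0,T)\}$ for $1\le p\le\infty$. (Known values: $\beta_1^{per}=16/T$, $\beta_\infty^{per}=4\pi^2/T^2$.) *)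

theory Defs
  imports "HOL-Analysis.Analysis"
begin

definition partial_grad :: "(real \<Rightarrow> real^'n \<Rightarrow> real) \<Rightarrow> real \<Rightarrow> real^'n \<Rightarrow> real^'n" where
  "partial_grad G t u = (\<chi> i. frechet_derivative (G t) (at u) (axis i 1))"

definition partial_hess :: "(real \<Rightarrow> real^'n \<Rightarrow> real) \<Rightarrow> real \<Rightarrow> real^'n \<Rightarrow> real^'n^'n" where
  "partial_hess G t u = (\<chi> i j. frechet_derivative (\<lambda>v. partial_grad G t v $ i) (at u) (axis j 1))"

definition C2_in_u :: "(real \<Rightarrow> real^'n \<Rightarrow> real) \<Rightarrow> bool" where
  "C2_in_u G \<longleftrightarrow> (\<forall>t u. G t differentiable (at u))
     \<and> (\<forall>t u. partial_grad G t differentiable (at u))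
     \<and> (\<forall>t. continuous_on UNIV (partial_hess G t))"

definition psd :: "real^'n^'n \<Rightarrow> bool" where
  "psd M \<longleftrightarrow> (\<forall>x. 0 \<le> x \<bullet> (M *v x))"

definition loewner_le :: "real^'n^'n \<Rightarrow> real^'n^'n \<Rightarrow> bool" where
  "loewner_le C D \<longleftrightarrow> psd (D - C)"

definition in_Lp :: "ereal \<Rightarrow> real \<Rightarrow> (real \<Rightarrow> real) \<Rightarrow> bool" where
  "in_Lp p T f \<longleftrightarrow> set_borel_measurable lborel {0..T} f \<and>
     (if p = \<infinity> then (\<exists>C. AE x in lborel. x \<in> {0..T} \<longrightarrow> \<bar>f x\<bar> \<le> C)
      else set_integrable lborel {0..T} (\<lambda>x. \<bar>f x\<bar> powr real_of_ereal p))"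

definition Lp_norm :: "ereal \<Rightarrow> real \<Rightarrow> (real \<Rightarrow> real) \<Rightarrow> real" where
  "Lp_norm p T f = (if p = \<infinity> then Inf {C. 0 \<le> C \<and> (AE x in lborel. x \<in> {0..T} \<longrightarrow> \<bar>f x\<bar> \<le> C)}
     else (LINT x:{0..T}|lborel. \<bar>f x\<bar> powr real_of_ereal p) powr (1 / real_of_ereal p))"

text \<open>Carath\'eodory solutions of u'' + a u = 0 on [0,T] with periodic boundary conditions:
  u is differentiable with derivative v, and v is absolutely continuous with v' = -a u a.e.\<close>
definition periodic_lin_solution :: "real \<Rightarrow> (real \<Rightarrow> real) \<Rightarrow> (real \<Rightarrow> real) \<Rightarrow> bool" where
  "periodic_lin_solution T a u \<longleftrightarrow> (\<exists>v.
     (\<forall>t\<in>{0..T}. (u has_real_derivative v t) (at t within {0..T})) \<and>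
     (\<forall>t\<in>{0..T}. ((\<lambda>s. - a s * u s) has_integral (v t - v 0)) {0..t}) \<and>
     u 0 - u T = 0 \<and> v 0 - v T = 0)"

definition L_T :: "real \<Rightarrow> (real \<Rightarrow> real) set" where
  "L_T T = {a. (\<forall>t. a (t + T) = a t) \<and> set_integrable lborel {0..T} a}"

definition Lambda_per :: "real \<Rightarrow> (real \<Rightarrow> real) set" where
  "Lambda_per T = {a \<in> L_T T. \<not> (AE x in lborel. x \<in> {0..T} \<longrightarrow> a x = 0)
      \<and> 0 \<le> (LINT x:{0..T}|lborel. a x)
      \<and> (\<exists>u. periodic_lin_solution T a u \<and> (\<exists>t\<in>{0..T}. u t \<noteq> 0))}"

definition beta_per :: "ereal \<Rightarrow> real \<Rightarrow> real" where
  "beta_per p T = Inf {Lp_norm p T (\<lambda>t. max (a t) 0) | a. a \<in> Lambda_per T \<and> in_Lp p T a}"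

text \<open>T-periodic u, of class C^1 with u' absolutely continuous and
  u'' + G_u(t,u) = 0 a.e., u(0)-u(T) = u'(0)-u'(T) = 0.\<close>
definition is_periodic_solution :: "(real \<Rightarrow> real^'n \<Rightarrow> real) \<Rightarrow> real \<Rightarrow> (real \<Rightarrow> real^'n) \<Rightarrow> bool" where
  "is_periodic_solution G T u \<longleftrightarrow> (\<forall>t. u (t + T) = u t) \<and> (\<exists>u'.
     (\<forall>t. (u has_vector_derivative u' t) (at t)) \<and>
     (\<forall>t1 t2. t1 \<le> t2 \<longrightarrow>
        ((\<lambda>s. - partial_grad G s (u s)) has_integral (u' t2 - u' t1)) {t1..t2}) \<and>
     u 0 - u T = 0 \<and> u' 0 - u' T = 0)"

end

theory Submission
  imports Defs "HOL-Complex_Analysis.Great_Picard"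
begin

text \<open>
  The difference \<open>w\<close> of two solutions satisfies \<open>w'' + C(t) w = 0\<close> with \<open>C\<close> symmetric and \<open>A \<le> C \<le> B\<close>, so for
  every constant vector \<open>k\<close>
  \<open>\<integral>\<bar>w'\<bar>\<^sup>2 = \<integral>\<langle>C(w + k), w + k\<rangle> - \<integral>\<langle>C k, k\<rangle> \<le> \<integral>\<langle>B(w + k), w + k\<rangle> - \<integral>\<langle>A k, k\<rangle>\<close>.
  As \<open>B\<close> is diagonal, the components of \<open>k\<close> can be chosen one by one so that
  \<open>\<integral>b\<^sub>i\<^sub>i(w\<^sub>i + k\<^sub>i)\<^sup>2 \<le> \<integral>w\<^sub>i'\<^sup>2\<close>, strictly unless \<open>w\<^sub>i' = 0\<close>. For \<open>p\<^sub>i = 1\<close> one centres the range of \<open>w\<^sub>i\<close> and uses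
  \<open>\<beta>\<^sub>1 \<le> 16/T\<close>; for \<open>p\<^sub>i > 1\<close> one centres \<open>w\<^sub>i\<close> with respect to the weight \<open>b\<^sub>i\<^sub>i\<^sup>+\<close>, whose first nonzero periodic
  eigenvalue exceeds \<open>1\<close> by the definition of \<open>\<beta>\<^sub>p\<close>. Hence \<open>k = 0\<close>, then \<open>w\<close> is constant, then \<open>w = 0\<close>.

  For existence, \<open>\<Phi>\<close> denotes the period map minus the identity on initial data. The inequality for \<open>w\<close> passes to
  uniform limits, so by compactness \<open>\<bar>\<Phi>(x) - \<Phi>(y)\<bar> \<ge> c \<bar>x - y\<bar>\<close> for some \<open>c > 0\<close>. Invariance of domain makes \<open>\<Phi>\<close>
  surjective, and a zero of \<open>\<Phi>\<close> is the initial value of a periodic solution.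
\<close>

section \<open>Differentiable functions on a compact interval\<close>

text \<open>The inequality for \<open>w\<close> needs no averaged matrix. For a symmetric
  \<open>C\<close> one has \<open><C w, w + 2 k> = <C (w + k), w + k> - <C k, k>\<close>, so it is
  enough to test the increment of \<open>G_u\<close> against the single vector
  \<open>w + 2 k\<close>. The scalar mean value theorem then supplies a Hessian at one point,
  depending on \<open>t\<close> and \<open>k\<close>, with no measurability question. Integrating
  \<open>w''\<close> against \<open>w + 2 k\<close> over a period leaves only the energy of
  \<open>w\<close>, because \<open>w''\<close> has mean zero.

  The free constant \<open>k\<close> cannot be dropped: \<open>A \<le> B\<close> and the positivity
  of \<open>A\<close> give every \<open>b_ii\<close> a positive integral, so the integral of
  \<open>b_ii f\<^sup>2\<close> exceeds that of \<open>f'\<^sup>2\<close> for constant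
  \<open>f \<noteq> 0\<close>. The constants \<open>beta\<close> control centred functions, and
  \<open>A\<close> controls the shift that the centring introduces.

  In the case \<open>p = 1\<close> equality is allowed. Strictness is recovered there because the
  extremal of the oscillation inequality, a triangular wave, has corners and so is not of class
  C1.\<close>

definition C1_on :: "real \<Rightarrow> real \<Rightarrow> (real \<Rightarrow> 'a::real_normed_vector) \<Rightarrow> (real \<Rightarrow> 'a) \<Rightarrow> bool" where
  "C1_on a b f f' \<longleftrightarrow> continuous_on {a..b} f' \<and>
     (\<forall>t\<in>{a..b}. (f has_vector_derivative f' t) (at t within {a..b}))"

lemma C1_on_continuous:
  assumes "C1_on a b f f'"
  shows "continuous_on {a..b} f" "continuous_on {a..b} f'"
  using assms unfolding C1_on_def
  by (auto simp: continuous_on_eq_continuous_within intro: has_vector_derivative_continuous)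

lemma C1_on_subset:
  assumes "C1_on a b f f'" "{c..d} \<subseteq> {a..b}"
  shows "C1_on c d f f'"
  using assms unfolding C1_on_def
  by (meson continuous_on_subset has_vector_derivative_within_subset in_mono)

lemma C1_on_integral:
  fixes f :: "real \<Rightarrow> 'a::banach"
  assumes "C1_on a b f f'" "a \<le> b"
  shows "(f' has_integral (f b - f a)) {a..b}" "integral {a..b} f' = f b - f a"
proof -
  show "(f' has_integral (f b - f a)) {a..b}"
    using assms unfolding C1_on_def by (intro fundamental_theorem_of_calculus) auto
  then show "integral {a..b} f' = f b - f a" by (rule integral_unique)
qed

lemma C1_on_diff:
  assumes "C1_on a b f f'" "C1_on a b g g'"
  shows "C1_on a b (\<lambda>t. f t - g t) (\<lambda>t. f' t - g' t)"
  using assms unfolding C1_on_def by (auto intro!: continuous_intros derivative_intros)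

lemma C1_on_add_const:
  assumes "C1_on a b f f'"
  shows "C1_on a b (\<lambda>t. f t + k) f'"
  using assms unfolding C1_on_def by (auto intro!: derivative_eq_intros)

lemma C1_on_scale:
  fixes f :: "real \<Rightarrow> real"
  assumes "C1_on a b f f'"
  shows "C1_on a b (\<lambda>t. c * f t) (\<lambda>t. c * f' t)"
  using assms unfolding C1_on_def
  by (auto intro!: continuous_intros derivative_eq_intros)

text \<open>Both parts come from expanding the integral of \<open>(f' - c)\<^sup>2\<close>, which is
  nonnegative and, by continuity, vanishes only if \<open>f' = c\<close> throughout. The slope
  \<open>c\<close> stays free so that different slopes can be prescribed on adjacent
  intervals.\<close>

lemma C1_on_square_integral_ge:
  fixes f :: "real \<Rightarrow> real"
  assumes f: "C1_on a b f f'" and ab: "a \<le> b"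
  shows "2 * c * (f b - f a) - c\<^sup>2 * (b - a) \<le> integral {a..b} (\<lambda>t. (f' t)\<^sup>2)"
    and "a < b \<Longrightarrow> integral {a..b} (\<lambda>t. (f' t)\<^sup>2) = 2 * c * (f b - f a) - c\<^sup>2 * (b - a)
          \<Longrightarrow> t \<in> {a..b} \<Longrightarrow> f' t = c"
proof -
  note ct = C1_on_continuous[OF f]
  have "integral {a..b} (\<lambda>t. (f' t - c)\<^sup>2)
      = integral {a..b} (\<lambda>t. ((f' t)\<^sup>2 - 2 * c * f' t) + c\<^sup>2)"
    by (intro integral_cong) (simp add: power2_eq_square algebra_simps)
  also have "\<dots> = integral {a..b} (\<lambda>t. (f' t)\<^sup>2 - 2 * c * f' t) + integral {a..b} (\<lambda>t. c\<^sup>2)"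
    by (intro integral_add integrable_continuous_real continuous_intros ct)
  also have "\<dots> = integral {a..b} (\<lambda>t. (f' t)\<^sup>2) - integral {a..b} (\<lambda>t. 2 * c * f' t) + c\<^sup>2 * (b - a)"
    using ab by (subst integral_diff) (auto intro!: integrable_continuous_real continuous_intros ct)
  also have "integral {a..b} (\<lambda>t. 2 * c * f' t) = 2 * c * (f b - f a)"
    using C1_on_integral[OF f ab] by simp
  finally have eq: "integral {a..b} (\<lambda>t. (f' t - c)\<^sup>2)
      = integral {a..b} (\<lambda>t. (f' t)\<^sup>2) - (2 * c * (f b - f a) - c\<^sup>2 * (b - a))" by simp
  have "0 \<le> integral {a..b} (\<lambda>t. (f' t - c)\<^sup>2)"
    by (intro integral_nonneg integrable_continuous_real continuous_intros ct) auto
  then show "2 * c * (f b - f a) - c\<^sup>2 * (b - a) \<le> integral {a..b} (\<lambda>t. (f' t)\<^sup>2)"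
    using eq by simp
  show "f' t = c" if "a < b" "t \<in> {a..b}"
    "integral {a..b} (\<lambda>t. (f' t)\<^sup>2) = 2 * c * (f b - f a) - c\<^sup>2 * (b - a)"
  proof -
    have "integral {a..b} (\<lambda>t. (f' t - c)\<^sup>2) = 0" using that eq by simp
    moreover have "continuous_on {a..b} (\<lambda>t. (f' t - c)\<^sup>2)" by (intro continuous_intros ct)
    ultimately have "(f' t - c)\<^sup>2 = 0"
      using that integral_eq_0_iff[of a b "\<lambda>t. (f' t - c)\<^sup>2"] by auto
    then show ?thesis by simp
  qed
qed

text \<open>The preceding bound at its best slope, the mean slope of \<open>f\<close>. This is
  Cauchy-Schwarz for \<open>f'\<close> against the constant 1.\<close>

lemma C1_on_increment_le:
  fixes f :: "real \<Rightarrow> real"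
  assumes f: "C1_on a b f f'" and ab: "a \<le> b"
  shows "(f b - f a)\<^sup>2 \<le> (b - a) * integral {a..b} (\<lambda>t. (f' t)\<^sup>2)"
proof (cases "a = b")
  case False
  define c where "c = (f b - f a) / (b - a)"
  have "(b - a) * (2 * c * (f b - f a) - c\<^sup>2 * (b - a)) \<le> (b - a) * integral {a..b} (\<lambda>t. (f' t)\<^sup>2)"
    using C1_on_square_integral_ge(1)[OF f ab, of c] ab by (intro mult_left_mono) auto
  moreover have "(b - a) * (2 * c * (f b - f a) - c\<^sup>2 * (b - a)) = (f b - f a)\<^sup>2"
  proof -
    have c: "(b - a) * c = f b - f a" using False by (simp add: c_def)
    have "(b - a) * (2 * c * (f b - f a) - c\<^sup>2 * (b - a))
        = 2 * ((b - a) * c) * (f b - f a) - ((b - a) * c)\<^sup>2"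
      by (simp add: power2_eq_square algebra_simps)
    then show ?thesis unfolding c by (simp add: power2_eq_square)
  qed
  ultimately show ?thesis by simp
qed auto

lemma C1_on_increment_le_subinterval:
  fixes f :: "real \<Rightarrow> real"
  assumes f: "C1_on a b f f'" and st: "s \<in> {a..b}" "t \<in> {a..b}"
  shows "(f t - f s)\<^sup>2 \<le> \<bar>t - s\<bar> * integral {a..b} (\<lambda>t. (f' t)\<^sup>2)"
proof -
  have *: "(f t - f s)\<^sup>2 \<le> (t - s) * integral {a..b} (\<lambda>t. (f' t)\<^sup>2)"
    if "s \<le> t" "s \<in> {a..b}" "t \<in> {a..b}" for s t
  proof -
    have fs: "C1_on s t f f'" using C1_on_subset[OF f] that by auto
    have "(f t - f s)\<^sup>2 \<le> (t - s) * integral {s..t} (\<lambda>t. (f' t)\<^sup>2)"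
      using C1_on_increment_le[OF fs] that by simp
    also have "\<dots> \<le> (t - s) * integral {a..b} (\<lambda>t. (f' t)\<^sup>2)"
      using that C1_on_continuous[OF f] C1_on_continuous[OF fs]
      by (intro mult_left_mono integral_subset_le integrable_continuous_real continuous_intros) auto
    finally show ?thesis .
  qed
  show ?thesis
  proof (cases "s \<le> t")
    case False
    have "(f t - f s)\<^sup>2 = (f s - f t)\<^sup>2" by (simp add: power2_commute)
    with *[of t s] False st show ?thesis by simp
  qed (use *[of s t] st in auto)
qed

lemma C1_on_deriv_zero_const:
  fixes f :: "real \<Rightarrow> 'a::real_normed_vector"
  assumes f: "C1_on a b f f'" and z: "\<forall>t\<in>{a..b}. f' t = 0" and "s \<in> {a..b}" "t \<in> {a..b}"
  shows "f t = f s"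
proof -
  have "(f has_vector_derivative 0) (at x within {a..b})" if "x \<in> {a..b}" for x
    using f z that unfolding C1_on_def by metis
  then obtain c where "\<And>x. x \<in> {a..b} \<Longrightarrow> f x = c"
    using has_vector_derivative_zero_constant[of "{a..b}" f] by auto
  then show ?thesis using assms by auto
qed

text \<open>The comparison slopes \<open>\<plusminus>2 (f t - f s) / T\<close> are those of the triangular wave through the two extrema.\<close>

lemma C1_on_oscillation:
  fixes f :: "real \<Rightarrow> real"
  assumes T: "0 < T" and f: "C1_on 0 T f f'" and per: "f 0 = f T"
    and st: "0 \<le> s" "s < t" "t \<le> T" and ne: "f s \<noteq> f t"
  shows "4 * (f t - f s)\<^sup>2 / T < integral {0..T} (\<lambda>t. (f' t)\<^sup>2)"
proof -
  define c where "c = 2 * (f t - f s) / T"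
  let ?I = "\<lambda>a b. integral {a..b} (\<lambda>t. (f' t)\<^sup>2)"
  have c0: "c \<noteq> 0" using ne T by (simp add: c_def)
  have f1: "C1_on 0 s f f'" and f2: "C1_on s t f f'" and f3: "C1_on t T f f'"
    using C1_on_subset[OF f] st by auto
  have int: "(\<lambda>t. (f' t)\<^sup>2) integrable_on {0..T}"
    by (intro integrable_continuous_real continuous_intros C1_on_continuous[OF f])
  have i1: "?I 0 T = ?I 0 s + ?I s T"
    using Henstock_Kurzweil_Integration.integral_combine[OF _ _ int, of s] st by simp
  have int2: "(\<lambda>t. (f' t)\<^sup>2) integrable_on {s..T}"
    using integrable_on_subinterval[OF int, of s T] st by simp
  have i2: "?I s T = ?I s t + ?I t T"
    using Henstock_Kurzweil_Integration.integral_combine[OF _ _ int2, of t] st by simp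
  note g1 = C1_on_square_integral_ge[OF f1, of "-c"]
  note g2 = C1_on_square_integral_ge[OF f2, of c]
  note g3 = C1_on_square_integral_ge[OF f3, of "-c"]
  let ?r1 = "2 * (-c) * (f s - f 0) - (-c)\<^sup>2 * (s - 0)"
  let ?r2 = "2 * c * (f t - f s) - c\<^sup>2 * (t - s)"
  let ?r3 = "2 * (-c) * (f T - f t) - (-c)\<^sup>2 * (T - t)"
  have cT: "c * T = 2 * (f t - f s)" using T by (simp add: c_def)
  have "?r1 + ?r2 + ?r3 = 4 * c * (f t - f s) - c * (c * T)"
    using per by (simp add: algebra_simps power2_eq_square)
  also have "\<dots> = 4 * (f t - f s)\<^sup>2 / T"
    unfolding cT by (simp add: c_def power2_eq_square field_simps)
  finally have sum: "?r1 + ?r2 + ?r3 = 4 * (f t - f s)\<^sup>2 / T" .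
  have le: "?r1 \<le> ?I 0 s" "?r2 \<le> ?I s t" "?r3 \<le> ?I t T" using g1(1) g2(1) g3(1) st by auto
  \<comment> \<open>Equality on all three pieces would force the slopes \<open>-c\<close>,
    \<open>c\<close>, \<open>-c\<close>, which clash at \<open>s\<close> and at \<open>t\<close>. If
    \<open>s = 0\<close>, the first piece is degenerate; then \<open>t < T\<close>, since
    \<open>t = T\<close> would give \<open>f s = f t\<close> by periodicity, and the clash at
    \<open>t\<close> remains.\<close>
  have "\<not> (?I 0 s = ?r1 \<and> ?I s t = ?r2 \<and> ?I t T = ?r3)"
  proof
    assume e: "?I 0 s = ?r1 \<and> ?I s t = ?r2 \<and> ?I t T = ?r3"
    have A: "f' s = c" "f' t = c" using g2(2)[of s] g2(2)[of t] e st by auto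
    show False
    proof (cases "s = 0")
      case False
      then have "f' s = - c" using g1(2)[of s] e st by auto
      then show False using A c0 by simp
    next
      case True
      then have "t < T" using st ne per by (cases "t = T") auto
      then have "f' t = - c" using g3(2)[of t] e st by auto
      then show False using A c0 by simp
    qed
  qed
  then show ?thesis using le sum i1 i2 by linarith
qed

text \<open>The shift \<open>k\<close> moves the maximum and the minimum of \<open>f\<close> to
  \<open>R\<close> and \<open>-R\<close>. An oscillation of \<open>2 * R\<close> turns the factor
  \<open>4 / T\<close> into \<open>16 / T\<close>, the known value of beta_1.\<close>

lemma C1_on_square_integral_ge_midrange:
  fixes f :: "real \<Rightarrow> real"
  assumes T: "0 < T" and f: "C1_on 0 T f f'" and per: "f 0 = f T"
    and nz: "\<not> (\<forall>t\<in>{0..T}. f' t = 0)"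
  obtains k R where "\<And>t. t \<in> {0..T} \<Longrightarrow> \<bar>f t + k\<bar> \<le> R" "R > 0"
    "16 / T * R\<^sup>2 < integral {0..T} (\<lambda>t. (f' t)\<^sup>2)"
proof -
  have ne: "{0..T} \<noteq> {}" using T by auto
  obtain x where x: "x \<in> {0..T}" "\<forall>t\<in>{0..T}. f t \<le> f x"
    using continuous_attains_sup[OF compact_Icc ne C1_on_continuous(1)[OF f]] by auto
  obtain y where y: "y \<in> {0..T}" "\<forall>t\<in>{0..T}. f y \<le> f t"
    using continuous_attains_inf[OF compact_Icc ne C1_on_continuous(1)[OF f]] by auto
  have "f x \<noteq> f y"
  proof
    assume eq: "f x = f y"
    have "f' t = 0" if t: "t \<in> {0..T}" for t
    proof -
      have c: "f s = f x" if "s \<in> {0..T}" for s using bspec[OF x(2) that] bspec[OF y(2) that] eq by simp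
      have "(f has_vector_derivative 0) (at t within {0..T})"
        by (rule has_vector_derivative_transform[OF t, where f = "\<lambda>_. f x"])
           (use c in \<open>auto intro!: derivative_eq_intros\<close>)
      moreover have "(f has_vector_derivative f' t) (at t within {0..T})"
        using f t by (auto simp: C1_on_def)
      ultimately show ?thesis
        using vector_derivative_unique_within_closed_interval[OF T, of t f "f' t" 0] t by simp
    qed
    then show False using nz by auto
  qed
  moreover have "f y \<le> f x" using x y by auto
  ultimately have lt: "f y < f x" by simp
  then have "x \<noteq> y" by auto
  define R where "R = (f x - f y) / 2"
  define k where "k = - (f x + f y) / 2"
  have "4 * (f (max x y) - f (min x y))\<^sup>2 / T < integral {0..T} (\<lambda>t. (f' t)\<^sup>2)"
    using x y lt \<open>x \<noteq> y\<close> by (intro C1_on_oscillation[OF T f per]) (auto simp: max_def min_def)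
  moreover have "(f (max x y) - f (min x y))\<^sup>2 = (2 * R)\<^sup>2"
  proof -
    have "2 * R = f x - f y" unfolding R_def by simp
    then show ?thesis using power2_commute[of "f x" "f y"] by (simp add: max_def min_def)
  qed
  ultimately have "16 / T * R\<^sup>2 < integral {0..T} (\<lambda>t. (f' t)\<^sup>2)"
    by (simp add: power2_eq_square)
  moreover have "\<bar>f t + k\<bar> \<le> R" if "t \<in> {0..T}" for t
    using bspec[OF x(2) that] bspec[OF y(2) that] unfolding k_def R_def abs_le_iff
    by (simp add: field_simps)
  moreover have "R > 0" using lt by (simp add: R_def)
  ultimately show ?thesis using that by blast
qed

section \<open>The first periodic eigenvalue\<close>

lemma C1_on_mult:
  fixes f g :: "real \<Rightarrow> real"
  assumes f: "C1_on a b f f'" and g: "C1_on a b g g'"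
  shows "C1_on a b (\<lambda>t. f t * g t) (\<lambda>t. f' t * g t + f t * g' t)"
  using assms C1_on_continuous[OF f] C1_on_continuous[OF g] unfolding C1_on_def
  by (auto intro!: continuous_intros derivative_eq_intros)

lemma C1_on_primitive:
  fixes g :: "real \<Rightarrow> 'a::banach"
  assumes "continuous_on {a..b} g"
  shows "C1_on a b (\<lambda>t. integral {a..t} g) g"
  unfolding C1_on_def
  by (intro conjI ballI assms) (rule integral_has_vector_derivative[OF assms])

lemma C1_on_cong:
  assumes "C1_on a b f f'" "\<And>t. t \<in> {a..b} \<Longrightarrow> f' t = g' t"
  shows "C1_on a b f g'"
  using assms continuous_on_eq[of "{a..b}" f' g'] by (auto simp: C1_on_def)

lemma integral_weighted_nonzero:
  fixes q f :: "real \<Rightarrow> real"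
  assumes T: "0 < T" and q: "continuous_on {0..T} q" "\<And>t. t \<in> {0..T} \<Longrightarrow> 0 \<le> q t"
    "integral {0..T} q \<noteq> 0"
    and f: "continuous_on {0..T} f" and pos: "\<And>t. t \<in> {0..T} \<Longrightarrow> 0 < f t"
  shows "integral {0..T} (\<lambda>t. q t * f t) \<noteq> 0"
proof
  assume "integral {0..T} (\<lambda>t. q t * f t) = 0"
  moreover have "continuous_on {0..T} (\<lambda>t. q t * f t)" by (intro continuous_intros q f)
  moreover have "0 \<le> q t * f t" if "t \<in> {0..T}" for t
    using q(2)[OF that] pos[OF that] by simp
  ultimately have *: "\<forall>t\<in>{0..T}. q t * f t = 0"
    using integral_eq_0_iff[of 0 T "\<lambda>t. q t * f t"] T by simp
  have "q t = 0" if "t \<in> {0..T}" for t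
    using bspec[OF * that] pos[OF that] by simp
  then have "integral {0..T} q = integral {0..T} (\<lambda>t. 0)" by (intro integral_cong)
  then show False using q(3) by simp
qed

text \<open>A zero mean with respect to a nonnegative weight of positive mass excludes a strict
  sign, hence \<open>f\<close> has a zero. The increment bound started at that zero gives a Poincare
  inequality, even if the weight vanishes on part of the interval.\<close>

lemma weighted_mean_zero_bound:
  fixes q f :: "real \<Rightarrow> real"
  assumes T: "0 < T" and q: "continuous_on {0..T} q" "\<And>t. t \<in> {0..T} \<Longrightarrow> 0 \<le> q t"
    "integral {0..T} q \<noteq> 0"
    and f: "C1_on 0 T f f'" and mean: "integral {0..T} (\<lambda>t. q t * f t) = 0"
    and t: "t \<in> {0..T}"
  shows "(f t)\<^sup>2 \<le> T * integral {0..T} (\<lambda>t. (f' t)\<^sup>2)"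
proof -
  note cf = C1_on_continuous[OF f]
  have "\<not> (\<forall>s\<in>{0..T}. 0 < f s)"
    using integral_weighted_nonzero[OF T q cf(1)] mean by blast
  then obtain s1 where s1: "s1 \<in> {0..T}" "f s1 \<le> 0" by force
  have "integral {0..T} (\<lambda>t. q t * - f t) = 0" using mean by simp
  then have "\<not> (\<forall>s\<in>{0..T}. 0 < - f s)"
    using integral_weighted_nonzero[OF T q continuous_on_minus[OF cf(1)]] by blast
  then obtain s2 where s2: "s2 \<in> {0..T}" "0 \<le> f s2" by force
  have "is_interval (f ` {0..T})"
    using connected_continuous_image[OF cf(1)] by (simp add: is_interval_connected_1)
  then have "0 \<in> f ` {0..T}"
    using mem_is_interval_1_I[of "f ` {0..T}" "f s1" "f s2" 0] s1 s2 by blast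
  then obtain s where s: "s \<in> {0..T}" "f s = 0" by auto
  have E: "0 \<le> integral {0..T} (\<lambda>t. (f' t)\<^sup>2)"
    by (intro integral_nonneg integrable_continuous_real continuous_intros cf) auto
  have "(f t - f s)\<^sup>2 \<le> \<bar>t - s\<bar> * integral {0..T} (\<lambda>t. (f' t)\<^sup>2)"
    by (rule C1_on_increment_le_subinterval[OF f s(1) t])
  also have "\<dots> \<le> T * integral {0..T} (\<lambda>t. (f' t)\<^sup>2)"
    using s t E by (intro mult_right_mono) auto
  finally show ?thesis using s by simp
qed

text \<open>Solves \<open>-h'' = q g\<close> by two integrations. The mean condition on
  \<open>g\<close> is the solvability condition that makes \<open>h'\<close> periodic; the constant
  \<open>c\<close> makes \<open>h\<close> periodic, and \<open>d\<close> normalises its weighted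
  mean.\<close>

lemma periodic_potential:
  fixes q g :: "real \<Rightarrow> real"
  assumes T: "0 < T" and q: "continuous_on {0..T} q" "integral {0..T} q \<noteq> 0"
    and g: "continuous_on {0..T} g" and mean: "integral {0..T} (\<lambda>t. q t * g t) = 0"
  obtains h h' where "C1_on 0 T h h'" "C1_on 0 T h' (\<lambda>t. - (q t * g t))" "h 0 = h T" "h' 0 = h' T"
    "integral {0..T} (\<lambda>t. q t * h t) = 0"
proof -
  define h0 where "h0 = (\<lambda>t. integral {0..t} (\<lambda>t. - (q t * g t)))"
  define c where "c = - integral {0..T} h0 / T"
  define h' where "h' = (\<lambda>t. h0 t + c)"
  define h1 where "h1 = (\<lambda>t. integral {0..t} h')"
  define d where "d = - integral {0..T} (\<lambda>t. q t * h1 t) / integral {0..T} q"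
  define h where "h = (\<lambda>t. h1 t + d)"
  have C0: "C1_on 0 T h0 (\<lambda>t. - (q t * g t))"
    unfolding h0_def by (intro C1_on_primitive continuous_intros q g)
  have C': "C1_on 0 T h' (\<lambda>t. - (q t * g t))"
    unfolding h'_def by (rule C1_on_add_const[OF C0])
  have C1: "C1_on 0 T h1 h'"
    unfolding h1_def by (intro C1_on_primitive C1_on_continuous(1)[OF C'])
  have Ch: "C1_on 0 T h h'" unfolding h_def by (rule C1_on_add_const[OF C1])
  have "h1 T = integral {0..T} h0 + c * T"
    unfolding h1_def h'_def using T
    by (subst integral_add)
      (auto intro!: integrable_continuous_real continuous_intros C1_on_continuous(1)[OF C0])
  also have "\<dots> = 0" using T by (simp add: c_def)
  finally have h1T: "h1 T = 0" .
  have "integral {0..T} (\<lambda>t. q t * h t) = integral {0..T} (\<lambda>t. q t * h1 t + q t * d)"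
    by (simp add: h_def distrib_left)
  also have "\<dots> = integral {0..T} (\<lambda>t. q t * h1 t) + integral {0..T} q * d"
    by (subst integral_add)
      (auto intro!: integrable_continuous_real continuous_intros q C1_on_continuous(1)[OF C1])
  also have "\<dots> = 0" using q by (simp add: d_def)
  finally have "integral {0..T} (\<lambda>t. q t * h t) = 0" .
  moreover have "h 0 = h T" using h1T by (simp add: h_def) (simp add: h1_def)
  moreover have "h' 0 = h' T" using mean by (simp add: h'_def h0_def)
  ultimately show ?thesis using that Ch C' by blast
qed

lemma C1_on_periodic_by_parts:
  fixes f h' :: "real \<Rightarrow> real"
  assumes T: "0 \<le> T" and h': "C1_on 0 T h' h''" and f: "C1_on 0 T f f'"
    and per: "f 0 = f T" "h' 0 = h' T"
  shows "integral {0..T} (\<lambda>t. h' t * f' t) = integral {0..T} (\<lambda>t. - h'' t * f t)"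
proof -
  note ct = C1_on_continuous[OF f] C1_on_continuous[OF h']
  have "integral {0..T} (\<lambda>t. h'' t * f t + h' t * f' t) = 0"
    using C1_on_integral(2)[OF C1_on_mult[OF h' f] T] per by simp
  moreover have "integral {0..T} (\<lambda>t. h'' t * f t + h' t * f' t)
      = integral {0..T} (\<lambda>t. h'' t * f t) + integral {0..T} (\<lambda>t. h' t * f' t)"
    by (intro integral_add integrable_continuous_real continuous_intros ct)
  ultimately show ?thesis by simp
qed

lemma integral_square_diff:
  fixes w f h :: "real \<Rightarrow> real"
  assumes "continuous_on {a..b} w" "continuous_on {a..b} f" "continuous_on {a..b} h"
  shows "integral {a..b} (\<lambda>t. w t * (f t - c * h t)\<^sup>2)
    = integral {a..b} (\<lambda>t. w t * (f t)\<^sup>2) - 2 * c * integral {a..b} (\<lambda>t. w t * (f t * h t))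
      + c\<^sup>2 * integral {a..b} (\<lambda>t. w t * (h t)\<^sup>2)"
proof -
  have *: "(F has_integral integral {a..b} F) {a..b}" if "continuous_on {a..b} F" for F :: "real \<Rightarrow> real"
    using that integrable_continuous_real by (auto intro!: integrable_integral)
  have "((\<lambda>t. w t * (f t)\<^sup>2 - 2 * c * (w t * (f t * h t)) + c\<^sup>2 * (w t * (h t)\<^sup>2)) has_integral
      (integral {a..b} (\<lambda>t. w t * (f t)\<^sup>2) - 2 * c * integral {a..b} (\<lambda>t. w t * (f t * h t))
      + c\<^sup>2 * integral {a..b} (\<lambda>t. w t * (h t)\<^sup>2))) {a..b}"
    by (intro has_integral_add has_integral_diff has_integral_mult_right * continuous_intros assms)
  moreover have "(\<lambda>t. w t * (f t)\<^sup>2 - 2 * c * (w t * (f t * h t)) + c\<^sup>2 * (w t * (h t)\<^sup>2))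
      = (\<lambda>t. w t * (f t - c * h t)\<^sup>2)"
    by (simp add: fun_eq_iff power2_eq_square algebra_simps)
  ultimately show ?thesis by (simp add: integral_unique)
qed

lemma uniform_limit_integral_tendsto:
  fixes F :: "nat \<Rightarrow> real \<Rightarrow> 'a::banach"
  assumes "uniform_limit {a..b} F g sequentially" "\<And>n. continuous_on {a..b} (F n)"
  shows "(\<lambda>n. integral {a..b} (F n)) \<longlonglongrightarrow> integral {a..b} g"
proof -
  obtain I J where *: "\<And>n. (F n has_integral I n) {a..b}" "(g has_integral J) {a..b}" "I \<longlonglongrightarrow> J"
    using uniform_limit_integral[OF assms] by auto
  show ?thesis using *(3) unfolding integral_unique[OF *(1)] integral_unique[OF *(2)] .
qed

lemma LIMSEQ_zero_of_square_le:
  fixes a b :: "nat \<Rightarrow> real"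
  assumes "\<And>n. (a n)\<^sup>2 \<le> b n" "b \<longlonglongrightarrow> 0"
  shows "a \<longlonglongrightarrow> 0"
proof -
  have "(\<lambda>n. (a n)\<^sup>2) \<longlonglongrightarrow> 0"
    by (rule tendsto_sandwich[OF _ _ tendsto_const assms(2)]) (auto intro: always_eventually assms(1))
  then have "(\<lambda>n. sqrt ((a n)\<^sup>2)) \<longlonglongrightarrow> sqrt 0" by (rule tendsto_real_sqrt)
  then show ?thesis by (simp add: tendsto_rabs_zero_iff)
qed

text \<open>Minimises the Rayleigh quotient \<open>\<integral>f'\<^sup>2 / \<integral>q f\<^sup>2\<close>. No weak compactness is needed: if \<open>f\<close> is nearly
  minimal and \<open>h\<close> solves \<open>-h'' = q f\<close>, then \<open>f - \<lambda> h\<close> is small in \<open>H\<^sup>1\<close>, and uniform compactness of the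
  minimising sequence suffices.\<close>

lemma first_periodic_eigenvalue:
  fixes q f0 :: "real \<Rightarrow> real"
  assumes T: "0 < T" and q: "continuous_on {0..T} q" "\<And>t. t \<in> {0..T} \<Longrightarrow> 0 \<le> q t"
    and Q0: "integral {0..T} q \<noteq> 0"
    and f0: "C1_on 0 T f0 f0'" "f0 0 = f0 T" "integral {0..T} (\<lambda>t. q t * f0 t) = 0"
      "integral {0..T} (\<lambda>t. (f0' t)\<^sup>2) \<le> integral {0..T} (\<lambda>t. q t * (f0 t)\<^sup>2)"
      "\<not> (\<forall>t\<in>{0..T}. f0' t = 0)"
  obtains l u u' where "0 < l" "l \<le> 1" "C1_on 0 T u u'" "C1_on 0 T u' (\<lambda>t. - (l * q t) * u t)"
    "u 0 = u T" "u' 0 = u' T" "\<exists>t\<in>{0..T}. u t \<noteq> 0"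
proof -
  \<comment> \<open>\<open>X\<close> is the admissible class, \<open>E\<close> the Dirichlet energy,
    \<open>N\<close> the weighted square norm. The zero weighted mean in \<open>X\<close> removes
    the eigenvalue 0, whose eigenfunctions are the constants.\<close>
  define X where "X f f' \<longleftrightarrow> C1_on 0 T f f' \<and> f 0 = f T \<and> integral {0..T} (\<lambda>t. q t * f t) = 0"
    for f f' :: "real \<Rightarrow> real"
  define E where "E f' = integral {0..T} (\<lambda>t. (f' t)\<^sup>2)" for f' :: "real \<Rightarrow> real"
  define N where "N f = integral {0..T} (\<lambda>t. q t * (f t)\<^sup>2)" for f :: "real \<Rightarrow> real"
  define Q where "Q = integral {0..T} q"
  have Qpos: "0 < Q"
    using Q0 integral_nonneg[OF integrable_continuous_real[OF q(1)] q(2)] by (auto simp: Q_def)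
  have Xc: "continuous_on {0..T} f" "continuous_on {0..T} f'" if "X f f'" for f f'
    using that C1_on_continuous by (auto simp: X_def)
  have E_nonneg: "0 \<le> E f'" if "X f f'" for f f'
    unfolding E_def by (intro integral_nonneg integrable_continuous_real continuous_intros Xc[OF that]) auto
  have N_nonneg: "0 \<le> N f" if "continuous_on {0..T} f" for f
    unfolding N_def using q by (intro integral_nonneg integrable_continuous_real continuous_intros that q) auto
  have X_bound: "(f t)\<^sup>2 \<le> T * E f'" if "X f f'" "t \<in> {0..T}" for f f' t
    using weighted_mean_zero_bound[OF T q Q0] that by (auto simp: X_def E_def)
  have N_le: "N f \<le> T * Q * E f'" if X: "X f f'" for f f'
  proof -
    have "N f \<le> integral {0..T} (\<lambda>t. q t * (T * E f'))"
      unfolding N_def using X_bound[OF X] q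
      by (intro integral_le integrable_continuous_real continuous_intros Xc[OF X] q mult_left_mono) auto
    also have "\<dots> = T * Q * E f'" by (simp add: Q_def)
    finally show ?thesis .
  qed
  have X_scale: "X (\<lambda>t. c * f t) (\<lambda>t. c * f' t)" if "X f f'" for c f f'
  proof -
    have "integral {0..T} (\<lambda>t. q t * (c * f t)) = integral {0..T} (\<lambda>t. c * (q t * f t))"
      by (simp add: algebra_simps)
    also have "\<dots> = 0" using that by (simp add: X_def)
    finally show ?thesis using that by (auto simp: X_def intro: C1_on_scale)
  qed
  have X_diff: "X (\<lambda>t. f t - h t) (\<lambda>t. f' t - h' t)" if f: "X f f'" and h: "X h h'" for f f' h h'
  proof -
    have "integral {0..T} (\<lambda>t. q t * (f t - h t))
        = integral {0..T} (\<lambda>t. q t * f t) - integral {0..T} (\<lambda>t. q t * h t)"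
      unfolding right_diff_distrib
      by (intro integral_diff integrable_continuous_real continuous_intros Xc[OF f] Xc[OF h] q)
    then show ?thesis using f h by (auto simp: X_def intro: C1_on_diff)
  qed
  have E_scale: "E (\<lambda>t. c * f' t) = c\<^sup>2 * E f'" for c f'
    by (simp add: E_def power_mult_distrib)
  have N_scale: "N (\<lambda>t. c * f t) = c\<^sup>2 * N f" for c f
  proof -
    have "N (\<lambda>t. c * f t) = integral {0..T} (\<lambda>t. c\<^sup>2 * (q t * (f t)\<^sup>2))"
      by (simp add: N_def power_mult_distrib algebra_simps)
    then show ?thesis by (simp add: N_def)
  qed
  define S where "S = {E f' | f f'. X f f' \<and> N f = 1}"
  define l where "l = Inf S"
  have X0: "X f0 f0'" using f0 by (simp add: X_def)
  have "E f0' \<noteq> 0"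
  proof
    assume "E f0' = 0"
    then have "\<forall>t\<in>{0..T}. (f0' t)\<^sup>2 = 0"
      using integral_eq_0_iff[of 0 T "\<lambda>t. (f0' t)\<^sup>2"] T Xc[OF X0]
      by (auto simp: E_def intro!: continuous_intros)
    then show False using f0(5) by simp
  qed
  then have E0: "0 < E f0'" using E_nonneg[OF X0] by simp
  have N0: "E f0' \<le> N f0" using f0(4) by (simp add: E_def N_def)
  have normalize: "E f' / N f \<in> S" if X: "X f f'" and "0 < N f" for f f'
  proof -
    define c where "c = 1 / sqrt (N f)"
    have c2: "c\<^sup>2 = 1 / N f" using that by (simp add: c_def power_divide)
    have "E (\<lambda>t. c * f' t) \<in> S"
      unfolding S_def
    proof (intro CollectI exI conjI)
      show "X (\<lambda>t. c * f t) (\<lambda>t. c * f' t)" by (rule X_scale[OF X])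
      show "N (\<lambda>t. c * f t) = 1" using c2 that by (simp add: N_scale)
    qed simp
    then show ?thesis by (simp add: E_scale c2)
  qed
  have S_ne: "E f0' / N f0 \<in> S" using normalize[OF X0] E0 N0 by simp
  have bdd: "bdd_below S" unfolding S_def by (rule bdd_belowI[of _ 0]) (use E_nonneg in auto)
  \<comment> \<open>The trial function \<open>f0\<close> has quotient at most 1. Positivity of
    \<open>l\<close> below is the Poincare inequality in the form \<open>N_le\<close>.\<close>
  have l1: "l \<le> 1"
  proof -
    have "l \<le> E f0' / N f0" unfolding l_def by (rule cInf_lower[OF S_ne bdd])
    also have "\<dots> \<le> 1" using E0 N0 by simp
    finally show ?thesis .
  qed
  have l_pos: "0 < l"
  proof -
    have "1 / (T * Q) \<le> l"
      unfolding l_def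
    proof (rule cInf_greatest)
      fix x assume "x \<in> S"
      then obtain f f' where "x = E f'" "X f f'" "N f = 1" by (auto simp: S_def)
      then show "1 / (T * Q) \<le> x" using N_le[of f f'] T Qpos by (simp add: field_simps)
    qed (use S_ne in auto)
    moreover have "0 < 1 / (T * Q)" using T Qpos by simp
    ultimately show ?thesis by linarith
  qed
  have l_le: "l * N f \<le> E f'" if X: "X f f'" for f f'
  proof (cases "N f = 0")
    case True
    then show ?thesis using E_nonneg[OF X] by simp
  next
    case False
    then have pos: "0 < N f" using N_nonneg[OF Xc(1)[OF X]] by simp
    then have "l \<le> E f' / N f" unfolding l_def using normalize[OF X] bdd by (intro cInf_lower) auto
    then show ?thesis using pos by (simp add: field_simps)
  qed
  have "\<exists>f f'. X f f' \<and> N f = 1 \<and> E f' < l + 1 / real (Suc n)" for n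
  proof -
    have "\<exists>x\<in>S. x < l + 1 / real (Suc n)"
      using S_ne bdd by (subst cInf_less_iff[symmetric]) (auto simp: l_def)
    then show ?thesis by (auto simp: S_def)
  qed
  then obtain F F' where F: "\<And>n. X (F n) (F' n)" "\<And>n. N (F n) = 1" "\<And>n. E (F' n) < l + 1 / real (Suc n)"
    by metis
  have potential: "\<exists>h h'. X h h' \<and> C1_on 0 T h' (\<lambda>t. - (q t * g t)) \<and> h' 0 = h' T"
    if "continuous_on {0..T} g" "integral {0..T} (\<lambda>t. q t * g t) = 0" for g
    using periodic_potential[OF T q(1) Q0 that] unfolding X_def by metis
  have "\<exists>h h'. X h h' \<and> C1_on 0 T h' (\<lambda>t. - (q t * F n t)) \<and> h' 0 = h' T" for n
    using potential[OF Xc(1)[OF F(1)]] F(1)[of n] unfolding X_def by auto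
  then obtain H H' where H: "\<And>n. X (H n) (H' n)" "\<And>n. C1_on 0 T (H' n) (\<lambda>t. - (q t * F n t))"
    "\<And>n. H' n 0 = H' n T" by metis
  have E_le: "E (F' n) \<le> l + 1" for n
  proof -
    have "1 / real (Suc n) \<le> 1" by simp
    then show ?thesis using F(3)[of n] by linarith
  qed
  \<comment> \<open>Bounded energy gives a common Hoelder modulus of exponent 1/2, which is the
    equicontinuity that Arzela-Ascoli needs.\<close>
  have equi: "(F n x - F n y)\<^sup>2 \<le> \<bar>x - y\<bar> * (l + 1)" if "x \<in> {0..T}" "y \<in> {0..T}" for n x y
  proof -
    have "(F n x - F n y)\<^sup>2 \<le> \<bar>x - y\<bar> * E (F' n)"
      using C1_on_increment_le_subinterval[of 0 T "F n" "F' n" y x] F(1)[of n] that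
      by (simp add: X_def E_def)
    also have "\<dots> \<le> \<bar>x - y\<bar> * (l + 1)" using E_le by (intro mult_left_mono) auto
    finally show ?thesis .
  qed
  obtain g k where g: "continuous_on {0..T} g" and k: "strict_mono (k :: nat \<Rightarrow> nat)"
    and conv: "\<And>e. 0 < e \<Longrightarrow> \<exists>N. \<forall>n x. n \<ge> N \<and> x \<in> {0..T} \<longrightarrow> norm (F (k n) x - g x) < e"
  proof (rule Arzela_Ascoli[of "{0..T}" F "sqrt (T * (l + 1))"])
    fix n x assume x: "x \<in> {0..T}"
    have "(F n x)\<^sup>2 \<le> T * (l + 1)"
      using X_bound[OF F(1) x, of n] mult_left_mono[OF E_le[of n], of T] T by linarith
    then have "\<bar>F n x\<bar>\<^sup>2 \<le> T * (l + 1)" by simp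
    then show "norm (F n x) \<le> sqrt (T * (l + 1))" unfolding real_norm_def by (rule real_le_rsqrt)
  next
    fix x e :: real assume x: "x \<in> {0..T}" and e: "0 < e"
    have "norm (F n x - F n y) < e" if "y \<in> {0..T}" "norm (x - y) < e\<^sup>2 / (l + 1)" for n y
    proof -
      have "\<bar>x - y\<bar> * (l + 1) < e\<^sup>2" using that l_pos by (simp add: field_simps)
      then have "(F n x - F n y)\<^sup>2 < e\<^sup>2" using equi[OF x that(1), of n] by linarith
      then have "\<bar>F n x - F n y\<bar>\<^sup>2 < e\<^sup>2" by simp
      then show ?thesis unfolding real_norm_def by (rule power2_less_imp_less) (use e in simp)
    qed
    moreover have "0 < e\<^sup>2 / (l + 1)" using e l_pos by simp
    ultimately show "\<exists>d>0. \<forall>n y. y \<in> {0..T} \<and> norm (x - y) < d \<longrightarrow> norm (F n x - F n y) < e" by blast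
  qed auto
  have ul: "uniform_limit {0..T} (\<lambda>n. F (k n)) g sequentially"
    unfolding uniform_limit_sequentially_iff dist_norm using conv by blast
  have bq: "bounded (q ` {0..T})" "bounded (g ` {0..T})"
    using compact_continuous_image[OF q(1)] compact_continuous_image[OF g] compact_imp_bounded by auto
  have ulq: "uniform_limit {0..T} (\<lambda>n t. q t * F (k n) t) (\<lambda>t. q t * g t) sequentially"
    by (intro uniform_lim_mult uniform_limit_const ul bq)
  have bqg: "bounded ((\<lambda>t. q t * g t) ` {0..T})"
    by (intro compact_imp_bounded compact_continuous_image continuous_intros q g) auto
  have "uniform_limit {0..T} (\<lambda>n t. (q t * F (k n) t) * F (k n) t) (\<lambda>t. (q t * g t) * g t) sequentially"
    by (intro uniform_lim_mult ulq ul bq bqg)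
  then have "(\<lambda>n. integral {0..T} (\<lambda>t. (q t * F (k n) t) * F (k n) t))
      \<longlonglongrightarrow> integral {0..T} (\<lambda>t. (q t * g t) * g t)"
    by (rule uniform_limit_integral_tendsto) (intro continuous_intros q Xc[OF F(1)])
  then have "(\<lambda>n. N (F (k n))) \<longlonglongrightarrow> N g"
    by (simp add: N_def power2_eq_square mult.assoc)
  then have Ng: "N g = 1" using F(2) by (simp add: LIMSEQ_const_iff)
  have "(\<lambda>n. integral {0..T} (\<lambda>t. q t * F (k n) t)) \<longlonglongrightarrow> integral {0..T} (\<lambda>t. q t * g t)"
    using ulq by (rule uniform_limit_integral_tendsto) (intro continuous_intros q Xc[OF F(1)])
  then have mg: "integral {0..T} (\<lambda>t. q t * g t) = 0"
    using F(1) by (simp add: X_def LIMSEQ_const_iff)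
  have uld: "uniform_limit {0..T} (\<lambda>n t. F (k n) t - g t) (\<lambda>t. g t - g t) sequentially"
    by (intro uniform_limit_minus ul uniform_limit_const)
  then have "uniform_limit {0..T} (\<lambda>n t. q t * ((F (k n) t - g t) * (F (k n) t - g t)))
      (\<lambda>t. q t * ((g t - g t) * (g t - g t))) sequentially"
    by (intro uniform_lim_mult uniform_limit_const bq) (auto simp: bounded_iff)
  then have "(\<lambda>n. integral {0..T} (\<lambda>t. q t * ((F (k n) t - g t) * (F (k n) t - g t))))
      \<longlonglongrightarrow> integral {0..T} (\<lambda>t. q t * ((g t - g t) * (g t - g t)))"
    by (rule uniform_limit_integral_tendsto) (intro continuous_intros q Xc[OF F(1)] g)
  then have Nd: "(\<lambda>n. N (\<lambda>t. F (k n) t - g t)) \<longlonglongrightarrow> 0"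
    by (simp add: N_def power2_eq_square)
  obtain h h' where h: "X h h'" "C1_on 0 T h' (\<lambda>t. - (q t * g t))" "h' 0 = h' T"
    using potential[OF g mg] by auto
  have parts: "integral {0..T} (\<lambda>t. h' t * f' t) = integral {0..T} (\<lambda>t. q t * (g t * f t))"
    if "C1_on 0 T h' (\<lambda>t. - (q t * g t))" "h' 0 = h' T" "X f f'" for g h' f f'
    using C1_on_periodic_by_parts[of T h' _ f f'] that T by (simp add: X_def mult.assoc)
  have E_diff: "E (\<lambda>t. f' t - c * h' t) = E f' - 2 * c * integral {0..T} (\<lambda>t. f' t * h' t) + c\<^sup>2 * E h'"
    if "continuous_on {0..T} f'" "continuous_on {0..T} h'" for f' h' c
    using integral_square_diff[of 0 T "\<lambda>_. 1" f' h' c] that by (simp add: E_def)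
  have N_diff: "N (\<lambda>t. f t - c * h t) = N f - 2 * c * integral {0..T} (\<lambda>t. q t * (f t * h t)) + c\<^sup>2 * N h"
    if "continuous_on {0..T} f" "continuous_on {0..T} h" for f h c
    using integral_square_diff[of 0 T q f h c] that q by (simp add: N_def)
  \<comment> \<open>Integration by parts gives \<open><F', H'> = N F = 1\<close> and
    \<open>E H' = m\<close>. Nonnegativity of \<open>N (F - l H)\<close> together with
    \<open>l * N H \<le> E H'\<close> yields \<open>l * m \<le> 1\<close>, so the expanded energy
    \<open>E F' - 2 l + l\<^sup>2 m\<close> is at most \<open>E F' - l\<close>, the gap of
    \<open>F\<close> to the infimum.\<close>
  have near: "E (\<lambda>t. F' n t - l * H' n t) \<le> 1 / real (Suc n)" for n
  proof -
    note XF = F(1)[of n] and XH = H(1)[of n]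
    define m where "m = integral {0..T} (\<lambda>t. q t * (F n t * H n t))"
    have EH: "E (H' n) = m"
      using parts[OF H(2) H(3) XH] by (simp add: E_def m_def power2_eq_square)
    have cross: "integral {0..T} (\<lambda>t. F' n t * H' n t) = 1"
      using parts[OF H(2) H(3) XF] F(2)[of n] by (simp add: N_def power2_eq_square mult.commute)
    have "0 \<le> N (\<lambda>t. F n t - l * H n t)"
      by (intro N_nonneg continuous_intros Xc[OF XF] Xc[OF XH])
    also have "\<dots> = 1 - 2 * l * m + l * (l * N (H n))"
      using N_diff[OF Xc(1)[OF XF] Xc(1)[OF XH], of l] F(2)[of n]
      by (simp add: m_def power2_eq_square)
    also have "l * (l * N (H n)) \<le> l * m"
      using l_le[OF XH] l_pos EH by (intro mult_left_mono) auto
    finally have "l * m \<le> 1" by simp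
    then have "l * (l * m) \<le> l * 1" using l_pos by (intro mult_left_mono) auto
    then show ?thesis
      using E_diff[OF Xc(2)[OF XF] Xc(2)[OF XH], of l] F(3)[of n] cross EH
      by (simp add: power2_eq_square)
  qed
  \<comment> \<open>Stability of the potential in the energy norm. Expanding
    \<open>N (f - c d)\<close> with \<open>c = 1 / (T Q)\<close>, the reciprocal of the Poincare
    constant, replaces Cauchy-Schwarz for the product \<open>f d\<close>.\<close>
  have dist: "E (\<lambda>t. H' n t - h' t) \<le> T * Q * N (\<lambda>t. F n t - g t)" for n
  proof -
    define d d' where "d = (\<lambda>t. H n t - h t)" and "d' = (\<lambda>t. H' n t - h' t)"
    define f where "f = (\<lambda>t. F n t - g t)"
    have Xd: "X d d'" unfolding d_def d'_def by (rule X_diff[OF H(1) h(1)])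
    have cd: "C1_on 0 T d' (\<lambda>t. - (q t * f t))"
      using C1_on_diff[OF H(2)[of n] h(2)] by (simp add: d'_def f_def algebra_simps)
    have cf: "continuous_on {0..T} f" unfolding f_def by (intro continuous_intros Xc[OF F(1)] g)
    have Ed: "E d' = integral {0..T} (\<lambda>t. q t * (f t * d t))"
      using parts[OF cd _ Xd] H(3)[of n] h(3) by (simp add: d'_def E_def power2_eq_square)
    define c where "c = 1 / (T * Q)"
    have TQ: "0 < T * Q" using T Qpos by simp
    have "0 \<le> N (\<lambda>t. f t - c * d t)"
      by (intro N_nonneg continuous_intros cf Xc[OF Xd])
    also have "\<dots> = N f - 2 * c * E d' + c * (c * N d)"
      using N_diff[OF cf Xc(1)[OF Xd], of c] Ed by (simp add: power2_eq_square)
    also have "c * (c * N d) \<le> c * E d'"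
      using N_le[OF Xd] TQ unfolding c_def by (intro mult_left_mono) (auto simp: field_simps)
    finally have "c * E d' \<le> N f" by simp
    then show ?thesis using TQ by (simp add: c_def d'_def f_def field_simps)
  qed
  \<comment> \<open>\<open>F - l H\<close> and \<open>H - h\<close> both tend to 0 along the
    subsequence. Hence the limit \<open>g\<close>, so far only continuous, is a multiple of the
    twice differentiable \<open>h\<close>, and \<open>-h'' = q g\<close> becomes the eigenvalue
    equation for \<open>h\<close>.\<close>
  have g_eq: "g t = l * h t" if t: "t \<in> {0..T}" for t
  proof -
    have "(\<lambda>n. T * (1 / real (Suc (k n)))) \<longlonglongrightarrow> T * 0"
      using LIMSEQ_subseq_LIMSEQ[OF LIMSEQ_inverse_real_of_nat k]
      by (intro tendsto_mult tendsto_const) (simp add: o_def inverse_eq_divide)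
    moreover have "(F (k n) t - l * H (k n) t)\<^sup>2 \<le> T * (1 / real (Suc (k n)))" for n
      by (rule order_trans[OF X_bound[OF X_diff[OF F(1) X_scale[OF H(1)]] t] mult_left_mono[OF near]])
        (use T in simp)
    ultimately have 1: "(\<lambda>n. F (k n) t - l * H (k n) t) \<longlonglongrightarrow> 0"
      using LIMSEQ_zero_of_square_le[where b = "\<lambda>n. T * (1 / real (Suc (k n)))"] by simp
    have "(\<lambda>n. T * (T * Q * N (\<lambda>t. F (k n) t - g t))) \<longlonglongrightarrow> T * (T * Q * 0)"
      by (intro tendsto_intros Nd)
    moreover have "(H (k n) t - h t)\<^sup>2 \<le> T * (T * Q * N (\<lambda>t. F (k n) t - g t))" for n
      by (rule order_trans[OF X_bound[OF X_diff[OF H(1) h(1)] t] mult_left_mono[OF dist]])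
        (use T in simp)
    ultimately have "(\<lambda>n. H (k n) t - h t) \<longlonglongrightarrow> 0"
      using LIMSEQ_zero_of_square_le[where b = "\<lambda>n. T * (T * Q * N (\<lambda>t. F (k n) t - g t))"] by simp
    then have "(\<lambda>n. l * (H (k n) t - h t)) \<longlonglongrightarrow> l * 0" by (intro tendsto_intros)
    from tendsto_add[OF 1 this] have "(\<lambda>n. F (k n) t - l * h t) \<longlonglongrightarrow> 0"
      by (simp add: algebra_simps)
    then have "(\<lambda>n. F (k n) t) \<longlonglongrightarrow> l * h t" by (simp add: LIM_zero_iff)
    moreover have "(\<lambda>n. F (k n) t) \<longlonglongrightarrow> g t" by (rule tendsto_uniform_limitI[OF ul t])
    ultimately show ?thesis using LIMSEQ_unique by blast
  qed
  have "C1_on 0 T h' (\<lambda>t. - (l * q t) * h t)"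
    using h(2) by (rule C1_on_cong) (simp add: g_eq)
  \<comment> \<open>The normalisation \<open>N g = 1\<close> survived the uniform limit, which
    excludes \<open>h = 0\<close>.\<close>
  moreover have "\<exists>t\<in>{0..T}. h t \<noteq> 0"
  proof (rule ccontr)
    assume "\<not> ?thesis"
    then have "\<forall>t\<in>{0..T}. q t * (g t)\<^sup>2 = 0" using g_eq by simp
    then have "N g = integral {0..T} (\<lambda>t. 0)" unfolding N_def by (intro integral_cong) auto
    then show False using Ng by simp
  qed
  ultimately show ?thesis using that[OF l_pos l1, of h h'] h by (auto simp: X_def)
qed

section \<open>The constants beta\<close>

text \<open>Serves to bound from below the set whose infimum is \<open>beta_per\<close>. For
  \<open>p = \<infinity>\<close> the membership hypothesis makes the set of essential bounds
  nonempty, so that its \<open>Inf\<close> is a genuine infimum.\<close>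

lemma Lp_norm_nonneg:
  assumes "in_Lp p T a"
  shows "0 \<le> Lp_norm p T (\<lambda>t. max (a t) 0)"
proof (cases "p = \<infinity>")
  case True
  then obtain C where C: "AE x in lborel. x \<in> {0..T} \<longrightarrow> \<bar>a x\<bar> \<le> C"
    using assms by (auto simp: in_Lp_def)
  have "AE x in lborel. x \<in> {0..T} \<longrightarrow> \<bar>max (a x) 0\<bar> \<le> \<bar>C\<bar>"
    using C by (rule eventually_mono) auto
  then have "{C. 0 \<le> C \<and> (AE x in lborel. x \<in> {0..T} \<longrightarrow> \<bar>max (a x) 0\<bar> \<le> C)} \<noteq> {}"
    using abs_ge_zero by blast
  then have "0 \<le> Inf {C. 0 \<le> C \<and> (AE x in lborel. x \<in> {0..T} \<longrightarrow> \<bar>max (a x) 0\<bar> \<le> C)}"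
    by (rule cInf_greatest) auto
  then show ?thesis using True by (simp add: Lp_norm_def)
qed (simp add: Lp_norm_def)

lemma beta_per_le:
  assumes "a \<in> Lambda_per T" "in_Lp p T a"
  shows "beta_per p T \<le> Lp_norm p T (\<lambda>t. max (a t) 0)"
  unfolding beta_per_def
proof (rule cInf_lower)
  show "bdd_below {Lp_norm p T (\<lambda>t. max (a t) 0) |a. a \<in> Lambda_per T \<and> in_Lp p T a}"
    by (rule bdd_belowI[of _ 0]) (auto intro: Lp_norm_nonneg)
qed (use assms in blast)

lemma Lp_norm_mono_continuous:
  fixes a q :: "real \<Rightarrow> real"
  assumes p: "1 \<le> p" and a: "continuous_on {0..T} a" and q: "continuous_on {0..T} q"
    and le: "\<And>t. t \<in> {0..T} \<Longrightarrow> 0 \<le> a t" "\<And>t. t \<in> {0..T} \<Longrightarrow> a t \<le> q t"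
  shows "in_Lp p T a" "Lp_norm p T a \<le> Lp_norm p T q"
proof -
  have meas: "set_borel_measurable lborel {0..T} a"
    using borel_integrable_atLeastAtMost'[OF a]
    by (simp add: set_integrable_def set_borel_measurable_def borel_measurable_integrable)
  have bdd: "\<exists>C\<ge>0. \<forall>x\<in>{0..T}. \<bar>f x\<bar> \<le> C" if "continuous_on {0..T} f" for f :: "real \<Rightarrow> real"
  proof -
    have "bounded (f ` {0..T})"
      by (intro compact_imp_bounded compact_continuous_image that) simp
    then obtain C where "\<forall>x\<in>{0..T}. \<bar>f x\<bar> \<le> C" by (auto simp: bounded_iff)
    then have "\<forall>x\<in>{0..T}. \<bar>f x\<bar> \<le> \<bar>C\<bar>" by force
    then show ?thesis by (intro exI[of _ "\<bar>C\<bar>"]) simp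
  qed
  show "in_Lp p T a"
  proof (cases "p = \<infinity>")
    case True
    obtain C where "\<forall>x\<in>{0..T}. \<bar>a x\<bar> \<le> C" using bdd[OF a] by auto
    then have "AE x in lborel. x \<in> {0..T} \<longrightarrow> \<bar>a x\<bar> \<le> C" by simp
    then show ?thesis using True meas by (auto simp: in_Lp_def)
  next
    case False
    define r where "r = real_of_ereal p"
    have r: "1 \<le> r" using p False unfolding r_def by (cases p) auto
    have "continuous_on {0..T} (\<lambda>x. \<bar>a x\<bar> powr r)"
      using r by (intro continuous_on_powr' continuous_intros a) auto
    then show ?thesis
      using meas False borel_integrable_atLeastAtMost' by (auto simp: in_Lp_def r_def)
  qed
  show "Lp_norm p T a \<le> Lp_norm p T q"
  proof (cases "p = \<infinity>")
    case True
    obtain C where "0 \<le> C" "\<forall>x\<in>{0..T}. \<bar>q x\<bar> \<le> C" using bdd[OF q] by auto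
    then have "C \<in> {C. 0 \<le> C \<and> (AE x in lborel. x \<in> {0..T} \<longrightarrow> \<bar>q x\<bar> \<le> C)}" by simp
    then have ne: "{C. 0 \<le> C \<and> (AE x in lborel. x \<in> {0..T} \<longrightarrow> \<bar>q x\<bar> \<le> C)} \<noteq> {}" by blast
    have "Inf {C. 0 \<le> C \<and> (AE x in lborel. x \<in> {0..T} \<longrightarrow> \<bar>a x\<bar> \<le> C)}
        \<le> Inf {C. 0 \<le> C \<and> (AE x in lborel. x \<in> {0..T} \<longrightarrow> \<bar>q x\<bar> \<le> C)}"
    proof (rule cInf_superset_mono[OF ne])
      show "bdd_below {C. 0 \<le> C \<and> (AE x in lborel. x \<in> {0..T} \<longrightarrow> \<bar>a x\<bar> \<le> C)}"
        by (rule bdd_belowI[of _ 0]) simp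
      have "AE x in lborel. x \<in> {0..T} \<longrightarrow> \<bar>a x\<bar> \<le> C"
        if "AE x in lborel. x \<in> {0..T} \<longrightarrow> \<bar>q x\<bar> \<le> C" for C
        using that
      proof (rule eventually_mono)
        fix x assume *: "x \<in> {0..T} \<longrightarrow> \<bar>q x\<bar> \<le> C"
        show "x \<in> {0..T} \<longrightarrow> \<bar>a x\<bar> \<le> C"
        proof
          assume x: "x \<in> {0..T}"
          show "\<bar>a x\<bar> \<le> C" using le(1)[OF x] le(2)[OF x] * x by simp
        qed
      qed
      then show "{C. 0 \<le> C \<and> (AE x in lborel. x \<in> {0..T} \<longrightarrow> \<bar>q x\<bar> \<le> C)}
          \<subseteq> {C. 0 \<le> C \<and> (AE x in lborel. x \<in> {0..T} \<longrightarrow> \<bar>a x\<bar> \<le> C)}" by blast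
    qed
    then show ?thesis using True by (simp add: Lp_norm_def)
  next
    case False
    define r where "r = real_of_ereal p"
    have r: "1 \<le> r" using p False unfolding r_def by (cases p) auto
    have si: "set_integrable lborel {0..T} (\<lambda>x. \<bar>f x\<bar> powr r)" if "continuous_on {0..T} f" for f :: "real \<Rightarrow> real"
      using r by (intro borel_integrable_atLeastAtMost' continuous_on_powr' continuous_intros that) auto
    have "(LINT x:{0..T}|lborel. \<bar>a x\<bar> powr r) \<le> (LINT x:{0..T}|lborel. \<bar>q x\<bar> powr r)"
    proof (rule set_integral_mono[OF si[OF a] si[OF q]])
      fix x assume x: "x \<in> {0..T}"
      show "\<bar>a x\<bar> powr r \<le> \<bar>q x\<bar> powr r"
        using le(1)[OF x] le(2)[OF x] r by (intro powr_mono2) auto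
    qed
    moreover have "0 \<le> (LINT x:{0..T}|lborel. \<bar>a x\<bar> powr r)"
      unfolding set_lebesgue_integral_def by (rule integral_nonneg_AE) (simp add: indicator_def)
    ultimately have "(LINT x:{0..T}|lborel. \<bar>a x\<bar> powr r) powr (1 / r)
        \<le> (LINT x:{0..T}|lborel. \<bar>q x\<bar> powr r) powr (1 / r)"
      using r by (intro powr_mono2) auto
    then show ?thesis using False by (simp add: Lp_norm_def r_def)
  qed
qed

lemma Lp_norm_1_continuous:
  fixes q :: "real \<Rightarrow> real"
  assumes q: "continuous_on {0..T} q" "\<And>t. t \<in> {0..T} \<Longrightarrow> 0 \<le> q t"
  shows "Lp_norm 1 T q = integral {0..T} q"
proof -
  have "(LINT x:{0..T}|lborel. \<bar>q x\<bar> powr 1) = (LINT x:{0..T}|lborel. q x)"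
    by (rule set_lebesgue_integral_cong) (use q(2) in auto)
  also have "\<dots> = integral {0..T} q"
    by (rule set_borel_integral_eq_integral[OF borel_integrable_atLeastAtMost'[OF q(1)]])
  finally have "(LINT x:{0..T}|lborel. \<bar>q x\<bar> powr 1) = integral {0..T} q" .
  moreover have "0 \<le> integral {0..T} q"
    using q by (intro integral_nonneg integrable_continuous_real) auto
  ultimately show ?thesis by (simp add: Lp_norm_def)
qed

text \<open>The potential \<open>l q\<close> lies in \<open>Lambda_per\<close> with eigenfunction
  \<open>u\<close>, and \<open>l \<le> 1\<close> puts it pointwise below \<open>q\<close>. It
  therefore competes in the infimum with a norm no larger than that of \<open>q\<close>.\<close>

lemma beta_per_le_of_eigenvalue:
  fixes q :: "real \<Rightarrow> real"
  assumes T: "0 < T" and q: "continuous_on UNIV q" "\<And>t. 0 \<le> q t" "\<And>t. q (t + T) = q t"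
    and Q: "integral {0..T} q \<noteq> 0" and p: "1 \<le> p"
    and l: "0 < l" "l \<le> 1" and u: "C1_on 0 T u u'" "C1_on 0 T u' (\<lambda>t. - (l * q t) * u t)"
    "u 0 = u T" "u' 0 = u' T" "\<exists>t\<in>{0..T}. u t \<noteq> 0"
  shows "beta_per p T \<le> Lp_norm p T q"
proof -
  define a where "a = (\<lambda>t. l * q t)"
  have ca: "continuous_on {0..T} a"
    unfolding a_def by (intro continuous_intros continuous_on_subset[OF q(1)]) auto
  have cq: "continuous_on {0..T} q" by (rule continuous_on_subset[OF q(1)]) simp
  have a0: "0 \<le> a t" for t using q(2)[of t] l by (simp add: a_def)
  have aq: "a t \<le> q t" for t using q(2)[of t] l by (simp add: a_def mult_left_le_one_le)
  have int: "(LINT x:{0..T}|lborel. a x) = l * integral {0..T} q"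
    using set_borel_integral_eq_integral(2)[OF borel_integrable_atLeastAtMost'[OF ca]]
    by (simp add: a_def)
  have sol: "periodic_lin_solution T a u"
    unfolding periodic_lin_solution_def
  proof (intro exI[of _ u'] conjI ballI)
    fix t assume t: "t \<in> {0..T}"
    show "(u has_real_derivative u' t) (at t within {0..T})"
      using u(1) t by (auto simp: C1_on_def has_real_derivative_iff_has_vector_derivative)
    have "C1_on 0 t u' (\<lambda>t. - (l * q t) * u t)" by (rule C1_on_subset[OF u(2)]) (use t in auto)
    then show "((\<lambda>s. - a s * u s) has_integral u' t - u' 0) {0..t}"
      using C1_on_integral(1)[of 0 t u'] t unfolding a_def by auto
  qed (use u in auto)
  have "\<not> (AE x in lborel. x \<in> {0..T} \<longrightarrow> a x = 0)"
  proof
    assume "AE x in lborel. x \<in> {0..T} \<longrightarrow> a x = 0"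
    then have "AE x in lborel. indicator {0..T} x *\<^sub>R a x = 0"
      by (rule eventually_mono) (auto simp: indicator_def)
    then have "(LINT x:{0..T}|lborel. a x) = 0"
      unfolding set_lebesgue_integral_def by (rule integral_eq_zero_AE)
    then show False using int Q l by simp
  qed
  moreover have "0 \<le> (LINT x:{0..T}|lborel. a x)"
    using int l integral_nonneg[OF integrable_continuous_real[OF cq]] q(2) by simp
  moreover have "a \<in> L_T T"
    using borel_integrable_atLeastAtMost'[OF ca] q(3) by (simp add: L_T_def a_def)
  ultimately have "a \<in> Lambda_per T"
    using sol u(5) by (auto simp: Lambda_per_def)
  moreover have "(\<lambda>t. max (a t) 0) = a" using a0 by (auto simp: fun_eq_iff)
  moreover have "in_Lp p T a" "Lp_norm p T a \<le> Lp_norm p T q"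
    using Lp_norm_mono_continuous[OF p ca cq] a0 aq by auto
  ultimately show ?thesis using beta_per_le[of a T p] by simp
qed

section \<open>The upper bound for beta_1 from rounded triangular waves\<close>

lemma max_0_square_has_derivative:
  "((\<lambda>x. (max 0 x)\<^sup>2) has_real_derivative 2 * max 0 x) (at (x::real))"
proof (cases x "0::real" rule: linorder_cases)
  case less
  have "((\<lambda>x. 0) has_real_derivative 2 * max 0 x) (at x)" using less by simp
  then show ?thesis
    by (rule has_field_derivative_transform_within_open[of _ _ _ "{..<0}"]) (use less in auto)
next
  case equal
  \<comment> \<open>At the junction Caratheodory's criterion applies with slope function
    \<open>max 0\<close>, since \<open>(max 0 z)\<^sup>2 = max 0 z * z\<close>.\<close>
  have "\<exists>g. (\<forall>z. (max 0 z)\<^sup>2 - (max 0 x)\<^sup>2 = g z * (z - x)) \<and> isCont g x \<and> g x = 2 * max 0 x"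
    using equal by (intro exI[of _ "max 0"]) (auto simp: max_def power2_eq_square intro!: continuous_intros)
  then show ?thesis by (simp only: CARAT_DERIV)
next
  case greater
  have "((\<lambda>x. x\<^sup>2) has_real_derivative 2 * max 0 x) (at x)"
    using greater by (auto intro!: derivative_eq_intros)
  then show ?thesis
    by (rule has_field_derivative_transform_within_open[of _ _ _ "{0<..}"]) (use greater in auto)
qed

lemma max_0_has_derivative:
  assumes "x \<noteq> 0"
  shows "(max 0 has_real_derivative (if x > 0 then 1 else 0)) (at (x::real))"
proof (cases "x > 0")
  case True
  have "((\<lambda>x. x) has_real_derivative 1) (at x)" by (auto intro!: derivative_eq_intros)
  then have "(max 0 has_real_derivative 1) (at x)"
    by (rule has_field_derivative_transform_within_open[of _ _ _ "{0<..}"]) (use True in auto)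
  then show ?thesis using True by simp
next
  case False
  have "((\<lambda>x. 0) has_real_derivative 0) (at x)" by simp
  then have "(max 0 has_real_derivative 0) (at x)"
    by (rule has_field_derivative_transform_within_open[of _ _ _ "{..<0}"]) (use False assms in auto)
  then show ?thesis using False by simp
qed

text \<open>The absolute value with its corner on \<open>[-e, e]\<close> replaced by the parabola
  \<open>e / 2 + x\<^sup>2 / (2 e)\<close>. The two squares cancel the quadratic growth outside, so
  one closed formula can be differentiated without gluing pieces.\<close>

definition smooth_abs :: "real \<Rightarrow> real \<Rightarrow> real" where
  "smooth_abs e x = e / 2 + (x\<^sup>2 - (max 0 (x - e))\<^sup>2 - (max 0 (- x - e))\<^sup>2) / (2 * e)"

text \<open>The derivative of \<open>smooth_abs\<close>: the function \<open>x / e\<close> cut off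
  at the values -1 and 1.\<close>

definition clip :: "real \<Rightarrow> real \<Rightarrow> real" where
  "clip e x = (x - max 0 (x - e) + max 0 (- x - e)) / e"

lemma smooth_abs_outside:
  assumes "0 < e" "e \<le> \<bar>x\<bar>"
  shows "smooth_abs e x = \<bar>x\<bar>"
proof (cases "0 \<le> x")
  case True
  then have "max 0 (x - e) = x - e" "max 0 (- x - e) = 0" using assms by auto
  then have "smooth_abs e x = e / 2 + (x\<^sup>2 - (x - e)\<^sup>2) / (2 * e)" by (simp add: smooth_abs_def)
  also have "\<dots> = x" using assms by (simp add: power2_eq_square field_simps)
  finally show ?thesis using True by simp
next
  case False
  then have "max 0 (x - e) = 0" "max 0 (- x - e) = - x - e" using assms by auto
  then have "smooth_abs e x = e / 2 + (x\<^sup>2 - (- x - e)\<^sup>2) / (2 * e)" by (simp add: smooth_abs_def)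
  also have "\<dots> = - x" using assms by (simp add: power2_eq_square field_simps)
  finally show ?thesis using False by simp
qed

lemma smooth_abs_inside:
  assumes "0 < e" "\<bar>x\<bar> \<le> e"
  shows "smooth_abs e x \<le> e"
proof -
  have "max 0 (x - e) = 0" "max 0 (- x - e) = 0" using assms by auto
  then have "smooth_abs e x = e / 2 + x\<^sup>2 / (2 * e)" by (simp add: smooth_abs_def)
  also have "x\<^sup>2 \<le> e\<^sup>2" using assms by (simp add: abs_le_square_iff[symmetric])
  then have "e / 2 + x\<^sup>2 / (2 * e) \<le> e / 2 + e\<^sup>2 / (2 * e)"
    using assms by (intro add_left_mono divide_right_mono) auto
  also have "\<dots> = e" using assms by (simp add: power2_eq_square)
  finally show ?thesis .
qed

lemma clip_outside:
  assumes "0 < e"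
  shows "e \<le> x \<Longrightarrow> clip e x = 1" "x \<le> - e \<Longrightarrow> clip e x = -1"
  using assms by (auto simp: clip_def max_def field_simps)

lemma smooth_abs_has_derivative:
  assumes "0 < e"
  shows "(smooth_abs e has_real_derivative clip e x) (at x)"
  unfolding smooth_abs_def[abs_def]
  by (rule derivative_eq_intros refl DERIV_chain2[OF max_0_square_has_derivative] | use assms in \<open>simp; fail\<close>)+
     (use assms in \<open>simp add: clip_def field_simps\<close>)

lemma clip_has_derivative:
  assumes "0 < e" "x \<noteq> e" "x \<noteq> - e"
  shows "(clip e has_real_derivative (if \<bar>x\<bar> \<le> e then 1 / e else 0)) (at x)"
proof -
  have 1: "((\<lambda>x. max 0 (x - e)) has_real_derivative (if x - e > 0 then 1 else 0) * 1) (at x)"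
    by (rule DERIV_chain2[OF max_0_has_derivative]) (use assms in \<open>auto intro!: derivative_eq_intros\<close>)
  have 2: "((\<lambda>x. max 0 (- x - e)) has_real_derivative (if - x - e > 0 then 1 else 0) * (-1)) (at x)"
    by (rule DERIV_chain2[OF max_0_has_derivative]) (use assms in \<open>auto intro!: derivative_eq_intros\<close>)
  show ?thesis
    unfolding clip_def[abs_def]
    by (rule derivative_eq_intros refl 1 2)+ (use assms in \<open>auto simp: abs_if\<close>)
qed

lemma continuous_on_clip [continuous_intros]:
  assumes "continuous_on S f"
  shows "continuous_on S (\<lambda>x. clip e (f x))"
  unfolding clip_def by (cases "e = 0") (auto intro!: continuous_intros assms)

text \<open>A triangular wave of slope \<open>\<plusminus>1\<close> with corners rounded off at scale \<open>e\<close> solves \<open>u'' + a u = 0\<close> with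
  \<open>\<parallel>a\<parallel>\<^sub>1 \<le> 4 / (T/4 - e)\<close>.\<close>

lemma beta_per_1_le_aux:
  assumes T: "0 < T" and e: "0 < e" "e < T / 4"
  shows "beta_per 1 T \<le> 4 / (T / 4 - e)"
proof -
  \<comment> \<open>Away from the corners this is \<open>t\<close>, then \<open>T / 2 - t\<close>,
    then \<open>t - T\<close>: a wave with zeros at \<open>0\<close>, \<open>T / 2\<close> and
    \<open>T\<close>, and extrema at \<open>T / 4\<close> and \<open>3 * T / 4\<close>.\<close>
  define u where "u t = t - T / 2 - smooth_abs e (t - T / 4) + smooth_abs e (t - 3 * T / 4)" for t
  define v where "v t = 1 - clip e (t - T / 4) + clip e (t - 3 * T / 4)" for t
  define J1 where "J1 = {T / 4 - e..T / 4 + e}"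
  define J2 where "J2 = {3 * T / 4 - e..3 * T / 4 + e}"
  \<comment> \<open>This is \<open>- u'' / u\<close>. On \<open>J1\<close> the second derivative is
    \<open>-1 / e\<close> and \<open>u\<close> is positive; on \<open>J2\<close> both signs are
    reversed, so \<open>a0\<close> is nonnegative in either case. On the linear pieces it
    vanishes.\<close>
  define a0 where "a0 t = indicator J1 t *\<^sub>R (1 / (e * u t)) + indicator J2 t *\<^sub>R (- 1 / (e * u t))" for t
  \<comment> \<open>Periodic extension from \<open>[0, T)\<close>. The end \<open>T\<close> is sent
    to \<open>0\<close>, and \<open>a0\<close> vanishes at both points, so \<open>a\<close> and
    \<open>a0\<close> agree on the closed period.\<close>
  define a where "a t = a0 (t - T * of_int \<lfloor>t / T\<rfloor>)" for t
  \<comment> \<open>The bound for \<open>a0\<close> coming from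
    \<open>\<bar>u\<bar> \<ge> T / 4 - e\<close> near the corners. Two intervals of length
    \<open>2 * e\<close> then give total mass at most
    \<open>4 * e * M = 4 / (T / 4 - e)\<close>.\<close>
  define M where "M = 1 / (e * (T / 4 - e))"
  have M0: "0 < M" using e by (simp add: M_def)
  have disj: "t \<notin> J2" if "t \<in> J1" for t using that e by (auto simp: J1_def J2_def)
  have uJ1: "T / 4 - e \<le> u t" if "t \<in> J1" for t
  proof -
    have "smooth_abs e (t - 3 * T / 4) = \<bar>t - 3 * T / 4\<bar>"
      by (rule smooth_abs_outside) (use that e in \<open>auto simp: J1_def\<close>)
    moreover have "\<bar>t - 3 * T / 4\<bar> = 3 * T / 4 - t" using that e by (auto simp: J1_def)
    moreover have "smooth_abs e (t - T / 4) \<le> e"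
      by (rule smooth_abs_inside) (use that e in \<open>auto simp: J1_def\<close>)
    ultimately show ?thesis by (simp add: u_def)
  qed
  have uJ2: "u t \<le> - (T / 4 - e)" if "t \<in> J2" for t
  proof -
    have "smooth_abs e (t - T / 4) = \<bar>t - T / 4\<bar>"
      by (rule smooth_abs_outside) (use that e in \<open>auto simp: J2_def\<close>)
    moreover have "\<bar>t - T / 4\<bar> = t - T / 4" using that e by (auto simp: J2_def)
    moreover have "smooth_abs e (t - 3 * T / 4) \<le> e"
      by (rule smooth_abs_inside) (use that e in \<open>auto simp: J2_def\<close>)
    ultimately show ?thesis by (simp add: u_def)
  qed
  have a0_bounds: "0 \<le> a0 t" "a0 t \<le> M * (indicator J1 t + indicator J2 t)" for t
  proof -
    have "0 \<le> 1 / (e * x)" "1 / (e * x) \<le> M" if "T / 4 - e \<le> x" for x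
      using that e unfolding M_def by (auto intro!: divide_left_mono mult_left_mono mult_pos_pos)
    from this[of "u t"] this[of "- u t"] uJ1[of t] uJ2[of t] disj[of t]
    show "0 \<le> a0 t" "a0 t \<le> M * (indicator J1 t + indicator J2 t)"
      by (auto simp: a0_def indicator_def)
  qed
  have a0_u: "- a0 t * u t = - (if \<bar>t - T / 4\<bar> \<le> e then 1 / e else 0) + (if \<bar>t - 3 * T / 4\<bar> \<le> e then 1 / e else 0)" for t
  proof -
    have "t \<in> J1 \<longleftrightarrow> \<bar>t - T / 4\<bar> \<le> e" "t \<in> J2 \<longleftrightarrow> \<bar>t - 3 * T / 4\<bar> \<le> e"
      by (auto simp: J1_def J2_def)
    moreover have "u t \<noteq> 0" if "t \<in> J1 \<or> t \<in> J2" using uJ1[of t] uJ2[of t] e that by auto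
    ultimately show ?thesis using disj[of t] e by (auto simp: a0_def indicator_def)
  qed
  have du: "(u has_real_derivative v t) (at t)" for t
    unfolding u_def[abs_def] v_def
    by (auto intro!: derivative_eq_intros DERIV_chain2[OF smooth_abs_has_derivative[OF e(1)]])
  have cu: "continuous_on S u" for S
    by (meson DERIV_isCont continuous_at_imp_continuous_on du)
  have cv: "continuous_on S v" for S
    unfolding v_def by (intro continuous_intros)
  have dv: "(v has_real_derivative - a0 t * u t) (at t)"
    if "t \<notin> {T / 4 - e, T / 4 + e, 3 * T / 4 - e, 3 * T / 4 + e}" for t
  proof -
    have "((\<lambda>x. clip e (x - c)) has_real_derivative (if \<bar>t - c\<bar> \<le> e then 1 / e else 0) * 1) (at t)"
      if "t \<noteq> c - e" "t \<noteq> c + e" for c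
      by (rule DERIV_chain2[OF clip_has_derivative[OF e(1)]])
         (use that in \<open>auto intro!: derivative_eq_intros\<close>)
    from this[of "T / 4"] this[of "3 * T / 4"] that show ?thesis
      unfolding v_def[abs_def] a0_u by (auto intro!: derivative_eq_intros)
  qed
  have int_v: "((\<lambda>s. - a0 s * u s) has_integral (v t - v 0)) {0..t}" if "0 \<le> t" for t
    \<comment> \<open>The exceptional set consists of the four kinks of \<open>v\<close>, where
      \<open>a0\<close> jumps.\<close>
    by (rule fundamental_theorem_of_calculus_interior_strong
          [of "{T / 4 - e, T / 4 + e, 3 * T / 4 - e, 3 * T / 4 + e}"])
       (use that dv cv in \<open>auto simp: has_real_derivative_iff_has_vector_derivative[symmetric]\<close>)
  have a_eq: "a t = a0 t" if "t \<in> {0..T}" for t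
  proof (cases "t = T")
    case True
    have "a0 T = 0" "a0 0 = 0" using e by (auto simp: a0_def J1_def J2_def)
    then show ?thesis using True T by (simp add: a_def)
  next
    case False
    then have "\<lfloor>t / T\<rfloor> = 0" using that T by (simp add: floor_eq_iff field_simps)
    then show ?thesis by (simp add: a_def)
  qed
  have a_per: "a (t + T) = a t" for t
  proof -
    have "\<lfloor>(t + T) / T\<rfloor> = \<lfloor>t / T\<rfloor> + 1" using T by (simp add: add_divide_distrib)
    then show ?thesis by (simp add: a_def algebra_simps)
  qed
  have i1: "integrable lborel (\<lambda>t. indicator J1 t *\<^sub>R (1 / (e * u t)))"
  proof -
    have "set_integrable lborel J1 (\<lambda>t. 1 / (e * u t))"
      unfolding J1_def by (intro borel_integrable_atLeastAtMost' continuous_intros cu)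
        (use uJ1 e in \<open>force simp: J1_def\<close>)
    then show ?thesis by (simp add: set_integrable_def)
  qed
  have i2: "integrable lborel (\<lambda>t. indicator J2 t *\<^sub>R (- 1 / (e * u t)))"
  proof -
    have "set_integrable lborel J2 (\<lambda>t. - 1 / (e * u t))"
      unfolding J2_def by (intro borel_integrable_atLeastAtMost' continuous_intros cu)
        (use uJ2 e in \<open>force simp: J2_def\<close>)
    then show ?thesis by (simp add: set_integrable_def)
  qed
  have i0: "integrable lborel a0" unfolding a0_def[abs_def] using i1 i2 by (rule Bochner_Integration.integrable_add)
  have ind: "(\<lambda>t. indicator {0..T} t *\<^sub>R a t) = a0"
  proof
    fix t show "indicator {0..T} t *\<^sub>R a t = a0 t"
    proof (cases "t \<in> {0..T}")
      case False
      then have "a0 t = 0" using e by (auto simp: a0_def J1_def J2_def indicator_def)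
      then show ?thesis using False by simp
    qed (simp add: a_eq)
  qed
  have si: "set_integrable lborel {0..T} a" unfolding set_integrable_def ind by (rule i0)
  have LINT_le: "integral\<^sup>L lborel a0 \<le> 4 / (T / 4 - e)"
  proof -
    have iJ: "integrable lborel (\<lambda>t. indicator J1 t :: real)" "integrable lborel (\<lambda>t. indicator J2 t :: real)"
      unfolding J1_def J2_def
      by (auto intro!: integrable_real_indicator simp: emeasure_lborel_Icc_eq)
    have mJ: "measure lborel J1 = 2 * e" "measure lborel J2 = 2 * e"
      using e by (auto simp: J1_def J2_def)
    have "integral\<^sup>L lborel a0 \<le> integral\<^sup>L lborel (\<lambda>t. M * (indicator J1 t + indicator J2 t))"
      using i0 iJ a0_bounds by (intro integral_mono) auto
    also have "\<dots> = M * (measure lborel J1 + measure lborel J2)"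
      using iJ by simp
    also have "\<dots> = 4 / (T / 4 - e)" using e unfolding mJ M_def by (simp add: field_simps)
    finally show ?thesis .
  qed
  have "periodic_lin_solution T a u"
    unfolding periodic_lin_solution_def
  proof (intro exI[of _ v] conjI ballI)
    fix t assume t: "t \<in> {0..T}"
    show "(u has_real_derivative v t) (at t within {0..T})"
      using du by (rule DERIV_subset) simp
    show "((\<lambda>s. - a s * u s) has_integral v t - v 0) {0..t}"
      by (rule has_integral_eq[OF _ int_v]) (use t a_eq in auto)
  next
    show "u 0 - u T = 0" using T e by (simp add: u_def smooth_abs_outside)
    show "v 0 - v T = 0" using T e by (simp add: v_def clip_outside)
  qed
  moreover have "u (T / 4) \<noteq> 0" using uJ1[of "T / 4"] e by (simp add: J1_def)
  moreover have "T / 4 \<in> {0..T}" using T by simp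
  moreover have "\<not> (AE x in lborel. x \<in> {0..T} \<longrightarrow> a x = 0)"
  proof
    assume "AE x in lborel. x \<in> {0..T} \<longrightarrow> a x = 0"
    then have "AE x in lborel. x \<notin> J1"
    proof (rule eventually_mono)
      fix x assume *: "x \<in> {0..T} \<longrightarrow> a x = 0"
      show "x \<notin> J1"
      proof
        assume x: "x \<in> J1"
        then have "x \<in> {0..T}" using e by (auto simp: J1_def)
        then have "a0 x = 0" using * a_eq by auto
        then show False using x disj[OF x] uJ1[OF x] e by (simp add: a0_def)
      qed
    qed
    then have "J1 \<in> null_sets lborel" by (subst AE_iff_null_sets) (auto simp: J1_def)
    then have "emeasure lborel J1 = 0" by auto
    then show False using e by (simp add: J1_def)
  qed
  moreover have "0 \<le> (LINT x:{0..T}|lborel. a x)"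
    unfolding set_lebesgue_integral_def ind using a0_bounds by (intro integral_nonneg_AE) auto
  moreover have "a \<in> L_T T" using a_per si by (simp add: L_T_def)
  ultimately have "a \<in> Lambda_per T" by (auto simp: Lambda_per_def)
  moreover have a_nonneg: "0 \<le> a t" for t by (simp add: a_def a0_bounds)
  have "in_Lp 1 T a"
    using si a_nonneg unfolding in_Lp_def
    by (simp add: set_integrable_def set_borel_measurable_def borel_measurable_integrable)
  ultimately have "beta_per 1 T \<le> Lp_norm 1 T (\<lambda>t. max (a t) 0)" by (rule beta_per_le)
  also have "(\<lambda>t. max (a t) 0) = a" using a_nonneg by (auto simp: fun_eq_iff)
  also have "Lp_norm 1 T a = integral\<^sup>L lborel a0"
  proof -
    have "0 \<le> integral\<^sup>L lborel a0" using a0_bounds by (intro integral_nonneg_AE) auto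
    then show ?thesis
      using a_nonneg ind by (simp add: Lp_norm_def set_lebesgue_integral_def)
  qed
  also note LINT_le
  finally show ?thesis .
qed

lemma beta_per_1_le:
  assumes T: "0 < T"
  shows "beta_per 1 T \<le> 16 / T"
proof -
  have "((\<lambda>e. 4 / (T / 4 - e)) \<longlongrightarrow> 4 / (T / 4 - 0)) (at_right 0)"
    using T by (intro tendsto_intros) auto
  moreover have "\<forall>\<^sub>F e in at_right 0. beta_per 1 T \<le> 4 / (T / 4 - e)"
    using T beta_per_1_le_aux[OF T] unfolding eventually_at_right_field
    by (intro exI[of _ "T / 4"]) auto
  ultimately have "beta_per 1 T \<le> 4 / (T / 4 - 0)"
    by (intro tendsto_lowerbound[of _ _ "at_right 0"]) auto
  then show ?thesis by simp
qed

text \<open>The eigenvalue argument only yields \<open>beta_per p T \<le> Lp_norm p T q\<close>,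
  which contradicts a strict hypothesis but not the non-strict one at \<open>p = 1\<close>; there
  the strict oscillation bound takes its place. Strictness is stated through the equality case so
  that constant \<open>f\<close>, for which both integrals can be made zero, is covered as
  well.\<close>

lemma scalar_inequality:
  fixes b :: "real \<Rightarrow> real" and f :: "real \<Rightarrow> real"
  assumes T: "0 < T" and b: "continuous_on UNIV b" "\<And>t. b (t + T) = b t" and p: "1 \<le> p"
    and bound: "if p = 1 then Lp_norm p T (\<lambda>t. max (b t) 0) \<le> beta_per p T
      else Lp_norm p T (\<lambda>t. max (b t) 0) < beta_per p T"
    and f: "C1_on 0 T f f'" and per: "f 0 = f T"
  obtains k where "integral {0..T} (\<lambda>t. b t * (f t + k)\<^sup>2) \<le> integral {0..T} (\<lambda>t. (f' t)\<^sup>2)"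
    "integral {0..T} (\<lambda>t. b t * (f t + k)\<^sup>2) = integral {0..T} (\<lambda>t. (f' t)\<^sup>2) \<Longrightarrow> \<forall>t\<in>{0..T}. f' t = 0"
proof -
  note witness = that
  define q where "q t = max (b t) 0" for t
  note cf = C1_on_continuous[OF f]
  have cq': "continuous_on UNIV q" unfolding q_def by (intro continuous_intros b)
  have cb: "continuous_on {0..T} b" using b(1) by (rule continuous_on_subset) simp
  have cq: "continuous_on {0..T} q" using cq' by (rule continuous_on_subset) simp
  have q0: "0 \<le> q t" and bq: "b t \<le> q t" for t by (auto simp: q_def)
  have q_per: "q (t + T) = q t" for t by (simp add: q_def b)
  have b_le: "integral {0..T} (\<lambda>t. b t * (f t + k)\<^sup>2) \<le> integral {0..T} (\<lambda>t. q t * (f t + k)\<^sup>2)" for k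
    by (intro integral_le integrable_continuous_real continuous_intros cb cq cf mult_right_mono bq) auto
  have E0: "0 \<le> integral {0..T} (\<lambda>t. (f' t)\<^sup>2)"
    by (intro integral_nonneg integrable_continuous_real continuous_intros cf) auto
  have strict: thesis if "integral {0..T} (\<lambda>t. q t * (f t + k)\<^sup>2) < integral {0..T} (\<lambda>t. (f' t)\<^sup>2)" for k
  proof (rule witness[of k])
    show "integral {0..T} (\<lambda>t. b t * (f t + k)\<^sup>2) \<le> integral {0..T} (\<lambda>t. (f' t)\<^sup>2)"
      using that b_le[of k] by linarith
    show "\<forall>t\<in>{0..T}. f' t = 0"
      if "integral {0..T} (\<lambda>t. b t * (f t + k)\<^sup>2) = integral {0..T} (\<lambda>t. (f' t)\<^sup>2)"
      using that \<open>integral {0..T} (\<lambda>t. q t * (f t + k)\<^sup>2) < _\<close> b_le[of k] by linarith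
  qed
  \<comment> \<open>A weight \<open>q\<close> that vanishes identically is set apart: it defines no
    weighted mean, and the integral with \<open>q\<close> is zero for every shift.\<close>
  consider (const) "\<forall>t\<in>{0..T}. f' t = 0" | (one) "\<not> (\<forall>t\<in>{0..T}. f' t = 0)" "p = 1"
    | (zero) "\<not> (\<forall>t\<in>{0..T}. f' t = 0)" "integral {0..T} q = 0"
    | (gt) "\<not> (\<forall>t\<in>{0..T}. f' t = 0)" "p \<noteq> 1" "integral {0..T} q \<noteq> 0" by blast
  then show ?thesis
  proof cases
    case const
    have "b t * (f t + - f 0)\<^sup>2 = 0" if "t \<in> {0..T}" for t
      using C1_on_deriv_zero_const[OF f const _ that, of 0] T by simp
    then have "integral {0..T} (\<lambda>t. b t * (f t + - f 0)\<^sup>2) = integral {0..T} (\<lambda>t. 0)"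
      by (rule integral_cong)
    then show ?thesis using E0 const by (intro witness[of "- f 0"]) simp_all
  next
    case one
    obtain k R where kR: "\<And>t. t \<in> {0..T} \<Longrightarrow> \<bar>f t + k\<bar> \<le> R" "R > 0"
      "16 / T * R\<^sup>2 < integral {0..T} (\<lambda>t. (f' t)\<^sup>2)"
      using C1_on_square_integral_ge_midrange[OF T f per one(1)] by blast
    have "integral {0..T} (\<lambda>t. q t * (f t + k)\<^sup>2) \<le> integral {0..T} (\<lambda>t. q t * R\<^sup>2)"
    proof (intro integral_le integrable_continuous_real continuous_intros cq cf mult_left_mono q0)
      fix t assume "t \<in> {0..T}"
      then show "(f t + k)\<^sup>2 \<le> R\<^sup>2" using kR by (intro abs_le_square_iff[THEN iffD1]) auto
    qed
    also have "\<dots> = integral {0..T} q * R\<^sup>2" by simp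
    also have "integral {0..T} q \<le> 16 / T"
    proof -
      have "integral {0..T} q = Lp_norm 1 T q" using Lp_norm_1_continuous[OF cq] q0 by simp
      also have "\<dots> \<le> beta_per 1 T" using bound one(2) by (simp add: q_def[abs_def])
      finally show ?thesis using beta_per_1_le[OF T] by simp
    qed
    then have "integral {0..T} q * R\<^sup>2 \<le> 16 / T * R\<^sup>2" by (rule mult_right_mono) simp
    finally have "integral {0..T} (\<lambda>t. q t * (f t + k)\<^sup>2) \<le> 16 / T * R\<^sup>2" .
    then show ?thesis by (rule strict[OF le_less_trans[OF _ kR(3)]])
  next
    case zero
    have "q t = 0" if "t \<in> {0..T}" for t
      using zero(2) integral_eq_0_iff[OF cq T q0] that by blast
    then have "integral {0..T} (\<lambda>t. q t * (f t + 0)\<^sup>2) = integral {0..T} (\<lambda>t. 0)"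
      by (intro integral_cong) auto
    moreover have "integral {0..T} (\<lambda>t. (f' t)\<^sup>2) \<noteq> 0"
    proof
      assume "integral {0..T} (\<lambda>t. (f' t)\<^sup>2) = 0"
      moreover have "continuous_on {0..T} (\<lambda>t. (f' t)\<^sup>2)" by (intro continuous_intros cf)
      ultimately show False using zero(1) integral_eq_0_iff[of 0 T "\<lambda>t. (f' t)\<^sup>2"] T by simp
    qed
    ultimately show ?thesis using strict[of 0] E0 by simp
  next
    case gt
    define k where "k = - integral {0..T} (\<lambda>t. q t * f t) / integral {0..T} q"
    define g where "g t = f t + k" for t
    have g: "C1_on 0 T g f'" unfolding g_def by (rule C1_on_add_const[OF f])
    have "integral {0..T} (\<lambda>t. q t * g t) = integral {0..T} (\<lambda>t. q t * f t + q t * k)"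
      by (simp add: g_def distrib_left)
    also have "\<dots> = integral {0..T} (\<lambda>t. q t * f t) + integral {0..T} q * k"
      by (subst integral_add) (auto intro!: integrable_continuous_real continuous_intros cq cf)
    also have "\<dots> = 0" using gt by (simp add: k_def)
    finally have mean: "integral {0..T} (\<lambda>t. q t * g t) = 0" .
    have "integral {0..T} (\<lambda>t. q t * (g t)\<^sup>2) < integral {0..T} (\<lambda>t. (f' t)\<^sup>2)"
    proof (rule ccontr)
      assume "\<not> ?thesis"
      then have le: "integral {0..T} (\<lambda>t. (f' t)\<^sup>2) \<le> integral {0..T} (\<lambda>t. q t * (g t)\<^sup>2)" by simp
      have g_per: "g 0 = g T" by (simp add: g_def per)
      obtain l u u' where "0 < l" "l \<le> 1" "C1_on 0 T u u'" "C1_on 0 T u' (\<lambda>t. - (l * q t) * u t)"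
        "u 0 = u T" "u' 0 = u' T" "\<exists>t\<in>{0..T}. u t \<noteq> 0"
        using first_periodic_eigenvalue[OF T cq q0 gt(3) g g_per mean le gt(1)] by blast
      then have "beta_per p T \<le> Lp_norm p T q"
        by (intro beta_per_le_of_eigenvalue[OF T cq' q0 q_per gt(3) p])
      then show False using bound gt(2) by (simp add: q_def[abs_def])
    qed
    then show ?thesis using strict[of k] by (simp add: g_def)
  qed
qed

section \<open>The vector-valued inequality\<close>

lemma C1_on_component:
  fixes w :: "real \<Rightarrow> real^'n"
  assumes "C1_on a b w v"
  shows "C1_on a b (\<lambda>t. w t $ i) (\<lambda>t. v t $ i)"
  using assms bounded_linear.has_vector_derivative[OF bounded_linear_vec_nth]
  unfolding C1_on_def by (fast intro!: continuous_intros)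

lemma inner_diagonal_matrix:
  fixes D :: "real^'n^'n"
  assumes "\<And>i j. i \<noteq> j \<Longrightarrow> D $ i $ j = 0"
  shows "x \<bullet> (D *v x) = (\<Sum>i\<in>UNIV. D $ i $ i * (x $ i)\<^sup>2)"
proof -
  have "(\<Sum>j\<in>UNIV. D $ i $ j * x $ j) = D $ i $ i * x $ i" for i
  proof -
    have "(\<Sum>j\<in>UNIV. D $ i $ j * x $ j) = (\<Sum>j\<in>UNIV. if j = i then D $ i $ i * x $ i else 0)"
      using assms by (intro sum.cong) auto
    then show ?thesis by simp
  qed
  then show ?thesis
    by (simp add: inner_vec_def matrix_vector_mult_def power2_eq_square algebra_simps)
qed

lemma vector_inequality_imp_zero:
  fixes A B :: "real \<Rightarrow> real^'n^'n" and w v :: "real \<Rightarrow> real^'n"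
  assumes T: "0 < T"
    and B_cont: "continuous_on UNIV B" and B_per: "\<And>t. B (t + T) = B t"
    and B_diag: "\<And>t i j. i \<noteq> j \<Longrightarrow> B t $ i $ j = 0"
    and p: "\<And>i. 1 \<le> p i"
    and bound: "\<And>i. if p i = 1
        then Lp_norm (p i) T (\<lambda>t. max (B t $ i $ i) 0) \<le> beta_per (p i) T
        else Lp_norm (p i) T (\<lambda>t. max (B t $ i $ i) 0) < beta_per (p i) T"
    and A_pos: "\<And>k. k \<noteq> 0 \<Longrightarrow> integral {0..T} (\<lambda>t. (A t *v k) \<bullet> k) > 0"
    and w: "C1_on 0 T w v" and per: "w 0 = w T"
    and ineq: "\<And>k. integral {0..T} (\<lambda>t. v t \<bullet> v t)
      \<le> integral {0..T} (\<lambda>t. (w t + k) \<bullet> (B t *v (w t + k))) - integral {0..T} (\<lambda>t. (A t *v k) \<bullet> k)"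
    and t: "t \<in> {0..T}"
  shows "w t = 0" "v t = 0"
proof -
  define b where "b i t = B t $ i $ i" for i t
  note cw = C1_on_continuous[OF w]
  have cb: "continuous_on UNIV (b i)" for i unfolding b_def by (intro continuous_intros B_cont)
  have cb': "continuous_on {0..T} (b i)" for i using cb by (rule continuous_on_subset) simp
  define P where "P i k \<longleftrightarrow>
      integral {0..T} (\<lambda>t. b i t * (w t $ i + k)\<^sup>2) \<le> integral {0..T} (\<lambda>t. (v t $ i)\<^sup>2) \<and>
      (integral {0..T} (\<lambda>t. b i t * (w t $ i + k)\<^sup>2) = integral {0..T} (\<lambda>t. (v t $ i)\<^sup>2)
        \<longrightarrow> (\<forall>t\<in>{0..T}. v t $ i = 0))" for i k
  have "\<exists>k. P i k" for i
  proof -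
    have b_per: "b i (t + T) = b i t" for t by (simp add: b_def B_per)
    have b_bound: "if p i = 1 then Lp_norm (p i) T (\<lambda>t. max (b i t) 0) \<le> beta_per (p i) T
        else Lp_norm (p i) T (\<lambda>t. max (b i t) 0) < beta_per (p i) T"
      unfolding b_def by (rule bound)
    have w_per: "w 0 $ i = w T $ i" using per by simp
    obtain k where "integral {0..T} (\<lambda>t. b i t * (w t $ i + k)\<^sup>2) \<le> integral {0..T} (\<lambda>t. (v t $ i)\<^sup>2)"
      "integral {0..T} (\<lambda>t. b i t * (w t $ i + k)\<^sup>2) = integral {0..T} (\<lambda>t. (v t $ i)\<^sup>2)
        \<Longrightarrow> \<forall>t\<in>{0..T}. v t $ i = 0"
      by (rule scalar_inequality[OF T cb b_per p b_bound C1_on_component[OF w] w_per]) blast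
    then show ?thesis unfolding P_def by blast
  qed
  then obtain \<kappa> where "\<And>i. P i (\<kappa> i)" by metis
  then have \<kappa>: "integral {0..T} (\<lambda>t. b i t * (w t $ i + \<kappa> i)\<^sup>2) \<le> integral {0..T} (\<lambda>t. (v t $ i)\<^sup>2)"
    "integral {0..T} (\<lambda>t. b i t * (w t $ i + \<kappa> i)\<^sup>2) = integral {0..T} (\<lambda>t. (v t $ i)\<^sup>2)
        \<Longrightarrow> \<forall>t\<in>{0..T}. v t $ i = 0" for i unfolding P_def by blast+
  define k where "k = (\<chi> i. \<kappa> i)"
  let ?d = "\<lambda>i. integral {0..T} (\<lambda>t. (v t $ i)\<^sup>2) - integral {0..T} (\<lambda>t. b i t * (w t $ i + \<kappa> i)\<^sup>2)"
  have eB: "integral {0..T} (\<lambda>t. (w t + k) \<bullet> (B t *v (w t + k)))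
      = (\<Sum>i\<in>UNIV. integral {0..T} (\<lambda>t. b i t * (w t $ i + \<kappa> i)\<^sup>2))"
  proof -
    have "integral {0..T} (\<lambda>t. (w t + k) \<bullet> (B t *v (w t + k)))
        = integral {0..T} (\<lambda>t. \<Sum>i\<in>UNIV. b i t * (w t $ i + \<kappa> i)\<^sup>2)"
      by (simp add: inner_diagonal_matrix[OF B_diag] b_def k_def)
    also have "\<dots> = (\<Sum>i\<in>UNIV. integral {0..T} (\<lambda>t. b i t * (w t $ i + \<kappa> i)\<^sup>2))"
      by (intro integral_sum integrable_continuous_real continuous_intros cb' cw) simp
    finally show ?thesis .
  qed
  have ev: "integral {0..T} (\<lambda>t. v t \<bullet> v t) = (\<Sum>i\<in>UNIV. integral {0..T} (\<lambda>t. (v t $ i)\<^sup>2))"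
  proof -
    have "integral {0..T} (\<lambda>t. v t \<bullet> v t) = integral {0..T} (\<lambda>t. \<Sum>i\<in>UNIV. (v t $ i)\<^sup>2)"
      by (simp add: inner_vec_def power2_eq_square)
    also have "\<dots> = (\<Sum>i\<in>UNIV. integral {0..T} (\<lambda>t. (v t $ i)\<^sup>2))"
      by (intro integral_sum integrable_continuous_real continuous_intros cw) simp
    finally show ?thesis .
  qed
  \<comment> \<open>The deficits \<open>?d i\<close> are nonnegative by the choice of
    \<open>\<kappa>\<close>, while their sum is at most minus a quantity that is positive for
    \<open>k \<noteq> 0\<close>. This leaves only \<open>k = 0\<close> and equality in every
    component.\<close>
  have sum_le: "(\<Sum>i\<in>UNIV. ?d i) \<le> - integral {0..T} (\<lambda>t. (A t *v k) \<bullet> k)"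
    using ineq[of k] unfolding eB ev sum_subtractf by linarith
  have d0: "0 \<le> ?d i" for i using \<kappa>(1)[of i] by linarith
  then have sum0: "0 \<le> (\<Sum>i\<in>UNIV. ?d i)" by (intro sum_nonneg)
  have "k = 0"
  proof (rule ccontr)
    assume "k \<noteq> 0"
    from A_pos[OF this] sum_le sum0 show False by linarith
  qed
  then have "(\<Sum>i\<in>UNIV. ?d i) = 0" using sum_le sum0 by simp
  then have "?d i = 0" for i
    using sum_nonneg_eq_0_iff[of UNIV ?d] d0 by (simp del: right_minus_eq)
  then have vi: "v t $ i = 0" if "t \<in> {0..T}" for t i using \<kappa>(2)[of i] that by simp
  have v0: "v t = 0" if "t \<in> {0..T}" for t using vi[OF that] by (simp add: vec_eq_iff)
  have wc: "w t = w 0" if "t \<in> {0..T}" for t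
    by (rule C1_on_deriv_zero_const[OF w _ _ that]) (use v0 T in auto)
  \<comment> \<open>For constant \<open>w\<close> the test vector \<open>- w 0\<close> annihilates
    the term with \<open>B\<close>, and what remains contradicts the positivity of \<open>A\<close>
    unless \<open>w 0 = 0\<close>.\<close>
  have "w 0 = 0"
  proof (rule ccontr)
    assume "w 0 \<noteq> 0"
    then have "- w 0 \<noteq> 0" by simp
    have "integral {0..T} (\<lambda>t. v t \<bullet> v t) = integral {0..T} (\<lambda>t. 0)"
      by (rule integral_cong) (simp add: v0)
    then have 1: "integral {0..T} (\<lambda>t. v t \<bullet> v t) = 0" by (simp only: integral_0)
    have "integral {0..T} (\<lambda>t. (w t + - w 0) \<bullet> (B t *v (w t + - w 0))) = integral {0..T} (\<lambda>t. 0)"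
    proof (rule integral_cong)
      fix t assume "t \<in> {0..T}"
      then show "(w t + - w 0) \<bullet> (B t *v (w t + - w 0)) = 0" by (subst (1 2) wc) simp_all
    qed
    then have 2: "integral {0..T} (\<lambda>t. (w t + - w 0) \<bullet> (B t *v (w t + - w 0))) = 0"
      by (simp only: integral_0)
    from ineq[of "- w 0"] A_pos[OF \<open>- w 0 \<noteq> 0\<close>] show False unfolding 1 2 by linarith
  qed
  then show "w t = 0" "v t = 0" unfolding wc[OF t] v0[OF t] by simp_all
qed

section \<open>Globally Lipschitz differential equations\<close>

text \<open>The oriented integral from \<open>0\<close> to \<open>t\<close> for either sign of
  \<open>t\<close>: whichever integral runs over an empty or one-point interval vanishes.\<close>

definition primitive :: "(real \<Rightarrow> 'a::banach) \<Rightarrow> real \<Rightarrow> 'a" where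
  "primitive g t = integral {0..t} g - integral {t..0} g"

lemma primitive_has_vector_derivative:
  fixes g :: "real \<Rightarrow> 'a::banach"
  assumes g: "continuous_on UNIV g"
  shows "(primitive g has_vector_derivative g t) (at t)"
proof -
  define a b where "a = min t 0 - 1" and "b = max t 0 + 1"
  have ab: "a < t" "t < b" "a < 0" "0 < b" by (auto simp: a_def b_def)
  have gab: "continuous_on {a..b} g" using g by (rule continuous_on_subset) simp
  have int: "g integrable_on {c..d}" for c d
    by (rule integrable_continuous_real) (rule continuous_on_subset[OF g], simp)
  have eq: "primitive g s = integral {a..s} g - integral {a..0} g" if "s \<in> {a<..<b}" for s
  proof (cases "0 \<le> s")
    case True
    then have "integral {s..0} g = 0" by (cases "s = 0") auto
    then show ?thesis
      using Henstock_Kurzweil_Integration.integral_combine[of a 0 s g] ab True int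
      by (simp add: primitive_def algebra_simps)
  next
    case False
    then show ?thesis
      using Henstock_Kurzweil_Integration.integral_combine[of a s 0 g] ab that int
      by (simp add: primitive_def algebra_simps)
  qed
  have "((\<lambda>s. integral {a..s} g) has_vector_derivative g t) (at t within {a..b})"
    by (rule integral_has_vector_derivative[OF gab]) (use ab in auto)
  then have "((\<lambda>s. integral {a..s} g) has_vector_derivative g t) (at t)"
    using ab by (simp add: at_within_Icc_at)
  then have "((\<lambda>s. integral {a..s} g - integral {a..0} g) has_vector_derivative g t) (at t)"
    by (auto intro!: derivative_eq_intros)
  then show ?thesis
    by (rule has_vector_derivative_transform_within_open[of _ _ _ "{a<..<b}"]) (use ab eq in auto)
qed

lemma primitive_0: "primitive g 0 = 0"
  by (simp add: primitive_def)

lemma has_vector_derivative_reflect: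
  assumes "\<And>t. (f has_vector_derivative f' t) (at t)"
  shows "((\<lambda>t. f (- t)) has_vector_derivative - f' (- t)) (at t)"
proof -
  have "(uminus has_vector_derivative -1) (at t)" for t :: real
    by (auto intro!: derivative_eq_intros)
  then have "(f \<circ> uminus has_vector_derivative (-1) *\<^sub>R f' (- t)) (at t)"
    using assms by (rule vector_diff_chain_at)
  then show ?thesis by (simp add: o_def)
qed

text \<open>Integrating \<open>C exp (K s)\<close> gains a factor \<open>1 / K\<close>; with an
  exponential weight this gain is what makes the Picard operator contract. Negative times follow by
  reflection.\<close>

lemma exp_bound_of_derivative_bound:
  fixes h :: "real \<Rightarrow> 'a::real_normed_vector"
  assumes K: "0 < K" and C: "0 \<le> C" and h0: "h 0 = 0"
    and dh: "\<And>t. (h has_vector_derivative h' t) (at t)"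
    and bd: "\<And>t. norm (h' t) \<le> C * exp (K * \<bar>t\<bar>)"
  shows "norm (h t) \<le> C / K * exp (K * \<bar>t\<bar>)"
proof -
  have pos: "norm (h t) \<le> C / K * exp (K * t)"
    if t: "0 < t" and h0: "h 0 = 0" and dh: "\<And>t. (h has_vector_derivative h' t) (at t)"
    and bd: "\<And>t. norm (h' t) \<le> C * exp (K * \<bar>t\<bar>)" for h h' :: "real \<Rightarrow> 'a" and t
  proof -
    have "norm (h t - h 0) \<le> C / K * exp (K * t) - C / K * exp (K * 0)"
    proof (rule differentiable_bound_general[OF t])
      show "continuous_on {0..t} h"
        using dh by (meson continuous_at_imp_continuous_on has_vector_derivative_continuous)
      show "((\<lambda>x. C / K * exp (K * x)) has_vector_derivative C * exp (K * x)) (at x)" for x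
        unfolding has_real_derivative_iff_has_vector_derivative[symmetric]
        using K by (auto intro!: derivative_eq_intros)
      show "norm (h' x) \<le> C * exp (K * x)" if "0 < x" for x
        using bd[of x] that by simp
    qed (use dh K in \<open>auto intro!: continuous_intros\<close>)
    also have "\<dots> \<le> C / K * exp (K * t)" using C K by simp
    finally show ?thesis using h0 by simp
  qed
  consider "t = 0" | "0 < t" | "t < 0" by linarith
  then show ?thesis
  proof cases
    case 1
    then show ?thesis using h0 C K by simp
  next
    case 2
    then show ?thesis using pos[OF 2 h0 dh bd] by simp
  next
    case 3
    have "norm (h (- (- t))) \<le> C / K * exp (K * - t)"
    proof (rule pos)
      show "((\<lambda>t. h (- t)) has_vector_derivative - h' (- t)) (at t)" for t
        by (rule has_vector_derivative_reflect[OF dh])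
      show "norm (- h' (- t)) \<le> C * exp (K * \<bar>t\<bar>)" for t using bd[of "- t"] by simp
    qed (use 3 h0 in auto)
    then show ?thesis using 3 by simp
  qed
qed

text \<open>The weight \<open>exp (2 L \<bar>t\<bar>)\<close> makes the Picard operator a contraction on all of \<open>\<real>\<close> at once.\<close>

lemma global_Lipschitz_ode_solution:
  fixes F :: "real \<Rightarrow> 'a::banach \<Rightarrow> 'a"
  assumes L: "0 < L" and lip: "\<And>t x y. norm (F t x - F t y) \<le> L * norm (x - y)"
    and bd: "\<And>t. norm (F t 0) \<le> C"
    and cont: "\<And>z. continuous_on UNIV z \<Longrightarrow> continuous_on UNIV (\<lambda>t. F t (z t))"
  shows "\<exists>z. z 0 = x \<and> (\<forall>t. (z has_vector_derivative F t (z t)) (at t))"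
proof -
  \<comment> \<open>The contraction factor will be \<open>L / K = 1 / 2\<close>.\<close>
  define K where "K = 2 * L"
  have K: "0 < K" using L by (simp add: K_def)
  have C: "0 \<le> C" using bd[of 0] norm_ge_zero order_trans by blast
  \<comment> \<open>\<open>\<phi>\<close> stands for the unknown divided by the weight. This moves
    the fixed point problem to the complete space of bounded continuous functions, where
    \<open>Q\<close> is the Picard operator.\<close>
  define Z where "Z \<phi> t = exp (K * \<bar>t\<bar>) *\<^sub>R apply_bcontfun \<phi> t" for \<phi> :: "real \<Rightarrow>\<^sub>C 'a" and t
  define g where "g \<phi> t = F t (Z \<phi> t)" for \<phi> t
  define Q where "Q \<phi> t = exp (- (K * \<bar>t\<bar>)) *\<^sub>R (x + primitive (g \<phi>) t)" for \<phi> t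
  have cZ: "continuous_on UNIV (Z \<phi>)" for \<phi>
    unfolding Z_def by (intro continuous_intros continuous_on_apply_bcontfun)
  have cg: "continuous_on UNIV (g \<phi>)" for \<phi>
    unfolding g_def by (rule cont[OF cZ])
  have dprim: "(primitive (g \<phi>) has_vector_derivative g \<phi> t) (at t)" for \<phi> t
    by (rule primitive_has_vector_derivative[OF cg])
  have cprim: "continuous_on UNIV (primitive (g \<phi>))" for \<phi>
    using dprim by (meson continuous_at_imp_continuous_on has_vector_derivative_continuous)
  have e1: "exp (- (K * \<bar>t\<bar>)) * exp (K * \<bar>t\<bar>) = 1" for t by (simp add: exp_minus)
  have Q_in: "Q \<phi> \<in> bcontfun" for \<phi>
  proof -
    obtain M where M: "0 < M" "\<And>t. norm (apply_bcontfun \<phi> t) \<le> M"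
      using bounded_apply_bcontfun[of \<phi>] by (auto simp: bounded_pos)
    have "norm (primitive (g \<phi>) t) \<le> (C + L * M) / K * exp (K * \<bar>t\<bar>)" for t
    proof (rule exp_bound_of_derivative_bound[OF K _ primitive_0 dprim])
      show "0 \<le> C + L * M" using C L M by simp
      fix t
      have "norm (g \<phi> t) \<le> norm (F t 0) + norm (F t (Z \<phi> t) - F t 0)"
        unfolding g_def by norm
      also have "\<dots> \<le> C + L * (exp (K * \<bar>t\<bar>) * M)"
      proof (intro add_mono bd)
        have "norm (F t (Z \<phi> t) - F t 0) \<le> L * norm (Z \<phi> t)" using lip[of t "Z \<phi> t" 0] by simp
        also have "norm (Z \<phi> t) \<le> exp (K * \<bar>t\<bar>) * M" using M(2)[of t] by (simp add: Z_def)
        finally show "norm (F t (Z \<phi> t) - F t 0) \<le> L * (exp (K * \<bar>t\<bar>) * M)" using L by simp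
      qed
      also have "\<dots> \<le> (C + L * M) * exp (K * \<bar>t\<bar>)"
        using mult_left_mono[of 1 "exp (K * \<bar>t\<bar>)" C] C K by (simp add: algebra_simps)
      finally show "norm (g \<phi> t) \<le> (C + L * M) * exp (K * \<bar>t\<bar>)" .
    qed
    then have "norm (Q \<phi> t) \<le> norm x + (C + L * M) / K" for t
    proof -
      assume *: "\<And>t. norm (primitive (g \<phi>) t) \<le> (C + L * M) / K * exp (K * \<bar>t\<bar>)"
      have "norm (Q \<phi> t) \<le> exp (- (K * \<bar>t\<bar>)) * (norm x + (C + L * M) / K * exp (K * \<bar>t\<bar>))"
        using *[of t] norm_triangle_ineq[of x "primitive (g \<phi>) t"]
        by (simp add: Q_def mult_left_mono)
      also have "\<dots> = exp (- (K * \<bar>t\<bar>)) * norm x + (C + L * M) / K * (exp (- (K * \<bar>t\<bar>)) * exp (K * \<bar>t\<bar>))"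
        by (simp add: algebra_simps)
      also have "\<dots> \<le> norm x + (C + L * M) / K"
        unfolding e1 using K by (simp add: mult_left_le_one_le)
      finally show ?thesis .
    qed
    then have "bounded (range (Q \<phi>))" by (auto simp: bounded_iff)
    moreover have "continuous_on UNIV (Q \<phi>)"
      unfolding Q_def by (intro continuous_intros cprim)
    ultimately show ?thesis by (simp add: bcontfun_def)
  qed
  define P where "P \<phi> = Bcontfun (Q \<phi>)" for \<phi>
  have P: "apply_bcontfun (P \<phi>) = Q \<phi>" for \<phi>
    unfolding P_def by (rule Bcontfun_inverse[OF Q_in])
  have "dist (P \<phi>) (P \<psi>) \<le> 1 / 2 * dist \<phi> \<psi>" for \<phi> \<psi>
  proof (rule dist_bound)
    fix t
    have "norm (primitive (g \<phi>) t - primitive (g \<psi>) t) \<le> L * dist \<phi> \<psi> / K * exp (K * \<bar>t\<bar>)"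
    proof (rule exp_bound_of_derivative_bound[OF K, where h' = "\<lambda>t. g \<phi> t - g \<psi> t"])
      show "((\<lambda>t. primitive (g \<phi>) t - primitive (g \<psi>) t) has_vector_derivative g \<phi> t - g \<psi> t) (at t)" for t
        by (intro derivative_intros dprim)
      fix t
      have "norm (g \<phi> t - g \<psi> t) \<le> L * norm (Z \<phi> t - Z \<psi> t)"
        unfolding g_def by (rule lip)
      also have "\<dots> = L * (exp (K * \<bar>t\<bar>) * dist (apply_bcontfun \<phi> t) (apply_bcontfun \<psi> t))"
        by (simp add: Z_def dist_norm flip: scaleR_right_diff_distrib)
      also have "\<dots> \<le> L * (exp (K * \<bar>t\<bar>) * dist \<phi> \<psi>)"
        using L by (intro mult_left_mono dist_bounded) auto
      finally show "norm (g \<phi> t - g \<psi> t) \<le> L * dist \<phi> \<psi> * exp (K * \<bar>t\<bar>)" by (simp add: algebra_simps)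
    qed (use L in \<open>auto simp: primitive_0\<close>)
    then have "norm (primitive (g \<phi>) t - primitive (g \<psi>) t) \<le> dist \<phi> \<psi> / 2 * exp (K * \<bar>t\<bar>)"
      using L by (simp add: K_def)
    then have "exp (- (K * \<bar>t\<bar>)) * norm (primitive (g \<phi>) t - primitive (g \<psi>) t)
        \<le> exp (- (K * \<bar>t\<bar>)) * (dist \<phi> \<psi> / 2 * exp (K * \<bar>t\<bar>))" by (rule mult_left_mono) simp
    also have "\<dots> = 1 / 2 * dist \<phi> \<psi> * (exp (- (K * \<bar>t\<bar>)) * exp (K * \<bar>t\<bar>))" by simp
    finally show "dist (apply_bcontfun (P \<phi>) t) (apply_bcontfun (P \<psi>) t) \<le> 1 / 2 * dist \<phi> \<psi>"
      unfolding e1 P by (simp add: Q_def dist_norm flip: scaleR_right_diff_distrib)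
  qed
  then obtain \<phi> where \<phi>: "P \<phi> = \<phi>"
    using banach_fix_type[of "1/2" P] by auto
  have Zt: "Z \<phi> t = x + primitive (g \<phi>) t" for t
  proof -
    have "apply_bcontfun \<phi> t = Q \<phi> t" using P[of \<phi>] \<phi> by simp
    then show ?thesis using e1[of t] by (simp add: Z_def Q_def mult.commute)
  qed
  then have "Z \<phi> = (\<lambda>t. x + primitive (g \<phi>) t)" by auto
  moreover have "((\<lambda>t. x + primitive (g \<phi>) t) has_vector_derivative F t (Z \<phi> t)) (at t)" for t
    using dprim[of \<phi> t] by (auto intro!: derivative_eq_intros simp: g_def)
  ultimately have "\<forall>t. (Z \<phi> has_vector_derivative F t (Z \<phi> t)) (at t)" by simp
  moreover have "Z \<phi> 0 = x" using Zt[of 0] by (simp add: primitive_0)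
  ultimately show ?thesis by blast
qed

text \<open>For \<open>t \<ge> 0\<close> the function
  \<open>exp (- 2 L t) * \<bar>w t\<bar>\<^sup>2\<close> is nonincreasing. The squared norm is used
  because it is differentiable also where \<open>w\<close> vanishes; negative times follow by
  reflection.\<close>

lemma Gronwall_growth:
  fixes w :: "real \<Rightarrow> 'a::real_inner"
  assumes dw: "\<And>t. (w has_vector_derivative w' t) (at t)" and bd: "\<And>t. norm (w' t) \<le> L * norm (w t)"
  shows "norm (w t) \<le> exp (L * \<bar>t\<bar>) * norm (w 0)"
proof -
  have pos: "norm (w t) \<le> exp (L * t) * norm (w 0)"
    if t: "0 \<le> t" and dw: "\<And>t. (w has_vector_derivative w' t) (at t)"
      and bd: "\<And>t. norm (w' t) \<le> L * norm (w t)" for w w' :: "real \<Rightarrow> 'a" and t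
  proof -
    define m where "m t = exp (- (2 * L * t)) * (w t \<bullet> w t)" for t
    define m' where "m' t = exp (- (2 * L * t)) * (2 * (w t \<bullet> w' t) - 2 * L * (w t \<bullet> w t))" for t
    have dm: "(m has_real_derivative m' t) (at t)" for t
    proof -
      have "((\<lambda>t. w t \<bullet> w t) has_real_derivative 2 * (w t \<bullet> w' t)) (at t)"
        using dw[of t] unfolding has_vector_derivative_def has_field_derivative_def
        by (auto intro!: derivative_eq_intros simp: fun_eq_iff inner_commute algebra_simps)
      then show ?thesis unfolding m_def[abs_def] m'_def
        by (auto intro!: derivative_eq_intros simp: algebra_simps)
    qed
    have m'_le: "m' t \<le> 0" for t
    proof -
      have "w t \<bullet> w' t \<le> norm (w t) * norm (w' t)" by (rule norm_cauchy_schwarz)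
      also have "\<dots> \<le> norm (w t) * (L * norm (w t))" by (intro mult_left_mono bd) simp
      also have "\<dots> = L * (w t \<bullet> w t)" by (simp add: dot_square_norm power2_eq_square)
      finally show ?thesis unfolding m'_def by (intro mult_nonneg_nonpos) auto
    qed
    have "m t \<le> m 0"
      by (rule DERIV_nonpos_imp_nonincreasing[OF t]) (use dm m'_le in blast)
    then have "exp (2 * L * t) * m t \<le> exp (2 * L * t) * m 0" by simp
    moreover have "exp (2 * L * t) * m t = (norm (w t))\<^sup>2"
      by (simp add: m_def exp_minus dot_square_norm)
    moreover have "exp (2 * L * t) * m 0 = (exp (L * t) * norm (w 0))\<^sup>2"
      by (simp add: m_def dot_square_norm power_mult_distrib exp_double[symmetric] mult.assoc)
    ultimately show ?thesis
      by (metis abs_le_square_iff abs_norm_cancel abs_of_nonneg exp_ge_zero mult_nonneg_nonneg norm_ge_zero)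
  qed
  show ?thesis
  proof (cases "0 \<le> t")
    case True
    then show ?thesis using pos[OF True dw bd] by simp
  next
    case False
    have "norm (w (- (- t))) \<le> exp (L * - t) * norm (w (- 0))"
    proof (rule pos)
      show "((\<lambda>t. w (- t)) has_vector_derivative - w' (- t)) (at t)" for t
        by (rule has_vector_derivative_reflect[OF dw])
      show "norm (- w' (- t)) \<le> L * norm (w (- t))" for t using bd[of "- t"] by simp
    qed (use False in auto)
    then show ?thesis using False by simp
  qed
qed

section \<open>Gradients and Hessians\<close>

lemma gradient_has_derivative:
  assumes "C2_in_u G"
  shows "(G t has_derivative (\<lambda>h. partial_grad G t u \<bullet> h)) (at u)"
proof -
  obtain D where D: "(G t has_derivative D) (at u)"
    using assms unfolding C2_in_u_def differentiable_def by blast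
  have D': "D = frechet_derivative (G t) (at u)" by (rule frechet_derivative_at[OF D])
  have lin: "linear D" using D by (rule has_derivative_linear)
  have "D h = partial_grad G t u \<bullet> h" for h
  proof -
    have "D h = D (\<Sum>i\<in>UNIV. h $ i *s axis i 1)" by (simp add: basis_expansion)
    also have "\<dots> = (\<Sum>i\<in>UNIV. h $ i * D (axis i 1))"
      using lin by (simp add: linear_sum linear_cmul scalar_mult_eq_scaleR)
    also have "\<dots> = partial_grad G t u \<bullet> h"
      by (simp add: partial_grad_def inner_vec_def D' mult.commute)
    finally show ?thesis .
  qed
  then have "D = (\<lambda>h. partial_grad G t u \<bullet> h)" by auto
  then show ?thesis using D by simp
qed

lemma hessian_has_derivative:
  assumes "C2_in_u G"
  shows "(partial_grad G t has_derivative (\<lambda>h. partial_hess G t u *v h)) (at u)"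
proof -
  obtain D where D: "(partial_grad G t has_derivative D) (at u)"
    using assms unfolding C2_in_u_def differentiable_def by blast
  have lin: "linear D" using D by (rule has_derivative_linear)
  have comp: "frechet_derivative (\<lambda>v. partial_grad G t v $ i) (at u) = (\<lambda>h. D h $ i)" for i
    by (rule frechet_derivative_at[symmetric])
       (rule bounded_linear.has_derivative[OF bounded_linear_vec_nth D])
  have "D h = partial_hess G t u *v h" for h
  proof -
    have "D h = D (\<Sum>j\<in>UNIV. h $ j *s axis j 1)" by (simp add: basis_expansion)
    also have "\<dots> = (\<Sum>j\<in>UNIV. h $ j *\<^sub>R D (axis j 1))"
      using lin by (simp add: linear_sum linear_cmul scalar_mult_eq_scaleR)
    finally show ?thesis
      by (simp add: vec_eq_iff matrix_vector_mult_def partial_hess_def comp mult.commute)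
  qed
  then have "D = (\<lambda>h. partial_hess G t u *v h)" by auto
  then show ?thesis using D by simp
qed

text \<open>Two applications of the mean value theorem: in the direction \<open>y\<close> to an
  \<open>x\<close>-increment of \<open>f\<close>, and then in the direction \<open>x\<close> to the
  gradient tested against \<open>y\<close>.\<close>

lemma second_difference_mean_value:
  fixes f :: "'a::real_inner \<Rightarrow> real"
  assumes f: "\<And>u. (f has_derivative (\<lambda>h. g u \<bullet> h)) (at u)"
    and g: "\<And>u. (g has_derivative H u) (at u)" and s: "0 < s"
  shows "\<exists>\<eta> \<theta>. 0 < \<eta> \<and> \<eta> < s \<and> 0 < \<theta> \<and> \<theta> < s \<and>
    f (u + s *\<^sub>R x + s *\<^sub>R y) - f (u + s *\<^sub>R x) - f (u + s *\<^sub>R y) + f u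
      = s\<^sup>2 * (H (u + \<eta> *\<^sub>R x + \<theta> *\<^sub>R y) x \<bullet> y)"
proof -
  define \<phi> where "\<phi> r = f (u + s *\<^sub>R x + r *\<^sub>R y) - f (u + r *\<^sub>R y)" for r
  have d\<phi>: "(\<phi> has_real_derivative (g (u + s *\<^sub>R x + r *\<^sub>R y) - g (u + r *\<^sub>R y)) \<bullet> y) (at r)" for r
  proof -
    have "((\<lambda>r. f (c + r *\<^sub>R y)) has_derivative (\<lambda>h. g (c + r *\<^sub>R y) \<bullet> (h *\<^sub>R y))) (at r)" for c
      by (rule has_derivative_compose[OF _ f, of "\<lambda>r. c + r *\<^sub>R y"]) (auto intro!: derivative_eq_intros)
    from has_derivative_diff[OF this this]
    show ?thesis unfolding \<phi>_def[abs_def] has_field_derivative_def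
      by (rule has_derivative_eq_rhs) (simp add: fun_eq_iff inner_diff_left algebra_simps)
  qed
  obtain \<theta> where \<theta>: "0 < \<theta>" "\<theta> < s"
    "\<phi> s - \<phi> 0 = (s - 0) * ((g (u + s *\<^sub>R x + \<theta> *\<^sub>R y) - g (u + \<theta> *\<^sub>R y)) \<bullet> y)"
    using MVT2[OF s d\<phi>] by blast
  define \<psi> where "\<psi> r = g (u + r *\<^sub>R x + \<theta> *\<^sub>R y) \<bullet> y" for r
  have d\<psi>: "(\<psi> has_real_derivative H (u + r *\<^sub>R x + \<theta> *\<^sub>R y) x \<bullet> y) (at r)" for r
  proof -
    have lin: "linear (H v)" for v using g by (rule has_derivative_linear)
    have "((\<lambda>r. g (u + r *\<^sub>R x + \<theta> *\<^sub>R y)) has_derivative (\<lambda>h. H (u + r *\<^sub>R x + \<theta> *\<^sub>R y) (h *\<^sub>R x))) (at r)"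
      by (rule has_derivative_compose[OF _ g, of "\<lambda>r. u + r *\<^sub>R x + \<theta> *\<^sub>R y"])
         (auto intro!: derivative_eq_intros)
    from has_derivative_inner_left[OF this, of y]
    show ?thesis unfolding \<psi>_def[abs_def] has_field_derivative_def
      by (rule has_derivative_eq_rhs) (simp add: fun_eq_iff linear_cmul[OF lin] mult.commute)
  qed
  obtain \<eta> where \<eta>: "0 < \<eta>" "\<eta> < s" "\<psi> s - \<psi> 0 = (s - 0) * (H (u + \<eta> *\<^sub>R x + \<theta> *\<^sub>R y) x \<bullet> y)"
    using MVT2[OF s d\<psi>] by blast
  have "f (u + s *\<^sub>R x + s *\<^sub>R y) - f (u + s *\<^sub>R x) - f (u + s *\<^sub>R y) + f u = \<phi> s - \<phi> 0"
    by (simp add: \<phi>_def)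
  also have "\<dots> = s * (\<psi> s - \<psi> 0)" unfolding \<theta>(3) by (simp add: \<psi>_def inner_diff_left)
  also have "\<dots> = s\<^sup>2 * (H (u + \<eta> *\<^sub>R x + \<theta> *\<^sub>R y) x \<bullet> y)"
    unfolding \<eta>(3) by (simp add: power2_eq_square)
  finally show ?thesis using \<theta> \<eta> by blast
qed

text \<open>The second difference quotient is symmetric in \<open>x\<close> and \<open>y\<close>,
  and by continuity of \<open>H\<close> it tends to \<open>H u x \<bullet> y\<close> as the step
  tends to 0.\<close>

lemma second_derivative_symmetric:
  fixes f :: "'a::real_inner \<Rightarrow> real"
  assumes f: "\<And>u. (f has_derivative (\<lambda>h. g u \<bullet> h)) (at u)"
    and g: "\<And>u. (g has_derivative H u) (at u)"
    and cont: "\<And>x y. continuous_on UNIV (\<lambda>u. H u x \<bullet> y)"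
  shows "H u x \<bullet> y = H u y \<bullet> x"
proof -
  define S where "S x y s = (f (u + s *\<^sub>R x + s *\<^sub>R y) - f (u + s *\<^sub>R x) - f (u + s *\<^sub>R y) + f u) / s\<^sup>2"
    for x y and s :: real
  define r where "r n = inverse (real (Suc n))" for n
  have r: "0 < r n" for n by (simp add: r_def)
  have r0: "r \<longlonglongrightarrow> 0" unfolding r_def[abs_def] by (rule LIMSEQ_inverse_real_of_nat)
  have lim: "(\<lambda>n. S x y (r n)) \<longlonglongrightarrow> H u x \<bullet> y" for x y
  proof -
    have "\<forall>n. \<exists>\<eta> \<theta>. 0 < \<eta> \<and> \<eta> < r n \<and> 0 < \<theta> \<and> \<theta> < r n \<and>
      S x y (r n) = H (u + \<eta> *\<^sub>R x + \<theta> *\<^sub>R y) x \<bullet> y"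
    proof
      fix n
      have rn: "r n \<noteq> 0" using r[of n] by simp
      obtain \<eta> \<theta> where "0 < \<eta>" "\<eta> < r n" "0 < \<theta>" "\<theta> < r n"
        "f (u + r n *\<^sub>R x + r n *\<^sub>R y) - f (u + r n *\<^sub>R x) - f (u + r n *\<^sub>R y) + f u
          = (r n)\<^sup>2 * (H (u + \<eta> *\<^sub>R x + \<theta> *\<^sub>R y) x \<bullet> y)"
        using second_difference_mean_value[OF f g r] by blast
      then show "\<exists>\<eta> \<theta>. 0 < \<eta> \<and> \<eta> < r n \<and> 0 < \<theta> \<and> \<theta> < r n \<and>
          S x y (r n) = H (u + \<eta> *\<^sub>R x + \<theta> *\<^sub>R y) x \<bullet> y"
        using rn by (intro exI[of _ \<eta>] exI[of _ \<theta>]) (simp add: S_def)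
    qed
    then obtain \<eta> \<theta> where *: "\<And>n. 0 < \<eta> n" "\<And>n. \<eta> n < r n" "\<And>n. 0 < \<theta> n" "\<And>n. \<theta> n < r n"
      "\<And>n. S x y (r n) = H (u + \<eta> n *\<^sub>R x + \<theta> n *\<^sub>R y) x \<bullet> y" by metis
    have "\<eta> \<longlonglongrightarrow> 0" "\<theta> \<longlonglongrightarrow> 0"
      by (rule tendsto_sandwich[OF _ _ tendsto_const r0]; use * in \<open>auto intro!: always_eventually less_imp_le\<close>)+
    then have "(\<lambda>n. u + \<eta> n *\<^sub>R x + \<theta> n *\<^sub>R y) \<longlonglongrightarrow> u + 0 *\<^sub>R x + 0 *\<^sub>R y"
      by (intro tendsto_intros)
    then have "(\<lambda>n. u + \<eta> n *\<^sub>R x + \<theta> n *\<^sub>R y) \<longlonglongrightarrow> u" by simp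
    then have "(\<lambda>n. H (u + \<eta> n *\<^sub>R x + \<theta> n *\<^sub>R y) x \<bullet> y) \<longlonglongrightarrow> H u x \<bullet> y"
      by (intro continuous_on_tendsto_compose[OF cont[of x y]]) auto
    then show ?thesis using *(5) by simp
  qed
  have "S x y s = S y x s" for s by (simp add: S_def algebra_simps)
  then have "(\<lambda>n. S y x (r n)) \<longlonglongrightarrow> H u x \<bullet> y" using lim[of x y] by simp
  then show ?thesis using lim[of y x] LIMSEQ_unique by blast
qed

lemma hessian_symmetric:
  assumes G: "C2_in_u G"
  shows "(partial_hess G t u *v x) \<bullet> y = (partial_hess G t u *v y) \<bullet> x"
proof (rule second_derivative_symmetric[where f = "G t" and g = "partial_grad G t"
      and H = "\<lambda>u h. partial_hess G t u *v h"])
  have c: "continuous_on UNIV (partial_hess G t)" using G by (simp add: C2_in_u_def)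
  show "continuous_on UNIV (\<lambda>u. (partial_hess G t u *v x) \<bullet> y)" for x y
    unfolding inner_vec_def matrix_vector_mult_def by (simp, intro continuous_intros c)
qed (rule gradient_has_derivative[OF G] hessian_has_derivative[OF G])+

section \<open>Gradient estimates from the bounds on the Hessian\<close>

lemma periodic_reduce:
  fixes f :: "real \<Rightarrow> 'a"
  assumes T: "0 < T" and per: "\<And>t. f (t + T) = f t"
  shows "\<exists>s\<in>{0..T}. f t = f s"
proof -
  have n: "f (s + real n * T) = f s" for s n
  proof (induction n)
    case (Suc n)
    have "f (s + real (Suc n) * T) = f (s + real n * T + T)" by (simp add: algebra_simps)
    then show ?case using Suc per by simp
  qed simp
  have z: "f (s + of_int k * T) = f s" for s k
  proof (cases "0 \<le> k")
    case True
    then show ?thesis using n[of s "nat k"] by simp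
  next
    case False
    then show ?thesis using n[of "s + of_int k * T" "nat (- k)"] by simp
  qed
  define s where "s = t - of_int \<lfloor>t / T\<rfloor> * T"
  have "of_int \<lfloor>t / T\<rfloor> * T \<le> t"
    by (rule iffD1[OF pos_le_divide_eq[OF T] of_int_floor_le])
  moreover have "t < of_int (\<lfloor>t / T\<rfloor> + 1) * T"
    by (rule iffD1[OF pos_divide_less_eq[OF T] conjunct2[OF floor_correct]])
  ultimately have "s \<in> {0..T}" by (simp add: s_def algebra_simps)
  moreover have "f t = f s" using z[of s "\<lfloor>t / T\<rfloor>"] by (simp add: s_def)
  ultimately show ?thesis by blast
qed

lemma periodic_continuous_bounded:
  fixes f :: "real \<Rightarrow> 'a::real_normed_vector"
  assumes T: "0 < T" and cont: "continuous_on UNIV f" and per: "\<And>t. f (t + T) = f t"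
  obtains C where "0 \<le> C" "\<And>t. norm (f t) \<le> C"
proof -
  have "bounded (f ` {0..T})"
    by (intro compact_imp_bounded compact_continuous_image continuous_on_subset[OF cont]) auto
  then obtain C where C: "\<forall>t\<in>{0..T}. norm (f t) \<le> C" by (auto simp: bounded_iff)
  have "norm (f t) \<le> C" for t using periodic_reduce[of T f, OF T per, of t] C by auto
  moreover have "0 \<le> C" using C T norm_ge_zero[of "f 0"] by (meson atLeastAtMost_iff order.refl order_less_imp_le order_trans)
  ultimately show ?thesis using that by blast
qed

lemma matrix_quadratic_form_bound:
  fixes M :: "real^'n^'n"
  shows "\<bar>x \<bullet> (M *v x)\<bar> \<le> real CARD('n) * norm M * (norm x)\<^sup>2"
proof -
  have "norm (M *v x) \<le> (\<Sum>i\<in>UNIV. \<bar>(M *v x) $ i\<bar>)" by (rule norm_le_l1_cart)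
  also have "\<dots> \<le> (\<Sum>i\<in>(UNIV::'n set). norm M * norm x)"
  proof (rule sum_mono)
    fix i
    have "\<bar>(M *v x) $ i\<bar> = \<bar>M $ i \<bullet> x\<bar>" by (simp add: matrix_vector_mult_def inner_vec_def)
    also have "\<dots> \<le> norm (M $ i) * norm x" by (rule Cauchy_Schwarz_ineq2)
    also have "\<dots> \<le> norm M * norm x"
      by (intro mult_right_mono Finite_Cartesian_Product.norm_nth_le) auto
    finally show "\<bar>(M *v x) $ i\<bar> \<le> norm M * norm x" .
  qed
  also have "\<dots> = real CARD('n) * norm M * norm x" by simp
  finally have *: "norm (M *v x) \<le> real CARD('n) * norm M * norm x" .
  have "\<bar>x \<bullet> (M *v x)\<bar> \<le> norm x * norm (M *v x)" by (rule Cauchy_Schwarz_ineq2)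
  also have "\<dots> \<le> norm x * (real CARD('n) * norm M * norm x)" by (intro mult_left_mono * norm_ge_zero)
  finally show ?thesis by (simp add: power2_eq_square algebra_simps)
qed

text \<open>The mean value theorem for one scalar function along the segment. The point
  \<open>\<xi>\<close> depends on the tested direction \<open>e\<close>, which is harmless as long
  as a single direction is tested.\<close>

lemma gradient_mean_value:
  fixes G :: "real \<Rightarrow> real^'n \<Rightarrow> real"
  assumes G: "C2_in_u G"
  shows "\<exists>\<xi>. (partial_grad G t x - partial_grad G t y) \<bullet> e = (partial_hess G t \<xi> *v (x - y)) \<bullet> e"
proof -
  define \<phi> where "\<phi> r = partial_grad G t (y + r *\<^sub>R (x - y)) \<bullet> e" for r
  have d\<phi>: "(\<phi> has_real_derivative (partial_hess G t (y + r *\<^sub>R (x - y)) *v (x - y)) \<bullet> e) (at r)" for r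
  proof -
    have "((\<lambda>r. partial_grad G t (y + r *\<^sub>R (x - y))) has_derivative
        (\<lambda>h. partial_hess G t (y + r *\<^sub>R (x - y)) *v (h *\<^sub>R (x - y)))) (at r)"
      by (rule has_derivative_compose[OF _ hessian_has_derivative[OF G], of "\<lambda>r. y + r *\<^sub>R (x - y)"])
         (auto intro!: derivative_eq_intros)
    from has_derivative_inner_left[OF this, of e]
    show ?thesis unfolding \<phi>_def[abs_def] has_field_derivative_def
      by (rule has_derivative_eq_rhs) (simp add: fun_eq_iff matrix_vector_mult_scaleR mult.commute)
  qed
  obtain r where "\<phi> 1 - \<phi> 0 = (1 - 0) * ((partial_hess G t (y + r *\<^sub>R (x - y)) *v (x - y)) \<bullet> e)"
    using MVT2[OF zero_less_one d\<phi>] by blast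
  then show ?thesis by (auto simp: \<phi>_def inner_diff_left)
qed

lemma loewner_le_quadratic_form:
  assumes "loewner_le C D"
  shows "x \<bullet> (C *v x) \<le> x \<bullet> (D *v x)"
  using assms by (simp add: loewner_le_def psd_def matrix_vector_mult_diff_rdistrib inner_diff_right)

text \<open>The mean value form is tested in the direction \<open>w + 2 k\<close>. Symmetry of the
  Hessian completes the square, and the upper bound \<open>B\<close> and the lower bound
  \<open>A\<close> are then applied to the two resulting quadratic forms separately.\<close>

lemma gradient_increment_bound:
  fixes G :: "real \<Rightarrow> real^'n \<Rightarrow> real"
  assumes G: "C2_in_u G"
    and hess: "\<And>u. loewner_le (A t) (partial_hess G t u) \<and> loewner_le (partial_hess G t u) (B t)"
  shows "(partial_grad G t x - partial_grad G t y) \<bullet> (x - y) + 2 * ((partial_grad G t x - partial_grad G t y) \<bullet> k)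
    \<le> (x - y + k) \<bullet> (B t *v (x - y + k)) - (A t *v k) \<bullet> k"
proof -
  define w where "w = x - y"
  obtain \<xi> where \<xi>: "(partial_grad G t x - partial_grad G t y) \<bullet> (w + 2 *\<^sub>R k)
      = (partial_hess G t \<xi> *v w) \<bullet> (w + 2 *\<^sub>R k)"
    using gradient_mean_value[OF G, of t x y] unfolding w_def by blast
  let ?H = "partial_hess G t \<xi>"
  have "(w + k) \<bullet> (?H *v (w + k)) = w \<bullet> (?H *v w) + w \<bullet> (?H *v k) + k \<bullet> (?H *v w) + k \<bullet> (?H *v k)"
    by (simp add: matrix_vector_right_distrib inner_add_left inner_add_right)
  also have "w \<bullet> (?H *v k) = k \<bullet> (?H *v w)"
    using hessian_symmetric[OF G, of t \<xi> k w] by (simp add: inner_commute)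
  finally have "(?H *v w) \<bullet> (w + 2 *\<^sub>R k) = (w + k) \<bullet> (?H *v (w + k)) - k \<bullet> (?H *v k)"
    by (simp add: inner_add_right inner_commute)
  also have "\<dots> \<le> (w + k) \<bullet> (B t *v (w + k)) - k \<bullet> (A t *v k)"
    using loewner_le_quadratic_form hess[of \<xi>] by (intro diff_mono) blast+
  finally show ?thesis using \<xi> by (simp add: w_def inner_add_right inner_commute)
qed

text \<open>Two-sided bounds on the quadratic form of a symmetric Hessian bound its bilinear form,
  by polarisation and the parallelogram law.\<close>

lemma gradient_Lipschitz:
  fixes G :: "real \<Rightarrow> real^'n \<Rightarrow> real"
  assumes G: "C2_in_u G"
    and hess: "\<And>u. loewner_le (A t) (partial_hess G t u) \<and> loewner_le (partial_hess G t u) (B t)"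
    and M: "\<And>x. \<bar>x \<bullet> (A t *v x)\<bar> \<le> M * (norm x)\<^sup>2" "\<And>x. \<bar>x \<bullet> (B t *v x)\<bar> \<le> M * (norm x)\<^sup>2"
  shows "norm (partial_grad G t x - partial_grad G t y) \<le> M * norm (x - y)"
proof -
  define w where "w = x - y"
  define D where "D = partial_grad G t x - partial_grad G t y"
  have bound: "D \<bullet> e \<le> M / 2 * ((norm w)\<^sup>2 + (norm e)\<^sup>2)" for e
  proof -
    obtain \<xi> where \<xi>: "D \<bullet> e = (partial_hess G t \<xi> *v w) \<bullet> e"
      using gradient_mean_value[OF G, of t x y e] unfolding w_def D_def by blast
    let ?H = "partial_hess G t \<xi>"
    have H: "\<bar>z \<bullet> (?H *v z)\<bar> \<le> M * (norm z)\<^sup>2" for z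
      using loewner_le_quadratic_form[of "A t" ?H z] loewner_le_quadratic_form[of ?H "B t" z]
        hess[of \<xi>] M[of z] by linarith
    have "4 * ((?H *v w) \<bullet> e) = (w + e) \<bullet> (?H *v (w + e)) - (w - e) \<bullet> (?H *v (w - e))"
      using hessian_symmetric[OF G, of t \<xi> w e]
      by (simp add: matrix_vector_right_distrib matrix_vector_mult_diff_distrib inner_add_left
          inner_add_right inner_diff_left inner_diff_right inner_commute)
    also have "\<dots> \<le> M * (norm (w + e))\<^sup>2 + M * (norm (w - e))\<^sup>2"
      using H[of "w + e"] H[of "w - e"] by linarith
    also have "\<dots> = 2 * M * ((norm w)\<^sup>2 + (norm e)\<^sup>2)"
      by (simp add: power2_norm_eq_inner inner_add_left inner_add_right inner_diff_left
          inner_diff_right algebra_simps inner_commute)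
    finally show ?thesis using \<xi> by simp
  qed
  show ?thesis
  proof (cases "D = 0 \<or> w = 0")
    case True
    have "0 \<le> M * (norm w)\<^sup>2" using M(1)[of w] abs_ge_zero order_trans by blast
    then have "w \<noteq> 0 \<Longrightarrow> 0 \<le> M" by (simp add: zero_le_mult_iff)
    then show ?thesis using True unfolding D_def w_def by (cases "x = y") auto
  next
    case False
    \<comment> \<open>The vector parallel to \<open>D\<close> with the length of \<open>w\<close>:
      this balances the two squares and turns the bound into
      \<open>norm D \<le> M * norm w\<close>.\<close>
    define e where "e = (norm w / norm D) *\<^sub>R D"
    have ne: "norm e = norm w" using False by (simp add: e_def)
    have "D \<bullet> e = norm w * norm D" using False by (simp add: e_def dot_square_norm power2_eq_square)
    then have "norm w * norm D \<le> norm w * (M * norm w)"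
      using bound[of e] unfolding ne by (simp add: power2_eq_square algebra_simps)
    then show ?thesis using False unfolding D_def w_def by (simp add: mult_le_cancel_left)
  qed
qed

text \<open>\<open>G\<close> is only continuous in \<open>t\<close>, but its difference quotients in
  \<open>u\<close> inherit that continuity, and the Lipschitz bound makes them converge to the
  gradient at the rate \<open>M * r n\<close>, uniformly in \<open>t\<close>.\<close>

lemma gradient_continuous_in_t:
  fixes G :: "real \<Rightarrow> real^'n \<Rightarrow> real"
  assumes G: "C2_in_u G" and cont: "continuous_on UNIV (\<lambda>(t, u). G t u)"
    and M: "0 \<le> M" and lip: "\<And>t x y. norm (partial_grad G t x - partial_grad G t y) \<le> M * norm (x - y)"
  shows "continuous_on UNIV (\<lambda>t. partial_grad G t u)"
proof -
  define r where "r n = inverse (real (Suc n))" for n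
  have r: "0 < r n" for n by (simp add: r_def)
  have r0: "r \<longlonglongrightarrow> 0" unfolding r_def[abs_def] by (rule LIMSEQ_inverse_real_of_nat)
  have contG: "continuous_on UNIV (\<lambda>t. G t v)" for v
    using continuous_on_compose2[OF cont, of UNIV "\<lambda>t. (t, v)"] by (simp add: continuous_on_Pair)
  have "continuous_on UNIV (\<lambda>t. partial_grad G t u $ i)" for i
  proof (rule uniform_limit_theorem)
    define D where "D n t = (G t (u + r n *\<^sub>R axis i 1) - G t u) / r n" for n t
    show "\<forall>\<^sub>F n in sequentially. continuous_on UNIV (D n)"
      unfolding D_def using r by (intro always_eventually allI continuous_intros contG) (auto simp: less_imp_neq[symmetric])
    have close: "\<bar>D n t - partial_grad G t u $ i\<bar> \<le> M * r n" for n t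
    proof -
      define \<phi> where "\<phi> h = G t (u + h *\<^sub>R axis i 1)" for h
      have d\<phi>: "(\<phi> has_real_derivative partial_grad G t (u + h *\<^sub>R axis i 1) $ i) (at h)" for h
      proof -
        have "(\<phi> has_derivative (\<lambda>k. partial_grad G t (u + h *\<^sub>R axis i 1) \<bullet> (k *\<^sub>R axis i 1))) (at h)"
          unfolding \<phi>_def
          by (rule has_derivative_compose[OF _ gradient_has_derivative[OF G], of "\<lambda>h. u + h *\<^sub>R axis i 1"])
             (auto intro!: derivative_eq_intros)
        then show ?thesis unfolding has_field_derivative_def
          by (rule has_derivative_eq_rhs) (simp add: fun_eq_iff inner_axis mult.commute)
      qed
      obtain h where h: "0 < h" "h < r n"
        "\<phi> (r n) - \<phi> 0 = (r n - 0) * (partial_grad G t (u + h *\<^sub>R axis i 1) $ i)"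
        using MVT2[OF r[of n] d\<phi>] by blast
      have "D n t = partial_grad G t (u + h *\<^sub>R axis i 1) $ i"
        using h(3) r[of n] by (simp add: D_def \<phi>_def)
      then have "\<bar>D n t - partial_grad G t u $ i\<bar>
          = \<bar>(partial_grad G t (u + h *\<^sub>R axis i 1) - partial_grad G t u) $ i\<bar>" by simp
      also have "\<dots> \<le> norm (partial_grad G t (u + h *\<^sub>R axis i 1) - partial_grad G t u)"
        by (rule component_le_norm_cart)
      also have "\<dots> \<le> M * norm (u + h *\<^sub>R axis i 1 - u)" by (rule lip)
      also have "\<dots> = M * h" using h by simp
      also have "\<dots> \<le> M * r n" using h M by (intro mult_left_mono) auto
      finally show ?thesis .
    qed
    show "uniform_limit UNIV D (\<lambda>t. partial_grad G t u $ i) sequentially"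
    proof (rule uniform_limitI)
      fix e :: real assume e: "0 < e"
      have "(\<lambda>n. M * r n) \<longlonglongrightarrow> M * 0" by (intro tendsto_intros r0)
      then have "\<forall>\<^sub>F n in sequentially. M * r n < e" using e by (simp add: order_tendsto_iff)
      then show "\<forall>\<^sub>F n in sequentially. \<forall>t\<in>UNIV. dist (D n t) (partial_grad G t u $ i) < e"
        by (rule eventually_mono) (use close in \<open>auto simp: dist_real_def intro: le_less_trans\<close>)
    qed
  qed simp
  then show ?thesis by (intro continuous_on_vec_lambda[of UNIV "\<lambda>i t. partial_grad G t u $ i", simplified])
qed

lemma continuous_on_compose_uniform_Lipschitz:
  fixes g :: "real \<Rightarrow> 'a::real_normed_vector \<Rightarrow> 'b::real_normed_vector"
  assumes lip: "\<And>t x y. norm (g t x - g t y) \<le> M * norm (x - y)"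
    and cont: "\<And>x. continuous_on UNIV (\<lambda>t. g t x)" and z: "continuous_on UNIV z"
  shows "continuous_on UNIV (\<lambda>t. g t (z t))"
proof (rule continuous_at_imp_continuous_on, rule ballI)
  fix t :: real
  have "((\<lambda>s. g s (z s) - g s (z t)) \<longlongrightarrow> 0) (at t)"
  proof (rule Lim_null_comparison)
    show "\<forall>\<^sub>F s in at t. norm (g s (z s) - g s (z t)) \<le> M * norm (z s - z t)"
      by (intro always_eventually allI lip)
    have "(z \<longlongrightarrow> z t) (at t)" using z by (simp add: continuous_on_def)
    then have "((\<lambda>s. M * norm (z s - z t)) \<longlongrightarrow> M * norm (z t - z t)) (at t)"
      by (intro tendsto_intros)
    then show "((\<lambda>s. M * norm (z s - z t)) \<longlongrightarrow> 0) (at t)" by simp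
  qed
  moreover have "((\<lambda>s. g s (z t)) \<longlongrightarrow> g t (z t)) (at t)"
    using cont[of "z t"] by (simp add: continuous_on_def)
  ultimately have "((\<lambda>s. g s (z s) - g s (z t) + g s (z t)) \<longlongrightarrow> 0 + g t (z t)) (at t)"
    by (rule tendsto_add)
  then show "isCont (\<lambda>t. g t (z t)) t" by (simp add: isCont_def)
qed

section \<open>Expansive maps and uniform limits\<close>

text \<open>The limit takes values in a ball of radius \<open>R\<close>, and from some index on the
  approximants take theirs in the ball of radius \<open>R + 1\<close>. On the resulting compact set
  \<open>q\<close> is uniformly continuous.\<close>

lemma uniform_limit_compose_continuous:
  fixes q :: "real \<Rightarrow> 'a::euclidean_space \<Rightarrow> real"
  assumes q: "continuous_on UNIV (\<lambda>(t, x). q t x)"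
    and W: "uniform_limit {a..b} W w sequentially" and w: "continuous_on {a..b} w"
  shows "uniform_limit {a..b} (\<lambda>n t. q t (W n t)) (\<lambda>t. q t (w t)) sequentially"
proof -
  have "bounded (w ` {a..b})" by (intro compact_imp_bounded compact_continuous_image w) simp
  then obtain R where R: "\<forall>t\<in>{a..b}. norm (w t) \<le> R" by (auto simp: bounded_iff)
  have "compact ({a..b} \<times> cball (0::'a) (R + 1))" by (intro compact_Times) auto
  then have uc: "uniformly_continuous_on ({a..b} \<times> cball 0 (R + 1)) (\<lambda>(t, x). q t x)"
    by (rule compact_uniformly_continuous[OF continuous_on_subset[OF q subset_UNIV]])
  show ?thesis
  proof (rule uniform_limitI)
    fix e :: real assume "0 < e"
    then obtain d where d: "0 < d" and D: "\<And>t x y. t \<in> {a..b} \<Longrightarrow> x \<in> cball 0 (R + 1) \<Longrightarrow> y \<in> cball 0 (R + 1)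
        \<Longrightarrow> dist x y < d \<Longrightarrow> dist (q t x) (q t y) < e"
      using uc unfolding uniformly_continuous_on_def by (force simp: dist_Pair_Pair)
    have "0 < min d 1" using d by simp
    from uniform_limitD[OF W this]
    show "\<forall>\<^sub>F n in sequentially. \<forall>t\<in>{a..b}. dist (q t (W n t)) (q t (w t)) < e"
    proof (rule eventually_mono, intro ballI)
      fix n t assume *: "\<forall>t\<in>{a..b}. dist (W n t) (w t) < min d 1" and t: "t \<in> {a..b}"
      have dt: "dist (W n t) (w t) < d" "dist (W n t) (w t) < 1" using bspec[OF * t] by auto
      have "norm (W n t) \<le> norm (w t) + dist (W n t) (w t)"
        unfolding dist_norm by norm
      then have "norm (W n t) \<le> R + 1" "norm (w t) \<le> R + 1" using bspec[OF R t] dt by linarith+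
      then show "dist (q t (W n t)) (q t (w t)) < e" using D[OF t _ _ dt(1)] by simp
    qed
  qed
qed

text \<open>Expansiveness is used twice: it gives injectivity, so that the range is open, and it
  makes preimages of a convergent sequence Cauchy, so that the range is closed. Connectedness of the
  space does the rest.\<close>

lemma range_UNIV_of_expansive:
  fixes f :: "'a::euclidean_space \<Rightarrow> 'a"
  assumes cont: "continuous_on UNIV f" and c: "0 < c"
    and exp: "\<And>x y. c * norm (x - y) \<le> norm (f x - f y)"
  shows "range f = UNIV"
proof -
  have inj: "inj f"
  proof (rule injI)
    fix x y assume "f x = f y"
    then have "c * norm (x - y) \<le> 0" using exp[of x y] by simp
    then show "x = y" using c by (simp add: mult_le_0_iff)
  qed
  have "open (range f)" by (rule invariance_of_domain[OF cont open_UNIV inj])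
  moreover have "closed (range f)"
    unfolding closed_sequential_limits
  proof (intro allI impI, elim conjE)
    fix s l assume s: "\<forall>n. s n \<in> range f" and lim: "s \<longlonglongrightarrow> l"
    then have "\<forall>n. \<exists>x. s n = f x" by blast
    from choice[OF this] obtain x where x: "\<forall>n. s n = f (x n)" by blast
    have "Cauchy x"
    proof (rule metric_CauchyI)
      fix e :: real assume e: "0 < e"
      have "Cauchy s" using lim by (rule LIMSEQ_imp_Cauchy)
      then obtain N where N: "\<And>m n. m \<ge> N \<Longrightarrow> n \<ge> N \<Longrightarrow> dist (s m) (s n) < c * e"
        using metric_CauchyD[of s "c * e"] c e by auto
      have "dist (x m) (x n) < e" if "m \<ge> N" "n \<ge> N" for m n
      proof -
        have "c * dist (x m) (x n) < c * e"
          using N[OF that] exp[of "x m" "x n"] by (simp add: dist_norm x)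
        then show ?thesis using c by simp
      qed
      then show "\<exists>N. \<forall>m\<ge>N. \<forall>n\<ge>N. dist (x m) (x n) < e" by blast
    qed
    then obtain y where "x \<longlonglongrightarrow> y" using Cauchy_convergent convergent_def by blast
    then have "(\<lambda>n. f (x n)) \<longlonglongrightarrow> f y"
      by (intro continuous_on_tendsto_compose[OF cont]) auto
    then have "s \<longlonglongrightarrow> f y" using x by (simp flip: fun_eq_iff)
    then show "l \<in> range f" using lim LIMSEQ_unique by blast
  qed
  ultimately show ?thesis using clopen[of "range f"] by auto
qed

lemma vector_Lipschitz_of_derivative_bound:
  fixes W :: "real \<Rightarrow> 'a::real_normed_vector"
  assumes dW: "\<And>t. (W has_vector_derivative W' t) (at t)"
    and bd: "\<And>t. t \<in> {a..b} \<Longrightarrow> norm (W' t) \<le> C" and st: "s \<in> {a..b}" "t \<in> {a..b}"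
  shows "norm (W s - W t) \<le> C * \<bar>s - t\<bar>"
proof -
  have lt: "norm (W t - W s) \<le> C * (t - s)" if "s < t" "s \<in> {a..b}" "t \<in> {a..b}" for s t
  proof -
    have "norm (W t - W s) \<le> C * t - C * s"
    proof (rule differentiable_bound_general[OF that(1)])
      show "continuous_on {s..t} W"
        using dW by (meson continuous_at_imp_continuous_on has_vector_derivative_continuous)
      show "norm (W' x) \<le> C" if "s < x" "x < t" for x
        using bd that \<open>s \<in> {a..b}\<close> \<open>t \<in> {a..b}\<close> by simp
      show "((\<lambda>x. C * x) has_vector_derivative C) (at x)" for x
        unfolding has_real_derivative_iff_has_vector_derivative[symmetric]
        by (auto intro!: derivative_eq_intros)
    qed (use dW in \<open>auto intro!: continuous_intros\<close>)
    then show ?thesis by (simp add: algebra_simps)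
  qed
  consider "s = t" | "s < t" | "t < s" by linarith
  then show ?thesis
  proof cases
    case 2
    then show ?thesis using lt[OF 2 st] by (simp add: norm_minus_commute)
  next
    case 3
    then show ?thesis using lt[OF 3 st(2) st(1)] by simp
  qed simp
qed

section \<open>Periodic solutions of Lipschitz systems\<close>

text \<open>Isolates what the existence argument uses of the gradient. The Hessian bounds survive
  only in \<open>increment\<close>, and the conditions involving \<open>beta_per\<close> only in
  \<open>rigid\<close>.\<close>

locale periodic_system =
  fixes g :: "real \<Rightarrow> real^'n \<Rightarrow> real^'n" and A B :: "real \<Rightarrow> real^'n^'n" and T M :: real
  assumes T: "0 < T" and M: "0 \<le> M"
    and lip: "norm (g t x - g t y) \<le> M * norm (x - y)"
    and cont: "continuous_on UNIV (\<lambda>t. g t x)"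
    and per: "g (t + T) = g t"
    and A_cont: "continuous_on UNIV A" and B_cont: "continuous_on UNIV B"
    and increment: "(g t x - g t y) \<bullet> (x - y) + 2 * ((g t x - g t y) \<bullet> k)
      \<le> (x - y + k) \<bullet> (B t *v (x - y + k)) - (A t *v k) \<bullet> k"
    and rigid: "C1_on 0 T w v \<Longrightarrow> w 0 = w T \<Longrightarrow>
      (\<And>k. integral {0..T} (\<lambda>t. v t \<bullet> v t)
        \<le> integral {0..T} (\<lambda>t. (w t + k) \<bullet> (B t *v (w t + k))) - integral {0..T} (\<lambda>t. (A t *v k) \<bullet> k)) \<Longrightarrow>
      t \<in> {0..T} \<Longrightarrow> w t = 0 \<and> v t = 0"
begin

definition F :: "real \<Rightarrow> (real^'n) \<times> (real^'n) \<Rightarrow> (real^'n) \<times> (real^'n)" where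
  "F t z = (snd z, - g t (fst z))"

definition solves :: "(real \<Rightarrow> (real^'n) \<times> (real^'n)) \<Rightarrow> bool" where
  "solves z \<longleftrightarrow> (\<forall>t. (z has_vector_derivative F t (z t)) (at t))"

definition L :: real where "L = 1 + M"

lemma L_pos: "0 < L" using M by (simp add: L_def)

lemma F_Lipschitz: "norm (F t x - F t y) \<le> L * norm (x - y)"
proof -
  have nfst: "norm (fst z) \<le> norm z" and nsnd: "norm (snd z) \<le> norm z" for z :: "(real^'n) \<times> (real^'n)"
    by (metis norm_fst_le norm_snd_le prod.collapse)+
  have "norm (F t x - F t y) \<le> norm (snd x - snd y) + norm (g t (fst y) - g t (fst x))"
    using norm_Pair_le[of "snd x - snd y" "g t (fst y) - g t (fst x)"] by (simp add: F_def)
  also have "\<dots> \<le> norm (x - y) + M * norm (x - y)"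
  proof (rule add_mono)
    show "norm (snd x - snd y) \<le> norm (x - y)" using nsnd[of "x - y"] by simp
    have "norm (g t (fst y) - g t (fst x)) \<le> M * norm (fst (y - x))" using lip by simp
    also have "\<dots> \<le> M * norm (x - y)"
      using M nfst[of "y - x"] by (intro mult_left_mono) (simp_all add: norm_minus_commute)
    finally show "norm (g t (fst y) - g t (fst x)) \<le> M * norm (x - y)" .
  qed
  finally show ?thesis by (simp add: L_def algebra_simps)
qed

lemma g_compose_continuous:
  assumes "continuous_on UNIV z"
  shows "continuous_on UNIV (\<lambda>t. g t (z t))"
  using lip cont assms by (rule continuous_on_compose_uniform_Lipschitz)

lemma solution_exists: "\<exists>z. z 0 = x \<and> solves z"
proof -
  obtain C where C: "\<And>t. norm (g t 0) \<le> C"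
    using periodic_continuous_bounded[OF T cont[of 0]] per by metis
  show ?thesis
    unfolding solves_def
  proof (rule global_Lipschitz_ode_solution[OF L_pos F_Lipschitz])
    show "norm (F t 0) \<le> C" for t using C[of t] by (simp add: F_def norm_Pair)
    show "continuous_on UNIV (\<lambda>t. F t (z t))" if "continuous_on UNIV z" for z
      unfolding F_def by (intro continuous_intros g_compose_continuous that)
  qed
qed

lemma solves_dist:
  assumes "solves y" "solves z"
  shows "norm (y t - z t) \<le> exp (L * \<bar>t\<bar>) * norm (y 0 - z 0)"
proof (rule Gronwall_growth)
  show "((\<lambda>t. y t - z t) has_vector_derivative F t (y t) - F t (z t)) (at t)" for t
    using assms by (auto simp: solves_def intro!: derivative_intros)
qed (rule F_Lipschitz)

lemma solves_unique:
  assumes "solves y" "solves z" "y 0 = z 0"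
  shows "y = z"
  using solves_dist[OF assms(1,2)] assms(3) by (auto simp: fun_eq_iff)

definition flow :: "(real^'n) \<times> (real^'n) \<Rightarrow> real \<Rightarrow> (real^'n) \<times> (real^'n)" where
  "flow x = (SOME z. z 0 = x \<and> solves z)"

lemma flow: "flow x 0 = x" "solves (flow x)"
  using someI_ex[OF solution_exists[of x]] by (auto simp: flow_def)

definition \<Phi> :: "(real^'n) \<times> (real^'n) \<Rightarrow> (real^'n) \<times> (real^'n)" where
  "\<Phi> x = flow x T - x"

lemma solves_components:
  assumes "solves z"
  shows "((\<lambda>t. fst (z t)) has_vector_derivative snd (z t)) (at t)"
    "((\<lambda>t. snd (z t)) has_vector_derivative - g t (fst (z t))) (at t)"
proof -
  have "(z has_vector_derivative F t (z t)) (at t)" using assms by (simp add: solves_def)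
  from bounded_linear.has_vector_derivative[OF bounded_linear_fst this]
    bounded_linear.has_vector_derivative[OF bounded_linear_snd this]
  show "((\<lambda>t. fst (z t)) has_vector_derivative snd (z t)) (at t)"
    "((\<lambda>t. snd (z t)) has_vector_derivative - g t (fst (z t))) (at t)"
    by (simp_all add: F_def)
qed

lemma solves_continuous:
  assumes "solves z"
  shows "continuous_on S z"
  using assms unfolding solves_def
  by (meson continuous_at_imp_continuous_on has_vector_derivative_continuous)

lemma \<Phi>_continuous: "continuous_on UNIV \<Phi>"
proof -
  have "norm (\<Phi> x - \<Phi> y) \<le> (exp (L * T) + 1) * norm (x - y)" for x y
  proof -
    have "norm (\<Phi> x - \<Phi> y) \<le> norm (flow x T - flow y T) + norm (x - y)"
      unfolding \<Phi>_def by norm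
    also have "norm (flow x T - flow y T) \<le> exp (L * T) * norm (x - y)"
      using solves_dist[OF flow(2)[of x] flow(2)[of y], of T] T by (simp add: flow(1))
    finally show ?thesis by (simp add: algebra_simps)
  qed
  then have "(exp (L * T) + 1)-lipschitz_on UNIV \<Phi>"
    by (intro lipschitz_onI) (auto simp: dist_norm add_nonneg_nonneg)
  then show ?thesis by (rule lipschitz_on_continuous_on)
qed

text \<open>The integrand for which the hypothesis of \<open>rigid\<close> reads "nonpositive
  integral for every \<open>k\<close>". It is jointly continuous in \<open>t\<close> and
  \<open>z\<close>, hence passes to uniform limits.\<close>

definition energy :: "real^'n \<Rightarrow> real \<Rightarrow> (real^'n) \<times> (real^'n) \<Rightarrow> real" where
  "energy k t z = snd z \<bullet> snd z - (fst z + k) \<bullet> (B t *v (fst z + k)) + (A t *v k) \<bullet> k"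

lemma energy_continuous: "continuous_on UNIV (\<lambda>(t, z). energy k t z)"
proof -
  have "continuous_on UNIV (\<lambda>p :: real \<times> _. A (fst p))" "continuous_on UNIV (\<lambda>p :: real \<times> _. B (fst p))"
    by (rule continuous_on_compose2[OF A_cont] continuous_on_compose2[OF B_cont]; simp add: continuous_on_fst)+
  then show ?thesis
    unfolding energy_def case_prod_beta inner_vec_def matrix_vector_mult_def
    by (simp, intro continuous_intros)
qed

text \<open>With \<open>v\<close> and \<open>w\<close> the components of \<open>W\<close>, the
  function \<open><v, w + 2 k>\<close> has derivative
  \<open>\<bar>v\<bar>\<^sup>2 - <D, w + 2 k>\<close>, which \<open>increment\<close> bounds below
  by the energy. That bound is homogeneous of degree two, so it is applied with \<open>d k\<close>
  in place of \<open>k\<close> and divided by \<open>d\<^sup>2\<close>. The boundary terms are kept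
  because \<open>W\<close> need not be periodic.\<close>

lemma scaled_difference_energy:
  assumes y: "solves y" and z: "solves z" and d: "0 < d"
    and W: "\<And>t. W t = (1 / d) *\<^sub>R (y t - z t)"
  shows "integral {0..T} (\<lambda>t. energy k t (W t))
    \<le> (snd (W T) \<bullet> fst (W T) + 2 * (snd (W T) \<bullet> k)) - (snd (W 0) \<bullet> fst (W 0) + 2 * (snd (W 0) \<bullet> k))"
proof -
  define h where "h t = snd (W t) \<bullet> fst (W t) + 2 * (snd (W t) \<bullet> k)" for t
  define D where "D t = (1 / d) *\<^sub>R (g t (fst (y t)) - g t (fst (z t)))" for t
  define h' where "h' t = snd (W t) \<bullet> snd (W t) - (D t \<bullet> fst (W t) + 2 * (D t \<bullet> k))" for t
  have W_eq: "W = (\<lambda>t. (1 / d) *\<^sub>R (y t - z t))" using W by auto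
  have dw: "((\<lambda>t. fst (W t)) has_vector_derivative snd (W t)) (at t)" for t
    unfolding W_eq by (auto intro!: derivative_eq_intros solves_components[OF y] solves_components[OF z])
  have dv: "((\<lambda>t. snd (W t)) has_vector_derivative - D t) (at t)" for t
    unfolding W_eq D_def
    by (auto intro!: derivative_eq_intros solves_components[OF y] solves_components[OF z] simp: algebra_simps)
  have cW: "continuous_on S W" for S
    unfolding W_eq by (intro continuous_intros solves_continuous y z)
  have dh: "(h has_vector_derivative h' t) (at t)" for t
  proof -
    have "((\<lambda>t. snd (W t) \<bullet> fst (W t)) has_vector_derivative snd (W t) \<bullet> snd (W t) + (- D t) \<bullet> fst (W t)) (at t)"
      by (rule bounded_bilinear.has_vector_derivative[OF bounded_bilinear_inner dv dw])
    moreover have "((\<lambda>t. snd (W t) \<bullet> k) has_vector_derivative (- D t) \<bullet> k) (at t)"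
      by (rule bounded_linear.has_vector_derivative[OF bounded_linear_inner_left dv])
    ultimately show ?thesis
      unfolding h_def[abs_def] h'_def has_real_derivative_iff_has_vector_derivative[symmetric]
      by (auto intro!: derivative_eq_intros)
  qed
  have energy_le: "energy k t (W t) \<le> h' t" for t
  proof -
    have fW: "fst (W t) = (1 / d) *\<^sub>R (fst (y t) - fst (z t))" by (simp add: W)
    have scale: "(1 / d) *\<^sub>R (fst (y t) - fst (z t)) + k = (1 / d) *\<^sub>R (fst (y t) - fst (z t) + d *\<^sub>R k)"
      using d by (simp add: scaleR_right_distrib)
    let ?x = "fst (y t)" and ?y = "fst (z t)"
    have "(1 / d)\<^sup>2 * ((g t ?x - g t ?y) \<bullet> (?x - ?y) + 2 * ((g t ?x - g t ?y) \<bullet> (d *\<^sub>R k)))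
        \<le> (1 / d)\<^sup>2 * ((?x - ?y + d *\<^sub>R k) \<bullet> (B t *v (?x - ?y + d *\<^sub>R k)) - (A t *v (d *\<^sub>R k)) \<bullet> (d *\<^sub>R k))"
      by (intro mult_left_mono increment) simp
    also have "\<dots> = (fst (W t) + k) \<bullet> (B t *v (fst (W t) + k)) - (A t *v k) \<bullet> k"
      unfolding fW scale using d
      by (simp add: matrix_vector_mult_scaleR right_diff_distrib power2_eq_square)
    also have "(1 / d)\<^sup>2 * ((g t ?x - g t ?y) \<bullet> (?x - ?y) + 2 * ((g t ?x - g t ?y) \<bullet> (d *\<^sub>R k)))
        = D t \<bullet> fst (W t) + 2 * (D t \<bullet> k)"
      unfolding fW D_def using d by (simp add: power2_eq_square distrib_left)
    finally show ?thesis by (simp add: energy_def h'_def)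
  qed
  have "(h' has_integral (h T - h 0)) {0..T}"
    using T dh by (intro fundamental_theorem_of_calculus) (auto intro: has_vector_derivative_at_within)
  moreover have "((\<lambda>t. energy k t (W t)) has_integral integral {0..T} (\<lambda>t. energy k t (W t))) {0..T}"
  proof -
    have "continuous_on {0..T} (\<lambda>t. (\<lambda>(t, z). energy k t z) (t, W t))"
      by (rule continuous_on_compose2[OF energy_continuous]) (auto intro!: continuous_intros cW)
    then show ?thesis using integrable_continuous_real by (auto intro!: integrable_integral)
  qed
  ultimately have "integral {0..T} (\<lambda>t. energy k t (W t)) \<le> h T - h 0"
    using energy_le by (meson has_integral_le)
  then show ?thesis by (simp add: h_def)
qed

text \<open>If no constant worked, differences of trajectories normalised at time 0 would have
  period defects tending to 0. The Lipschitz bounds make them equicontinuous, and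
  \<open>rigid\<close> annihilates a limit of norm 1 at time 0.\<close>

lemma \<Phi>_expansive: "\<exists>c>0. \<forall>x y. c * norm (x - y) \<le> norm (\<Phi> x - \<Phi> y)"
proof (rule ccontr)
  assume contr: "\<not> ?thesis"
  have "\<exists>x y. norm (\<Phi> x - \<Phi> y) < 1 / real (Suc n) * norm (x - y)" for n
  proof -
    have "0 < 1 / real (Suc n)" by simp
    then show ?thesis using contr by (meson not_le)
  qed
  then obtain x y where xy: "\<And>n. norm (\<Phi> (x n) - \<Phi> (y n)) < 1 / real (Suc n) * norm (x n - y n)"
    by metis
  define d where "d n = norm (x n - y n)" for n
  define W where "W n t = (1 / d n) *\<^sub>R (flow (x n) t - flow (y n) t)" for n t
  have d: "0 < d n" for n
  proof -
    have "x n \<noteq> y n"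
    proof
      assume "x n = y n"
      then show False using xy[of n] by simp
    qed
    then show ?thesis by (simp add: d_def)
  qed
  have W0: "norm (W n 0) = 1" for n
    using d[of n] by (simp add: W_def flow(1) d_def)
  have WT: "norm (W n T - W n 0) < 1 / real (Suc n)" for n
  proof -
    have "W n T - W n 0 = (1 / d n) *\<^sub>R (\<Phi> (x n) - \<Phi> (y n))"
      by (simp add: W_def \<Phi>_def flow(1) algebra_simps)
    then have "norm (W n T - W n 0) = norm (\<Phi> (x n) - \<Phi> (y n)) / d n" using d[of n] by simp
    also have "\<dots> < 1 / real (Suc n)"
      using xy[of n] d[of n] unfolding d_def[symmetric] by (simp only: pos_divide_less_eq)
    finally show ?thesis .
  qed
  define C where "C = exp (L * T)"
  have W_bound: "norm (W n t) \<le> C" if t: "t \<in> {0..T}" for n t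
  proof -
    have "norm (flow (x n) t - flow (y n) t) \<le> exp (L * \<bar>t\<bar>) * d n"
      using solves_dist[OF flow(2)[of "x n"] flow(2)[of "y n"], of t] by (simp add: flow(1) d_def)
    also have "\<dots> \<le> C * d n"
      using t d[of n] L_pos unfolding C_def by (intro mult_right_mono) auto
    finally show ?thesis using d[of n] by (simp add: W_def pos_divide_le_eq)
  qed
  have dW: "(W n has_vector_derivative (1 / d n) *\<^sub>R (F t (flow (x n) t) - F t (flow (y n) t))) (at t)" for n t
    unfolding W_def using flow(2)[of "x n"] flow(2)[of "y n"] unfolding solves_def
    by (auto intro!: derivative_eq_intros)
  have dW_bound: "norm ((1 / d n) *\<^sub>R (F t (flow (x n) t) - F t (flow (y n) t))) \<le> L * C"
    if t: "t \<in> {0..T}" for n t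
  proof -
    have "norm ((1 / d n) *\<^sub>R (F t (flow (x n) t) - F t (flow (y n) t)))
        = (1 / d n) * norm (F t (flow (x n) t) - F t (flow (y n) t))" using d[of n] by simp
    also have "\<dots> \<le> (1 / d n) * (L * norm (flow (x n) t - flow (y n) t))"
      using d[of n] by (intro mult_left_mono F_Lipschitz) simp
    also have "\<dots> = L * norm (W n t)" using d[of n] by (simp add: W_def)
    also have "\<dots> \<le> L * C" using W_bound[OF t] L_pos by (intro mult_left_mono) auto
    finally show ?thesis .
  qed
  have W_Lipschitz: "norm (W n s - W n t) \<le> L * C * \<bar>s - t\<bar>" if "s \<in> {0..T}" "t \<in> {0..T}" for n s t
    using vector_Lipschitz_of_derivative_bound[OF dW dW_bound that] by blast
  have LC: "0 < L * C" using L_pos by (simp add: C_def)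
  obtain w k where w: "continuous_on {0..T} w" and k: "strict_mono (k :: nat \<Rightarrow> nat)"
    and conv: "\<And>e. 0 < e \<Longrightarrow> \<exists>N. \<forall>n t. n \<ge> N \<and> t \<in> {0..T} \<longrightarrow> norm (W (k n) t - w t) < e"
  proof (rule Arzela_Ascoli[of "{0..T}" W C])
    show "norm (W n t) \<le> C" if "t \<in> {0..T}" for n t using W_bound[OF that] .
    fix t e :: real assume t: "t \<in> {0..T}" and e: "0 < e"
    have "norm (W n t - W n s) < e" if "s \<in> {0..T}" "norm (t - s) < e / (L * C)" for n s
    proof -
      have "L * C * \<bar>t - s\<bar> < e" using that(2) LC by (simp add: pos_less_divide_eq mult.commute)
      then show ?thesis using W_Lipschitz[OF t that(1), of n] by linarith
    qed
    moreover have "0 < e / (L * C)" using e LC by simp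
    ultimately show "\<exists>d>0. \<forall>n s. s \<in> {0..T} \<and> norm (t - s) < d \<longrightarrow> norm (W n t - W n s) < e" by blast
  qed auto
  have ul: "uniform_limit {0..T} (\<lambda>n. W (k n)) w sequentially"
    unfolding uniform_limit_sequentially_iff dist_norm using conv by blast
  have pt: "(\<lambda>n. W (k n) t) \<longlonglongrightarrow> w t" if "t \<in> {0..T}" for t
    by (rule tendsto_uniform_limitI[OF ul that])
  have pt0: "(\<lambda>n. W (k n) 0) \<longlonglongrightarrow> w 0" and ptT: "(\<lambda>n. W (k n) T) \<longlonglongrightarrow> w T"
    using T by (auto intro: pt)
  have cW: "continuous_on S (W n)" for S n
    using dW by (meson continuous_at_imp_continuous_on has_vector_derivative_continuous)
  have w_per: "w 0 = w T"
  proof -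
    have "(\<lambda>n. 1 / real (Suc n)) \<longlonglongrightarrow> 0"
      using LIMSEQ_inverse_real_of_nat by (simp add: inverse_eq_divide)
    then have "(\<lambda>n. W n T - W n 0) \<longlonglongrightarrow> 0"
      by (rule Lim_null_comparison[rotated]) (intro always_eventually allI less_imp_le WT)
    then have "(\<lambda>n. W (k n) T - W (k n) 0) \<longlonglongrightarrow> 0"
      using LIMSEQ_subseq_LIMSEQ[OF _ k] by (fastforce simp: o_def)
    moreover have "(\<lambda>n. W (k n) T - W (k n) 0) \<longlonglongrightarrow> w T - w 0" by (intro tendsto_diff pt0 ptT)
    ultimately have "w T - w 0 = 0" using LIMSEQ_unique by blast
    then show ?thesis by simp
  qed
  have "(\<lambda>n. norm (W (k n) 0)) \<longlonglongrightarrow> norm (w 0)" by (intro tendsto_norm pt0)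
  then have norm_w0: "norm (w 0) = 1" by (simp add: W0 LIMSEQ_const_iff)
  \<comment> \<open>The relation between position and velocity passes to the limit in integrated
    form, since the convergence of the derivatives of \<open>W\<close> is not known.\<close>
  have fst_w: "fst (w t) = fst (w 0) + integral {0..t} (\<lambda>s. snd (w s))" if t: "t \<in> {0..T}" for t
  proof -
    have sub: "{0..t} \<subseteq> {0..T}" using t by auto
    have "uniform_limit {0..t} (\<lambda>n s. snd (W (k n) s)) (\<lambda>s. snd (w s)) sequentially"
      by (rule bounded_linear.uniform_limit[OF bounded_linear_snd uniform_limit_on_subset[OF ul sub]])
    then have "(\<lambda>n. integral {0..t} (\<lambda>s. snd (W (k n) s))) \<longlonglongrightarrow> integral {0..t} (\<lambda>s. snd (w s))"
      by (rule uniform_limit_integral_tendsto) (intro continuous_intros cW)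
    moreover have "integral {0..t} (\<lambda>s. snd (W n s)) = fst (W n t) - fst (W n 0)" for n
    proof (rule integral_unique, rule fundamental_theorem_of_calculus)
      show "((\<lambda>s. fst (W n s)) has_vector_derivative snd (W n s)) (at s within {0..t})" for s
      proof -
        have "fst ((1 / d n) *\<^sub>R (F s (flow (x n) s) - F s (flow (y n) s))) = snd (W n s)"
          by (simp add: F_def W_def)
        then show ?thesis
          using bounded_linear.has_vector_derivative[OF bounded_linear_fst dW[of n s]]
          by (simp only: has_vector_derivative_at_within)
      qed
    qed (use t in auto)
    ultimately have "(\<lambda>n. fst (W (k n) t) - fst (W (k n) 0)) \<longlonglongrightarrow> integral {0..t} (\<lambda>s. snd (w s))" by simp
    moreover have "(\<lambda>n. fst (W (k n) t) - fst (W (k n) 0)) \<longlonglongrightarrow> fst (w t) - fst (w 0)"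
      by (intro tendsto_intros pt0 pt t)
    ultimately have "integral {0..t} (\<lambda>s. snd (w s)) = fst (w t) - fst (w 0)" using LIMSEQ_unique by blast
    then show ?thesis by simp
  qed
  have C1: "C1_on 0 T (\<lambda>t. fst (w t)) (\<lambda>t. snd (w t))"
  proof -
    have *: "C1_on 0 T (\<lambda>t. integral {0..t} (\<lambda>s. snd (w s)) + fst (w 0)) (\<lambda>t. snd (w t))"
      by (intro C1_on_add_const C1_on_primitive continuous_intros w)
    show ?thesis
      unfolding C1_on_def
    proof (intro conjI ballI)
      show "continuous_on {0..T} (\<lambda>t. snd (w t))" by (intro continuous_intros w)
      fix t assume t: "t \<in> {0..T}"
      show "((\<lambda>t. fst (w t)) has_vector_derivative snd (w t)) (at t within {0..T})"
      proof (rule has_vector_derivative_transform[OF t])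
        show "fst (w t) = integral {0..t} (\<lambda>s. snd (w s)) + fst (w 0)" if "t \<in> {0..T}" for t
          using fst_w[OF that] by (simp add: add.commute)
        show "((\<lambda>t. integral {0..t} (\<lambda>s. snd (w s)) + fst (w 0)) has_vector_derivative snd (w t)) (at t within {0..T})"
          using * t by (simp add: C1_on_def)
      qed
    qed
  qed
  have ineq: "integral {0..T} (\<lambda>t. snd (w t) \<bullet> snd (w t))
      \<le> integral {0..T} (\<lambda>t. (fst (w t) + c) \<bullet> (B t *v (fst (w t) + c))) - integral {0..T} (\<lambda>t. (A t *v c) \<bullet> c)" for c
  proof -
    have cBw: "continuous_on {0..T} (\<lambda>t. (fst (w t) + c) \<bullet> (B t *v (fst (w t) + c)))"
      and cA: "continuous_on {0..T} (\<lambda>t. (A t *v c) \<bullet> c)"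
      unfolding inner_vec_def matrix_vector_mult_def
      by (simp, intro continuous_intros w continuous_on_subset[OF B_cont subset_UNIV]
          continuous_on_subset[OF A_cont subset_UNIV])+
    have "uniform_limit {0..T} (\<lambda>n t. energy c t (W (k n) t)) (\<lambda>t. energy c t (w t)) sequentially"
      by (rule uniform_limit_compose_continuous[OF energy_continuous ul w])
    then have lim: "(\<lambda>n. integral {0..T} (\<lambda>t. energy c t (W (k n) t))) \<longlonglongrightarrow> integral {0..T} (\<lambda>t. energy c t (w t))"
    proof (rule uniform_limit_integral_tendsto)
      fix n
      have "continuous_on {0..T} (\<lambda>t. (\<lambda>(t, z). energy c t z) (t, W (k n) t))"
        by (rule continuous_on_compose2[OF energy_continuous]) (auto intro!: continuous_intros cW)
      then show "continuous_on {0..T} (\<lambda>t. energy c t (W (k n) t))" by simp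
    qed
    have lim2: "(\<lambda>n. (snd (W (k n) T) \<bullet> fst (W (k n) T) + 2 * (snd (W (k n) T) \<bullet> c))
          - (snd (W (k n) 0) \<bullet> fst (W (k n) 0) + 2 * (snd (W (k n) 0) \<bullet> c)))
        \<longlonglongrightarrow> (snd (w T) \<bullet> fst (w T) + 2 * (snd (w T) \<bullet> c)) - (snd (w 0) \<bullet> fst (w 0) + 2 * (snd (w 0) \<bullet> c))"
      by (intro tendsto_intros pt0 ptT)
    have "integral {0..T} (\<lambda>t. energy c t (w t))
        \<le> (snd (w T) \<bullet> fst (w T) + 2 * (snd (w T) \<bullet> c)) - (snd (w 0) \<bullet> fst (w 0) + 2 * (snd (w 0) \<bullet> c))"
      by (rule LIMSEQ_le[OF lim lim2], intro exI allI impI)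
         (rule scaled_difference_energy[OF flow(2) flow(2) d W_def])
    \<comment> \<open>The boundary terms cancel only here, because the limit satisfies
      \<open>w 0 = w T\<close> exactly.\<close>
    then have "integral {0..T} (\<lambda>t. energy c t (w t)) \<le> 0" using w_per by simp
    also have "integral {0..T} (\<lambda>t. energy c t (w t)) = integral {0..T} (\<lambda>t. snd (w t) \<bullet> snd (w t))
        - integral {0..T} (\<lambda>t. (fst (w t) + c) \<bullet> (B t *v (fst (w t) + c))) + integral {0..T} (\<lambda>t. (A t *v c) \<bullet> c)"
      unfolding energy_def
      by (subst integral_add integral_diff; (intro integrable_continuous_real continuous_intros w cBw cA)?)+ simp
    finally show ?thesis by simp
  qed
  have "fst (w 0) = 0 \<and> snd (w 0) = 0"
    by (rule rigid[OF C1 _ ineq]) (use w_per T in auto)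
  then have "w 0 = 0" by (simp add: prod_eq_iff)
  then show False using norm_w0 by simp
qed

text \<open>Expansiveness of \<open>\<Phi>\<close> gives both halves: surjectivity yields a zero,
  injectivity a single one. Trajectories are determined by their initial values.\<close>

theorem periodic_solution_unique_exists:
  "\<exists>!z. solves z \<and> z 0 = z T"
proof -
  obtain c where c: "0 < c" "\<And>x y. c * norm (x - y) \<le> norm (\<Phi> x - \<Phi> y)" using \<Phi>_expansive by blast
  have "0 \<in> range \<Phi>" using range_UNIV_of_expansive[OF \<Phi>_continuous c] by simp
  then obtain x where x: "\<Phi> x = 0" by auto
  show ?thesis
  proof (rule ex1I[of _ "flow x"])
    show "solves (flow x) \<and> flow x 0 = flow x T"
      using x flow[of x] by (simp add: \<Phi>_def)
    fix z assume z: "solves z \<and> z 0 = z T"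
    have zf: "z = flow (z 0)" using z flow[of "z 0"] by (intro solves_unique) auto
    have "\<Phi> (z 0) = 0" unfolding \<Phi>_def using z by (subst zf[symmetric]) simp
    then have "c * norm (z 0 - x) \<le> 0" using c(2)[of "z 0" x] x by simp
    then have "z 0 = x" using c(1) by (simp add: mult_le_0_iff)
    then show "z = flow x" using zf by simp
  qed
qed

text \<open>The translate by \<open>T\<close> solves the same system, as \<open>g\<close> is
  periodic, and has the same initial value.\<close>

lemma solves_periodic:
  assumes z: "solves z" and "z 0 = z T"
  shows "z (t + T) = z t"
proof -
  have "solves (\<lambda>t. z (t + T))"
    unfolding solves_def
  proof
    fix t
    have "((\<lambda>t. t + T) has_vector_derivative 1) (at t)" by (auto intro!: derivative_eq_intros)
    moreover have "(z has_vector_derivative F (t + T) (z (t + T))) (at (t + T))"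
      using z by (simp add: solves_def)
    ultimately have "(z \<circ> (\<lambda>t. t + T) has_vector_derivative 1 *\<^sub>R F (t + T) (z (t + T))) (at t)"
      by (rule vector_diff_chain_at)
    then show "((\<lambda>t. z (t + T)) has_vector_derivative F t (z (t + T))) (at t)"
      by (simp add: o_def F_def per)
  qed
  then have "(\<lambda>t. z (t + T)) = z" using z assms(2) by (intro solves_unique) auto
  then show ?thesis by (rule fun_cong)
qed

end

section \<open>Return to the second-order equation\<close>

lemma has_vector_derivative_of_has_integral:
  fixes v g :: "real \<Rightarrow> 'a::banach"
  assumes g: "continuous_on UNIV g"
    and int: "\<And>a b. a \<le> b \<Longrightarrow> (g has_integral (v b - v a)) {a..b}"
  shows "(v has_vector_derivative g t) (at t)"
proof -
  define a b where "a = t - 1" and "b = t + 1"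
  have t: "a < t" "t < b" by (auto simp: a_def b_def)
  have gab: "continuous_on {a..b} g" using g by (rule continuous_on_subset) simp
  have "((\<lambda>s. integral {a..s} g) has_vector_derivative g t) (at t within {a..b})"
    by (rule integral_has_vector_derivative[OF gab]) (use t in auto)
  then have "((\<lambda>s. integral {a..s} g) has_vector_derivative g t) (at t)"
    using t by (simp add: at_within_Icc_at)
  then have "((\<lambda>s. integral {a..s} g + v a) has_vector_derivative g t) (at t)"
    by (auto intro!: derivative_eq_intros)
  then show ?thesis
  proof (rule has_vector_derivative_transform_within_open)
    show "integral {a..s} g + v a = v s" if "s \<in> {a<..<b}" for s
      using integral_unique[OF int[of a s]] that by simp
  qed (use t in auto)
qed

lemma partial_grad_periodic:
  assumes "\<forall>t u. G (t + T) u = G t u"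
  shows "partial_grad G (t + T) = partial_grad G t"
proof -
  have "G (t + T) = G t" using assms by auto
  then show ?thesis by (intro ext) (simp add: partial_grad_def)
qed

text \<open>Along a continuous \<open>u\<close> the gradient is continuous in \<open>t\<close>, so
  the integrated equation can be differentiated everywhere and weak solutions are classical. In the
  other direction, periodicity on all of \<open>\<real>\<close> follows from the boundary conditions
  by uniqueness.\<close>

lemma is_periodic_solution_iff:
  assumes "periodic_system (partial_grad G) A B T M"
  shows "is_periodic_solution G T u \<longleftrightarrow>
    (\<exists>z. periodic_system.solves (partial_grad G) z \<and> z 0 = z T \<and> u = (\<lambda>t. fst (z t)))"
proof -
  interpret periodic_system "partial_grad G" A B T M by (rule assms)
  show ?thesis
  proof
    assume "is_periodic_solution G T u"
    then obtain u' where du: "\<And>t. (u has_vector_derivative u' t) (at t)"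
      and int: "\<And>a b. a \<le> b \<Longrightarrow> ((\<lambda>s. - partial_grad G s (u s)) has_integral (u' b - u' a)) {a..b}"
      and bc: "u 0 - u T = 0" "u' 0 - u' T = 0"
      unfolding is_periodic_solution_def by blast
    have cu: "continuous_on UNIV u"
      using du by (meson continuous_at_imp_continuous_on has_vector_derivative_continuous)
    have "continuous_on UNIV (\<lambda>s. - partial_grad G s (u s))"
      by (intro continuous_on_minus g_compose_continuous cu)
    then have dv: "(u' has_vector_derivative - partial_grad G t (u t)) (at t)" for t
      by (rule has_vector_derivative_of_has_integral[OF _ int])
    have "solves (\<lambda>t. (u t, u' t))"
      unfolding solves_def F_def using du dv by (auto intro!: has_vector_derivative_Pair)
    then show "\<exists>z. solves z \<and> z 0 = z T \<and> u = (\<lambda>t. fst (z t))"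
      using bc by (intro exI[of _ "\<lambda>t. (u t, u' t)"]) simp
  next
    assume "\<exists>z. solves z \<and> z 0 = z T \<and> u = (\<lambda>t. fst (z t))"
    then obtain z where z: "solves z" "z 0 = z T" and u: "u = (\<lambda>t. fst (z t))" by blast
    show "is_periodic_solution G T u"
      unfolding is_periodic_solution_def u
    proof (intro conjI exI[of _ "\<lambda>t. snd (z t)"] allI impI)
      show "fst (z (t + T)) = fst (z t)" for t using solves_periodic[OF z] by simp
      show "((\<lambda>t. fst (z t)) has_vector_derivative snd (z t)) (at t)" for t
        by (rule solves_components[OF z(1)])
      show "((\<lambda>s. - partial_grad G s (fst (z s))) has_integral (snd (z b) - snd (z a))) {a..b}"
        if "a \<le> b" for a b
        by (rule fundamental_theorem_of_calculus[OF that])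
           (rule has_vector_derivative_at_within, rule solves_components[OF z(1)])
    qed (use z(2) in simp_all)
  qed
qed

theorem theorem3p1:
  fixes G :: "real \<Rightarrow> real^'n \<Rightarrow> real"
    and T :: real
    and A B :: "real \<Rightarrow> real^'n^'n"
    and p :: "'n \<Rightarrow> ereal"
  assumes T_pos: "0 < T"
    and G_cont: "continuous_on UNIV (\<lambda>(t, u). G t u)"
    and G_per: "\<forall>t u. G (t + T) u = G t u"
    and G_C2: "C2_in_u G"
    and A_cont: "continuous_on UNIV A" and A_per: "\<forall>t. A (t + T) = A t"
    and A_sym: "\<forall>t. transpose (A t) = A t"
    and B_cont: "continuous_on UNIV B" and B_per: "\<forall>t. B (t + T) = B t"
    and B_diag: "\<forall>t i j. i \<noteq> j \<longrightarrow> B t $ i $ j = 0"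
    and p_range: "\<forall>i. 1 \<le> p i"
    and hess_bounds: "\<forall>t u. loewner_le (A t) (partial_hess G t u) \<and> loewner_le (partial_hess G t u) (B t)"
    and A_int_pos: "\<forall>k. k \<noteq> 0 \<longrightarrow> integral {0..T} (\<lambda>t. (A t *v k) \<bullet> k) > 0"
    and b_bound: "\<forall>i. (if p i = 1
        then Lp_norm (p i) T (\<lambda>t. max (B t $ i $ i) 0) \<le> beta_per (p i) T
        else Lp_norm (p i) T (\<lambda>t. max (B t $ i $ i) 0) < beta_per (p i) T)"
  shows "\<exists>!u. is_periodic_solution G T u"
proof -
  obtain CA where CA: "0 \<le> CA" "\<And>t. norm (A t) \<le> CA"
    using periodic_continuous_bounded[OF T_pos A_cont] A_per by blast
  obtain CB where CB: "0 \<le> CB" "\<And>t. norm (B t) \<le> CB"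
    using periodic_continuous_bounded[OF T_pos B_cont] B_per by blast
  \<comment> \<open>One constant that bounds the quadratic forms of \<open>A t\<close> and
    \<open>B t\<close> for all \<open>t\<close>; the dimension factor is the one in
    \<open>matrix_quadratic_form_bound\<close>.\<close>
  define M where "M = real CARD('n) * (CA + CB)"
  have M: "0 \<le> M" using CA CB by (simp add: M_def)
  have form: "\<bar>x \<bullet> (D *v x)\<bar> \<le> M * (norm x)\<^sup>2" if "norm D \<le> CA + CB" for D :: "real^'n^'n" and x
  proof -
    have "\<bar>x \<bullet> (D *v x)\<bar> \<le> real CARD('n) * norm D * (norm x)\<^sup>2" by (rule matrix_quadratic_form_bound)
    also have "\<dots> \<le> M * (norm x)\<^sup>2"
      unfolding M_def using that by (intro mult_right_mono mult_left_mono) auto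
    finally show ?thesis .
  qed
  have hess: "loewner_le (A t) (partial_hess G t u) \<and> loewner_le (partial_hess G t u) (B t)" for t u
    using hess_bounds by blast
  have lip: "norm (partial_grad G t x - partial_grad G t y) \<le> M * norm (x - y)" for t x y
    by (rule gradient_Lipschitz[OF G_C2 hess form form])
       (use CA(2)[of t] CB(2)[of t] CA(1) CB(1) in linarith)+
  have sys: "periodic_system (partial_grad G) A B T M"
  proof (rule periodic_system.intro[OF T_pos M lip _ _ A_cont B_cont])
    show "continuous_on UNIV (\<lambda>t. partial_grad G t x)" for x
      by (rule gradient_continuous_in_t[OF G_C2 G_cont M lip])
    show "partial_grad G (t + T) = partial_grad G t" for t
      by (rule partial_grad_periodic[OF G_per])
    show "(partial_grad G t x - partial_grad G t y) \<bullet> (x - y) + 2 * ((partial_grad G t x - partial_grad G t y) \<bullet> k)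
      \<le> (x - y + k) \<bullet> (B t *v (x - y + k)) - (A t *v k) \<bullet> k" for t x y k
      by (rule gradient_increment_bound[OF G_C2 hess])
    show "w t = 0 \<and> v t = 0"
      if w: "C1_on 0 T w v" "w 0 = w T"
        and ineq: "\<And>k. integral {0..T} (\<lambda>t. v t \<bullet> v t)
        \<le> integral {0..T} (\<lambda>t. (w t + k) \<bullet> (B t *v (w t + k))) - integral {0..T} (\<lambda>t. (A t *v k) \<bullet> k)"
        and t: "t \<in> {0..T}" for w v t
      using vector_inequality_imp_zero[OF T_pos B_cont B_per[rule_format] B_diag[rule_format]
          p_range[rule_format] b_bound[rule_format] A_int_pos[rule_format] w ineq t] by blast
  qed
  interpret periodic_system "partial_grad G" A B T M by (rule sys)
  obtain z where z: "solves z" "z 0 = z T" and uniq: "\<And>y. solves y \<Longrightarrow> y 0 = y T \<Longrightarrow> y = z"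
    using periodic_solution_unique_exists by blast
  show ?thesis
  proof (rule ex1I[of _ "\<lambda>t. fst (z t)"])
    show "is_periodic_solution G T (\<lambda>t. fst (z t))"
      unfolding is_periodic_solution_iff[OF sys] using z by blast
    fix u assume "is_periodic_solution G T u"
    then obtain y where "solves y" "y 0 = y T" "u = (\<lambda>t. fst (y t))"
      unfolding is_periodic_solution_iff[OF sys] by blast
    then show "u = (\<lambda>t. fst (z t))" using uniq by blast
  qed
qed

end
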